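(* Let $f\in C^2$, $f''>0$, $\bar u_l<\bar u_r$, and let $w_0\in L^\infty(\mathbb{R})$ be $p$-periodic with zero average and satisfy $\int_0^x w_0(y)\,dy\ge 0$ for $0\le x\le p$. Let $u$ be the entropy solution of $u_t+f(u)_x=0$ with data $\bar u_l+w_0(x)$ for $x<0$ and $\bar u_r+w_0(x)$ for $x>0$, and $u_l,u_r$ the entropy solutions with data $\bar u_l+w_0$, $\bar u_r+w_0$ on $\mathbb{R}$. Then for $t>0$, $$u(x,t)=\begin{cases}u_l(x,t),& x/t<f'(\bar u_l),\\ (f')^{-1}(x/t),& f'(\bar u_l)\le x/t\le f'(\bar u_r),\\ u_r(x,t),& x/t>f'(\bar u_r).\end{cases}$$
   Context: Entropy solutions of the scalar conservation law with $L^\infty$ initial data. *)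

theory Defs
  imports "HOL-Analysis.Analysis"
begin

definition test_fun ::
  "(real \<times> real \<Rightarrow> real) \<Rightarrow> (real \<times> real \<Rightarrow> real) \<Rightarrow> (real \<times> real \<Rightarrow> real) \<Rightarrow> bool" where
  "test_fun ph phx pht \<longleftrightarrow>
     (\<forall>z. (ph has_derivative (\<lambda>(h, k). phx z * h + pht z * k)) (at z)) \<and>
     continuous_on UNIV phx \<and> continuous_on UNIV pht \<and>
     (\<exists>R. \<forall>z. norm z > R \<longrightarrow> ph z = 0) \<and>
     (\<forall>z. ph z \<ge> 0)"

definition Linfty :: "(real \<Rightarrow> real) \<Rightarrow> bool" where
  "Linfty g \<longleftrightarrow> g \<in> borel_measurable lborel \<and> (\<exists>B. AE x in lborel. \<bar>g x\<bar> \<le> B)"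

text \<open>Kruzkov entropy solution of u_t + f(u)_x = 0 on R x (0,oo) with initial data u0:
  u is measurable and essentially bounded on t > 0, and for every constant k and every
  nonnegative test function ph on R x [0,oo)
   int_{t>0} |u-k| ph_t + sgn(u-k)(f u - f k) ph_x dx dt + int |u0 - k| ph(x,0) dx >= 0.\<close>
definition entropy_solution ::
  "(real \<Rightarrow> real) \<Rightarrow> (real \<Rightarrow> real) \<Rightarrow> (real \<Rightarrow> real \<Rightarrow> real) \<Rightarrow> bool" where
  "entropy_solution f u0 u \<longleftrightarrow>
     (\<lambda>z. u (fst z) (snd z)) \<in> borel_measurable lborel \<and>
     (\<exists>B. AE z in lborel. snd z > 0 \<longrightarrow> \<bar>u (fst z) (snd z)\<bar> \<le> B) \<and>
     (\<forall>k ph phx pht. test_fun ph phx pht \<longrightarrow>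
        (LINT z : {z. snd z > 0} | lborel.
            \<bar>u (fst z) (snd z) - k\<bar> * pht z
          + sgn (u (fst z) (snd z) - k) * (f (u (fst z) (snd z)) - f k) * phx z)
        + (LINT x | lborel. \<bar>u0 x - k\<bar> * ph (x, 0)) \<ge> 0)"

end

theory Submission
  imports Defs "HOL-Probability.Probability_Measure"
begin

text \<open>
  The proof passes to the Hamilton--Jacobi potential \<open>U\<close> with \<open>U\<^sub>x = u\<close>, \<open>U\<^sub>t = - f u\<close>,
  which is Lipschitz because an entropy solution is in particular a weak solution.  Kruzkov's
  inequality, tested with the squared positive part of \<open>\<phi> - U\<close> near a contact point, makes \<open>U\<close> a viscosity
  supersolution of \<open>U\<^sub>t + f U\<^sub>x = 0\<close>, while by Jensen's inequality the box averages of \<open>U\<close> are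
  smooth subsolutions.  Hence potentials obey a comparison principle, and no doubling of variables
  is needed.

  As the primitive of \<open>w0\<close> is nonnegative, the data of \<open>U\<close> lie above the line \<open>k x\<close> for every
  \<open>k\<close> in \<open>[ul, ur]\<close>; so \<open>U \<ge> k x - f k t\<close>, with equality on the ray \<open>x = f' k t\<close> by the
  upper bound along characteristics.  This determines \<open>U\<close> in the fan, and in the same way the
  potentials of \<open>uL\<close> and \<open>uR\<close> agree with \<open>U\<close> on the two bounding rays.  Comparison on each side of the
  fan shows that they agree with \<open>U\<close> there.
\<close>

section \<open>Box averages\<close>

text \<open>The box sits in the open quadrant to the right of and after its base point. Averages
  taken at times \<ge> 0 therefore see only positive times, where the flux is \<open>f\<close> of
  the slope, and Jensen's inequality is available up to the initial line without a boundary layer.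
  Initial data enter by extending a solution to the past by its data, constant in time, with zero
  flux. The initial term of the weak formulation then becomes an integral over the past, the
  extended field is divergence free on the whole plane, and its potential exists globally with
  explicit values at times \<le> 0. Slopes are defined only almost everywhere, potentials
  everywhere. Since a potential is Lipschitz, its averages are uniformly close to it, which makes
  them usable as comparison functions; slopes are recovered from the potentials by Lebesgue
  differentiation of averages.\<close>

definition unif :: "real \<Rightarrow> (real \<times> real) measure" where
  "unif e = uniform_measure lborel (box 0 (e, e))"

text \<open>An expectation over a random translation, so that bounds, Jensen's inequality and Fubini
  come from probability spaces.\<close>

definition avg :: "real \<Rightarrow> (real \<times> real \<Rightarrow> real) \<Rightarrow> real \<times> real \<Rightarrow> real" where
  "avg e g z = (LINT w|unif e. g (z + w))"

lemma mem_box_zero_pair: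
  "w \<in> box 0 (e, e) \<longleftrightarrow> 0 < fst w \<and> fst w < e \<and> 0 < snd w \<and> snd w < (e::real)"
  by (cases w) (auto simp: box_def Basis_prod_def inner_prod_def zero_prod_def)

lemma norm_le_box_zero_pair:
  "w \<in> box 0 (e, e) \<Longrightarrow> norm w \<le> 2 * (e::real)"
  using norm_Pair_le[of "fst w" "snd w"] by (simp add: mem_box_zero_pair)

lemma emeasure_box_zero_pair:
  assumes "e > 0"
  shows "emeasure lborel (box (0::real\<times>real) (e, e)) = ennreal (e * e)"
  using assms by (subst emeasure_lborel_box) (auto simp: Basis_prod_def inner_prod_def zero_prod_def
      prod.union_disjoint prod.insert_if)

lemma sets_unif [measurable_cong]: "sets (unif e) = sets borel"
  by (simp add: unif_def uniform_measure_def)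

lemma space_unif [simp]: "space (unif e) = UNIV"
  by (simp add: unif_def uniform_measure_def)

lemma prob_space_unif: "e > 0 \<Longrightarrow> prob_space (unif e)"
  unfolding unif_def
  by (rule prob_space_uniform_measure) (auto simp: emeasure_box_zero_pair)

lemma AE_unif: "e > 0 \<Longrightarrow> AE w in unif e. w \<in> box 0 (e, e)"
  unfolding unif_def by (rule AE_uniform_measureI) auto

lemma integrable_unif:
  fixes g :: "real \<times> real \<Rightarrow> real"
  assumes e: "e > 0" and [measurable]: "g \<in> borel_measurable borel"
    and B: "\<And>w. w \<in> box 0 (e, e) \<Longrightarrow> \<bar>g w\<bar> \<le> B"
  shows "integrable (unif e) g"
proof -
  interpret prob_space "unif e" using e by (rule prob_space_unif)
  show ?thesis
    by (rule integrable_const_bound[of _ B]) (use AE_unif[OF e] B in \<open>auto\<close>)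
qed

lemma integrable_avg:
  fixes g :: "real \<times> real \<Rightarrow> real"
  assumes "e > 0" and [measurable]: "g \<in> borel_measurable borel"
    and "\<And>w. w \<in> box 0 (e, e) \<Longrightarrow> \<bar>g (z + w)\<bar> \<le> B"
  shows "integrable (unif e) (\<lambda>w. g (z + w))"
  by (rule integrable_unif[of _ _ B]) (use assms in auto)

lemma avg_between:
  assumes e: "e > 0" and [measurable]: "g \<in> borel_measurable borel"
    and B: "\<And>w. w \<in> box 0 (e, e) \<Longrightarrow> c \<le> g (z + w) \<and> g (z + w) \<le> d"
  shows "c \<le> avg e g z \<and> avg e g z \<le> d"
proof -
  interpret prob_space "unif e" using e by (rule prob_space_unif)
  have i: "integrable (unif e) (\<lambda>w. g (z + w))"
    by (rule integrable_avg[of _ _ _ "\<bar>c\<bar> + \<bar>d\<bar>"]) (use e B in force)+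
  have ae: "AE w in unif e. c \<le> g (z + w)" "AE w in unif e. g (z + w) \<le> d"
    using AE_unif[OF e] B by auto
  show ?thesis
    using integral_ge_const[OF i ae(1)] integral_le_const[OF i ae(2)] by (simp add: avg_def)
qed

lemma avg_near:
  assumes e: "e > 0" and "g \<in> borel_measurable borel"
    and B: "\<And>w. w \<in> box 0 (e, e) \<Longrightarrow> \<bar>g (z + w) - c\<bar> \<le> d"
  shows "\<bar>avg e g z - c\<bar> \<le> d"
proof -
  have "c - d \<le> avg e g z \<and> avg e g z \<le> c + d"
    by (rule avg_between) (use assms in \<open>force simp: abs_le_iff\<close>)+
  then show ?thesis by auto
qed

lemma avg_bound:
  assumes "e > 0" and "g \<in> borel_measurable borel" and "\<And>w. \<bar>g w\<bar> \<le> B"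
  shows "\<bar>avg e g z\<bar> \<le> B"
  using avg_near[of e g z 0 B] assms by auto

lemma avg_cong_AE:
  assumes e: "e > 0" and [measurable]: "g \<in> borel_measurable borel" "h \<in> borel_measurable borel"
    and ae: "AE w in lborel. w - z \<in> box 0 (e, e) \<longrightarrow> g w = h w"
  shows "avg e g z = avg e h z"
proof -
  have "AE w in distr lborel borel ((+) z). w - z \<in> box 0 (e, e) \<longrightarrow> g w = h w"
    using ae by (subst lborel_distr_plus)
  moreover have [measurable]: "Measurable.pred borel (\<lambda>w. w - z \<in> box 0 (e, e) \<longrightarrow> g w = h w)"
    by measurable
  ultimately have "AE w in lborel. w \<in> box 0 (e, e) \<longrightarrow> g (z + w) = h (z + w)"
    by (subst (asm) AE_distr_iff) auto
  then have "AE w in unif e. g (z + w) = h (z + w)"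
    unfolding unif_def by (intro AE_uniform_measureI) auto
  then show ?thesis unfolding avg_def by (intro integral_cong_AE) auto
qed

lemma avg_lborel:
  assumes e: "e > 0" and [measurable]: "g \<in> borel_measurable borel"
  shows "avg e g z = (LINT w|lborel. g w * indicator (box 0 (e, e)) (w - z)) / (e * e)"
proof -
  have *: "(LINT w|lborel. g w * indicator (box 0 (e, e)) (w - z)) =
     (LINT w|lborel. g (z + w) * indicator (box 0 (e, e)) w)"
    by (subst lborel_distr_plus[symmetric, of z], subst integral_distr) auto
  have "unif e = density lborel (\<lambda>x. ennreal (indicator (box 0 (e, e)) x / (e * e)))"
    unfolding unif_def uniform_measure_def using e
    by (intro arg_cong[where f="density lborel"] ext)
      (auto simp: emeasure_box_zero_pair indicator_def divide_ennreal[symmetric])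
  then have "avg e g z = (LINT w|lborel. (indicator (box 0 (e, e)) w / (e * e)) * g (z + w))"
    using e by (simp add: avg_def integral_density)
  also have "\<dots> = (LINT w|lborel. (g (z + w) * indicator (box 0 (e, e)) w) / (e * e))"
    by (simp add: mult.commute)
  finally show ?thesis unfolding * by simp
qed

lemma avg_measurable:
  assumes e: "e > 0" and [measurable]: "g \<in> borel_measurable borel"
  shows "avg e g \<in> borel_measurable borel"
proof -
  interpret prob_space "unif e" using e by (rule prob_space_unif)
  show ?thesis unfolding avg_def by measurable
qed

text \<open>Fubini for two independent translations. With \<open>N\<close> another box it makes
  averages commute; with \<open>N\<close> uniform on the unit interval it moves an average inside an
  integral along a segment.\<close>

lemma avg_integral_commute:
  fixes G :: "real \<times> real \<Rightarrow> real" and \<phi> :: "'s \<Rightarrow> real \<times> real"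
  assumes e: "e > 0" and N: "prob_space N" and [measurable]: "\<phi> \<in> N \<rightarrow>\<^sub>M borel"
    "G \<in> borel_measurable borel" and B: "\<And>w. \<bar>G w\<bar> \<le> B"
  shows "avg e (\<lambda>z. LINT s|N. G (z + \<phi> s)) z = (LINT s|N. avg e G (z + \<phi> s))"
proof -
  interpret e: prob_space "unif e" using e by (rule prob_space_unif)
  interpret N: prob_space N by fact
  interpret P: pair_prob_space "unif e" N ..
  have "integrable (unif e \<Otimes>\<^sub>M N) (\<lambda>(w, s). G (z + w + \<phi> s))"
    by (rule P.P.integrable_const_bound[of _ B], rule AE_I2) (use B in \<open>auto split: prod.split\<close>)
  from P.Fubini_integral[OF this] show ?thesis
    unfolding avg_def by (simp add: ac_simps)
qed

lemma avg_commute: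
  assumes "e > 0" "d > 0" "g \<in> borel_measurable borel" "\<And>w. \<bar>g w\<bar> \<le> B"
  shows "avg e (avg d g) z = avg d (avg e g) z"
  using avg_integral_commute[OF assms(1) prob_space_unif[OF assms(2)], of "\<lambda>w. w" g B z] assms
  unfolding avg_def[of d] by simp

text \<open>The frontier of a convex set is negligible; its translate is closed, hence Borel, so the
  null set passes from Lebesgue measure to \<open>lborel\<close>.\<close>

lemma AE_not_frontier_box:
  "AE w in lborel. w - z \<notin> frontier (box (0::real\<times>real) (e, e))"
proof -
  have "(+) z ` frontier (box (0::real\<times>real) (e, e)) \<in> null_sets lebesgue"
    by (intro negligible_translation[unfolded negligible_iff_null_sets]
        negligible_convex_frontier[unfolded negligible_iff_null_sets]) simp
  moreover have "closed ((+) z ` frontier (box (0::real\<times>real) (e, e)))"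
    by (intro closed_translation) simp
  ultimately have "(+) z ` frontier (box (0::real\<times>real) (e, e)) \<in> null_sets lborel"
    by (metis null_sets_completion_iff borel_closed sets_lborel)
  then have "AE w in lborel. w \<notin> (+) z ` frontier (box (0::real\<times>real) (e, e))"
    by (rule AE_not_in)
  then show ?thesis
    by (rule AE_mp) (auto intro!: AE_I2, metis add_diff_cancel_left' add.commute diff_add_cancel image_eqI)
qed

text \<open>As \<open>g\<close> is merely bounded and measurable, the translation is moved from
  \<open>g\<close> to the box: indicators of the moving box converge off the frontier of the
  limiting one, and dominated convergence applies.\<close>

lemma continuous_avg:
  assumes e: "e > 0" and [measurable]: "g \<in> borel_measurable borel" and B: "\<And>w. \<bar>g w\<bar> \<le> B"
  shows "continuous_on UNIV (avg e g)"
proof -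
  let ?Q = "box (0::real\<times>real) (e, e)"
  have "(\<lambda>n. avg e g (X n)) \<longlonglongrightarrow> avg e g x" if X: "X \<longlonglongrightarrow> x" for X x
  proof -
    obtain C where C: "\<And>n. norm (X n) \<le> C"
      using X by (metis convergentI convergent_imp_Bseq BseqE)
    \<comment> \<open>\<open>C\<close> bounds the base points and \<open>2 * e\<close> the points of
      a box, so one ball contains all the moving boxes and provides the majorant.\<close>
    let ?K = "cball (0::real\<times>real) (C + 2 * e)"
    have "(\<lambda>n. LINT w|lborel. g w * indicator ?Q (w - X n)) \<longlonglongrightarrow> (LINT w|lborel. g w * indicator ?Q (w - x))"
    proof (rule integral_dominated_convergence[where w="\<lambda>w. \<bar>B\<bar> * indicator ?K w"])
      show "integrable lborel (\<lambda>w. \<bar>B\<bar> * indicat_real ?K w)"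
        by (intro integrable_mult_right integrable_real_indicator) (use emeasure_lborel_cball_finite[of "0::real\<times>real" "C + 2 * e"] in auto)
      show "AE w in lborel. (\<lambda>n. g w * indicat_real ?Q (w - X n)) \<longlonglongrightarrow> g w * indicat_real ?Q (w - x)"
        using AE_not_frontier_box[of x e]
      proof (rule AE_mp, intro AE_I2 impI tendsto_mult tendsto_const)
        fix w assume w: "w - x \<notin> frontier ?Q"
        have l: "(\<lambda>n. w - X n) \<longlonglongrightarrow> w - x" by (intro tendsto_intros X)
        show "(\<lambda>n. indicat_real ?Q (w - X n)) \<longlonglongrightarrow> indicat_real ?Q (w - x)"
        proof (cases "w - x \<in> ?Q")
          case True
          then have "eventually (\<lambda>n. w - X n \<in> ?Q) sequentially"
            using l open_box topological_tendstoD by blast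
          then show ?thesis using True by (intro tendsto_eventually) (auto elim: eventually_mono)
        next
          case False
          then have "w - x \<in> - closure ?Q" using w interior_subset[of ?Q] unfolding frontier_def by blast
          then have "eventually (\<lambda>n. w - X n \<in> - closure ?Q) sequentially"
            by (intro topological_tendstoD[OF l]) auto
          then have "eventually (\<lambda>n. w - X n \<notin> ?Q) sequentially"
            by (rule eventually_mono) (use closure_subset in blast)
          then show ?thesis using False by (intro tendsto_eventually) (auto elim: eventually_mono)
        qed
      qed
      fix n
      show "AE w in lborel. norm (g w * indicat_real ?Q (w - X n)) \<le> \<bar>B\<bar> * indicat_real ?K w"
      proof (intro AE_I2)
        fix w
        show "norm (g w * indicat_real ?Q (w - X n)) \<le> \<bar>B\<bar> * indicat_real ?K w"
        proof (cases "w - X n \<in> ?Q")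
          case True
          then have "norm w \<le> C + 2 * e"
            using norm_le_box_zero_pair[OF True] C[of n] norm_triangle_ineq[of "X n" "w - X n"] by simp
          then show ?thesis using True B[of w] by simp
        qed auto
      qed
    qed auto
    then show ?thesis unfolding avg_lborel[OF e assms(2)] using e by (intro tendsto_divide) auto
  qed
  then show ?thesis
    by (auto simp: continuous_on_sequentially o_def)
qed

text \<open>Lebesgue's differentiation theorem for cubes whose lower corner is the point itself,
  which is exactly the shape of the averaging box.\<close>

lemma AE_avg_tendsto:
  assumes [measurable]: "g \<in> borel_measurable borel" and B: "\<And>w. \<bar>g w\<bar> \<le> B"
  shows "AE z in lborel. ((\<lambda>e. avg e g z) \<longlongrightarrow> g z) (at_right 0)"
proof -
  have "set_integrable lborel (cbox a b) g" for a b
    unfolding set_integrable_def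
    by (rule integrableI_bounded_set_indicator[of _ _ _ B])
      (use B emeasure_lborel_cbox_finite[of a b] in auto)
  then have si: "g integrable_on cbox a b" for a b
    by (rule set_borel_integral_eq_integral(1))
  obtain N where N: "negligible N" and H: "\<And>x e. \<lbrakk>x \<notin> N; 0 < e\<rbrakk> \<Longrightarrow>
       \<exists>d>0. \<forall>h. 0 < h \<and> h < d \<longrightarrow> norm (integral (cbox x (x + h *\<^sub>R One)) g /\<^sub>R h ^ DIM(real\<times>real) - g x) < e"
    using integrable_ccontinuous_explicit[OF si] by blast
  have eq: "integral (cbox x (x + h *\<^sub>R One)) g /\<^sub>R h ^ DIM(real\<times>real) = avg h g x" if h: "h > 0" for h x
  proof -
    have One: "h *\<^sub>R One = (h, h)" by (auto simp: Basis_prod_def algebra_simps sum.union_disjoint sum.insert_if)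
    have i: "set_integrable lborel (box x (x + (h, h))) g"
      unfolding set_integrable_def
      by (rule integrableI_bounded_set_indicator[of _ _ _ B])
        (use B emeasure_lborel_box_finite[of x "x + (h, h)"] in auto)
    have "integral (cbox x (x + h *\<^sub>R One)) g = integral (box x (x + (h, h))) g"
      unfolding One by (simp add: integral_open_interval)
    also have "\<dots> = (LINT w:box x (x + (h, h))|lborel. g w)"
      using set_borel_integral_eq_integral(2)[OF i] by simp
    also have "\<dots> = (LINT w|lborel. g w * indicator (box 0 (h, h)) (w - x))"
    proof -
      have "w \<in> box x (x + (h, h)) \<longleftrightarrow> w - x \<in> box 0 (h, h)" for w
        unfolding mem_box_zero_pair
        by (cases w; cases x) (auto simp: box_def Basis_prod_def inner_prod_def)
      then show ?thesis unfolding set_lebesgue_integral_def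
        by (intro Bochner_Integration.integral_cong) (auto simp: indicator_def)
    qed
    finally show ?thesis using avg_lborel[OF h assms(1), of x] by (simp add: power2_eq_square field_simps)
  qed
  have "((\<lambda>e. avg e g z) \<longlongrightarrow> g z) (at_right 0)" if z: "z \<notin> N" for z
  proof (rule tendstoI)
    fix r :: real assume "r > 0"
    from H[OF z this] obtain d where "d > 0" "\<forall>h. 0 < h \<and> h < d \<longrightarrow> norm (integral (cbox z (z + h *\<^sub>R One)) g /\<^sub>R h ^ DIM(real\<times>real) - g z) < r"
      by blast
    then have "\<forall>h>0. h < d \<longrightarrow> dist (avg h g z) (g z) < r" using eq by (simp add: dist_norm)
    with \<open>d > 0\<close> show "\<forall>\<^sub>F e in at_right 0. dist (avg e g z) (g z) < r"
      by (auto simp: eventually_at_right_field)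
  qed
  then have "AE z in lebesgue. ((\<lambda>e. avg e g z) \<longlongrightarrow> g z) (at_right 0)"
    using N unfolding negligible_iff_null_sets by (intro AE_I'[of N]) auto
  then show ?thesis by (simp add: AE_completion_iff)
qed

section \<open>Potentials of bounded plane fields\<close>

text \<open>The l1 norm of the displacement is dual to the separate bounds \<open>M\<close> on the
  two components of the gradient, so that \<open>M\<close> itself is a Lipschitz constant.\<close>

definition lip_const :: "real \<Rightarrow> (real \<times> real \<Rightarrow> real) \<Rightarrow> bool" where
  "lip_const M F \<longleftrightarrow> (\<forall>z v. \<bar>F (z + v) - F z\<bar> \<le> M * (\<bar>fst v\<bar> + \<bar>snd v\<bar>))"

lemma lip_constD: "lip_const M F \<Longrightarrow> \<bar>F (z + v) - F z\<bar> \<le> M * (\<bar>fst v\<bar> + \<bar>snd v\<bar>)"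
  unfolding lip_const_def by blast

lemma lip_const_nonneg:
  assumes "lip_const M F" shows "0 \<le> M"
  using lip_constD[OF assms, of 0 "(1, 0)"] by simp

lemma lip_const_diff_le: "lip_const M F \<Longrightarrow> \<bar>F z - F z'\<bar> \<le> M * (\<bar>fst z - fst z'\<bar> + \<bar>snd z - snd z'\<bar>)"
  using lip_constD[of M F z' "z - z'"] by simp

lemma lip_const_dist:
  assumes "lip_const M F" shows "\<bar>F z - F z'\<bar> \<le> 2 * M * norm (z - z')"
proof -
  have "\<bar>fst z - fst z'\<bar> + \<bar>snd z - snd z'\<bar> \<le> 2 * norm (z - z')"
    using norm_fst_le[of "fst (z - z')" "snd (z - z')"] norm_snd_le[of "snd (z - z')" "fst (z - z')"]
    unfolding prod.collapse by simp
  from mult_left_mono[OF this lip_const_nonneg[OF assms]] show ?thesis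
    using lip_const_diff_le[OF assms, of z z'] by (simp only: mult.assoc mult.left_commute[of M])
qed

lemma lip_const_continuous:
  assumes "lip_const M F" shows "continuous_on UNIV F"
proof -
  have "(2 * M)-lipschitz_on UNIV F"
    using lip_const_dist[OF assms] lip_const_nonneg[OF assms]
    by (intro lipschitz_onI) (auto simp: dist_norm)
  then show ?thesis by (rule lipschitz_on_continuous_on)
qed

lemma lip_const_measurable: "lip_const M F \<Longrightarrow> F \<in> borel_measurable borel"
  by (intro borel_measurable_continuous_onI lip_const_continuous)

lemma lip_const_box:
  assumes "lip_const M F" "w \<in> box 0 (e, e)"
  shows "\<bar>F (z + w) - F z\<bar> \<le> 2 * M * e"
proof -
  have "\<bar>fst w\<bar> + \<bar>snd w\<bar> \<le> 2 * e" using assms(2) by (simp add: mem_box_zero_pair)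
  from mult_left_mono[OF this lip_const_nonneg[OF assms(1)]] lip_constD[OF assms(1), of z w]
  show ?thesis by simp
qed

lemma lip_const_avg_near:
  assumes "lip_const M F" "e > 0"
  shows "\<bar>avg e F z - F z\<bar> \<le> 2 * M * e"
  by (rule avg_near) (use assms lip_const_measurable lip_const_box in auto)

lemma lip_const_avg_integrable:
  assumes "lip_const M F" "e > 0"
  shows "integrable (unif e) (\<lambda>w. F (z + w))"
  by (rule integrable_avg[of _ _ _ "\<bar>F z\<bar> + 2 * M * e"])
    (use assms lip_const_measurable[OF assms(1)] lip_const_box[OF assms(1), of _ e z] in \<open>auto, smt (verit)\<close>)

lemma avg_diff:
  assumes "integrable (unif e) (\<lambda>w. F (z + w))" "integrable (unif e) (\<lambda>w. G (z + w))"
  shows "avg e (\<lambda>z. F z - G z) z = avg e F z - avg e G z"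
  using assms by (simp add: avg_def)

lemma avg_shift: "avg e (\<lambda>z. F (z + v)) z = avg e F (z + v)"
  by (simp add: avg_def ac_simps)

section \<open>Increments along segments and potentials from averaged potentials\<close>

definition unit_meas :: "real measure" where
  "unit_meas = uniform_measure lborel {0..1}"

lemma sets_unit_meas [measurable_cong]: "sets unit_meas = sets borel"
  by (simp add: unit_meas_def uniform_measure_def)

lemma space_unit_meas [simp]: "space unit_meas = UNIV"
  by (simp add: unit_meas_def uniform_measure_def)

lemma prob_space_unit_meas: "prob_space unit_meas"
  unfolding unit_meas_def by (rule prob_space_uniform_measure) auto

lemma integral_unit_meas:
  assumes [measurable]: "g \<in> borel_measurable borel"
  shows "(LINT s|unit_meas. g s) = (LINT s|lborel. indicator {0..1} s *\<^sub>R (g s :: real))"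
proof -
  have "unit_meas = density lborel (\<lambda>s. ennreal (indicator {0..1} s))"
    unfolding unit_meas_def uniform_measure_def
    by (intro arg_cong[where f="density lborel"] ext) (auto simp: indicator_def)
  then have "(LINT s|unit_meas. g s) = (LINT s|density lborel (\<lambda>s. ennreal (indicator {0..1} s)). g s)"
    by simp
  then show ?thesis by (subst (asm) integral_density) auto
qed

text \<open>The fundamental theorem of calculus along the segment; the integral is an expectation,
  so that averages can be interchanged with it.\<close>

lemma increment_eq_integral:
  fixes F :: "real \<times> real \<Rightarrow> real"
  assumes D: "\<And>z. (F has_derivative (\<lambda>(h, k). A z * h + B z * k)) (at z)"
    and cA: "continuous_on UNIV A" and cB: "continuous_on UNIV B"
  shows "F (z + v) - F z = (LINT s|unit_meas. A (z + s *\<^sub>R v) * fst v + B (z + s *\<^sub>R v) * snd v)"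
proof -
  let ?g = "\<lambda>s. A (z + s *\<^sub>R v) * fst v + B (z + s *\<^sub>R v) * snd v"
  have c: "continuous_on UNIV ?g"
    by (intro continuous_intros continuous_on_compose2[OF cA] continuous_on_compose2[OF cB]) auto
  have "((\<lambda>s. F (z + s *\<^sub>R v)) has_vector_derivative ?g s) (at s within {0..1})" for s
  proof -
    have "((\<lambda>s. z + s *\<^sub>R v) has_derivative (\<lambda>h. h *\<^sub>R v)) (at s within {0..1})"
      by (auto intro!: derivative_eq_intros)
    from has_derivative_compose[OF this D]
    show ?thesis unfolding has_vector_derivative_def
      by (rule has_derivative_eq_rhs) (auto simp: fun_eq_iff split_beta algebra_simps)
  qed
  then have "(LINT s|lborel. indicator {0..1} s *\<^sub>R ?g s) = F (z + 1 *\<^sub>R v) - F (z + 0 *\<^sub>R v)"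
    using c by (intro integral_FTC_atLeastAtMost) (auto intro: continuous_on_subset)
  then show ?thesis
    using c by (subst integral_unit_meas) (auto intro: borel_measurable_continuous_onI)
qed

text \<open>Says that the weak gradient of \<open>U\<close> is \<open>(a, - b)\<close>, without
  distributions: every average of \<open>U\<close> is differentiable with the averaged field as
  gradient.\<close>

definition potential :: "real \<Rightarrow> (real \<times> real \<Rightarrow> real) \<Rightarrow> (real \<times> real \<Rightarrow> real) \<Rightarrow> (real \<times> real \<Rightarrow> real) \<Rightarrow> bool" where
  "potential M a b U \<longleftrightarrow> lip_const M U \<and>
     (\<forall>e>0. \<forall>z. (avg e U has_derivative (\<lambda>(h, k). avg e a z * h - avg e b z * k)) (at z))"

locale bounded_field =
  fixes M :: real and a b :: "real \<times> real \<Rightarrow> real"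
  assumes a_meas [measurable]: "a \<in> borel_measurable borel"
    and b_meas [measurable]: "b \<in> borel_measurable borel"
    and a_bound: "\<bar>a z\<bar> \<le> M" and b_bound: "\<bar>b z\<bar> \<le> M"
begin

lemma M_nonneg: "0 \<le> M" using a_bound[of 0] by linarith

definition pairing :: "real \<times> real \<Rightarrow> real \<times> real \<Rightarrow> real" where
  "pairing v z = a z * fst v - b z * snd v"

lemma pairing_measurable [measurable]: "pairing v \<in> borel_measurable borel"
  unfolding pairing_def by measurable

lemma pairing_bound: "\<bar>pairing v z\<bar> \<le> M * (\<bar>fst v\<bar> + \<bar>snd v\<bar>)"
proof -
  have "\<bar>pairing v z\<bar> \<le> \<bar>a z\<bar> * \<bar>fst v\<bar> + \<bar>b z\<bar> * \<bar>snd v\<bar>"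
    unfolding pairing_def by (metis abs_mult abs_triangle_ineq4)
  also have "\<dots> \<le> M * \<bar>fst v\<bar> + M * \<bar>snd v\<bar>"
    by (intro add_mono mult_right_mono a_bound b_bound) auto
  finally show ?thesis by (simp add: algebra_simps)
qed

lemma avg_pairing:
  assumes "e > 0" shows "avg e (pairing v) z = avg e a z * fst v - avg e b z * snd v"
  unfolding pairing_def avg_def
  by (subst Bochner_Integration.integral_diff)
    (auto intro!: integrable_mult_left integrable_avg[of e _ z M] assms a_bound b_bound)

lemma increment_avg:
  assumes e: "e > 0" and D: "\<And>z. (F has_derivative (\<lambda>(h, k). avg e a z * h - avg e b z * k)) (at z)"
  shows "F (z + v) - F z = (LINT s|unit_meas. avg e (pairing v) (z + s *\<^sub>R v))"
proof -
  have "F (z + v) - F z = (LINT s|unit_meas. avg e a (z + s *\<^sub>R v) * fst v + - avg e b (z + s *\<^sub>R v) * snd v)"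
    by (rule increment_eq_integral)
      (use e D in \<open>auto intro!: continuous_avg[of _ _ M] continuous_intros a_bound b_bound\<close>)
  then show ?thesis using e by (simp add: avg_pairing)
qed

lemma integral_avg_pairing_bound:
  assumes "e > 0"
  shows "\<bar>LINT s|unit_meas. avg e (pairing v) (z + s *\<^sub>R v)\<bar> \<le> M * (\<bar>fst v\<bar> + \<bar>snd v\<bar>)"
proof -
  interpret prob_space unit_meas by (rule prob_space_unit_meas)
  have "\<bar>avg e (pairing v) w\<bar> \<le> M * (\<bar>fst v\<bar> + \<bar>snd v\<bar>)" for w
    by (rule avg_bound) (use assms pairing_bound in \<open>simp_all only: pairing_measurable\<close>)
  moreover have [measurable]: "avg e (pairing v) \<in> borel_measurable borel"
    using assms by (rule avg_measurable) simp
  ultimately have i: "integrable unit_meas (\<lambda>s. avg e (pairing v) (z + s *\<^sub>R v))"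
    by (intro integrable_const_bound[of _ "M * (\<bar>fst v\<bar> + \<bar>snd v\<bar>)"]) auto
  have "-(M * (\<bar>fst v\<bar> + \<bar>snd v\<bar>)) \<le> avg e (pairing v) w" "avg e (pairing v) w \<le> M * (\<bar>fst v\<bar> + \<bar>snd v\<bar>)" for w
    using \<open>\<And>w. \<bar>avg e (pairing v) w\<bar> \<le> _\<close>[of w] by linarith+
  then show ?thesis
    using integral_ge_const[OF i, of "-(M * (\<bar>fst v\<bar> + \<bar>snd v\<bar>))"] integral_le_const[OF i, of "M * (\<bar>fst v\<bar> + \<bar>snd v\<bar>)"]
    by (simp add: abs_le_iff)
qed

text \<open>The constant does not depend on \<open>e\<close>, so the bound survives the limit of
  vanishing width.\<close>

lemma lip_const_avg_potential:
  assumes "e > 0" "\<And>z. (F has_derivative (\<lambda>(h, k). avg e a z * h - avg e b z * k)) (at z)"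
  shows "lip_const M F"
  unfolding lip_const_def using increment_avg[OF assms] integral_avg_pairing_bound[OF assms(1)] by simp

text \<open>As averages commute, the right-hand side is symmetric in \<open>d\<close> and
  \<open>e\<close>; this symmetry allows potentials of different scales to be compared.\<close>

lemma increment_avg_avg:
  assumes e: "e > 0" and d: "d > 0"
    and D: "\<And>z. (F has_derivative (\<lambda>(h, k). avg e a z * h - avg e b z * k)) (at z)"
  shows "avg d F (z + v) - avg d F z = (LINT s|unit_meas. avg d (avg e (pairing v)) (z + s *\<^sub>R v))"
proof -
  have L: "lip_const M F" by (rule lip_const_avg_potential[OF e D])
  have "avg d F (z + v) - avg d F z = avg d (\<lambda>z. F (z + v) - F z) z"
    using lip_const_avg_integrable[OF L d, of "z + v"] lip_const_avg_integrable[OF L d, of z]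
    by (subst avg_diff) (auto simp: avg_shift ac_simps)
  also have "\<dots> = avg d (\<lambda>z. LINT s|unit_meas. avg e (pairing v) (z + s *\<^sub>R v)) z"
    by (simp add: increment_avg[OF e D])
  also have "\<dots> = (LINT s|unit_meas. avg d (avg e (pairing v)) (z + s *\<^sub>R v))"
    by (rule avg_integral_commute[where B="M * (\<bar>fst v\<bar> + \<bar>snd v\<bar>)"])
      (use e d in \<open>auto intro!: prob_space_unit_meas avg_measurable avg_bound pairing_bound\<close>)
  finally show ?thesis .
qed

text \<open>Normalised at the origin, the potentials \<open>F e\<close> are Cauchy as the scale
  shrinks, because \<open>F e\<close> averaged over \<open>d\<close> and \<open>F d\<close> averaged
  over \<open>e\<close> have equal increments. The Lipschitz limit \<open>U\<close> satisfies
  \<open>F d z = avg d U z - avg d U 0\<close>, so its averages inherit the gradient of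
  \<open>F d\<close>.\<close>

lemma potential_if_avg_potentials:
  assumes E: "\<And>e. e > 0 \<Longrightarrow> \<exists>F. \<forall>z. (F has_derivative (\<lambda>(h, k). avg e a z * h - avg e b z * k)) (at z)"
  shows "\<exists>U. potential M a b U \<and> U 0 = 0"
proof -
  have "\<exists>F. (\<forall>z. (F has_derivative (\<lambda>(h, k). avg e a z * h - avg e b z * k)) (at z)) \<and> F 0 = 0" if "e > 0" for e
  proof -
    from E[OF that] obtain F where "\<And>z. (F has_derivative (\<lambda>(h, k). avg e a z * h - avg e b z * k)) (at z)" by blast
    then have "((\<lambda>z. F z - F 0) has_derivative (\<lambda>(h, k). avg e a z * h - avg e b z * k)) (at z)" for z
      using has_derivative_diff[OF _ has_derivative_const, of F _ "at z" "F 0"] by (simp add: split_beta)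
    then show ?thesis by (intro exI[of _ "\<lambda>z. F z - F 0"]) simp
  qed
  then obtain F where D: "\<And>e z. e > 0 \<Longrightarrow> (F e has_derivative (\<lambda>(h, k). avg e a z * h - avg e b z * k)) (at z)"
    and F0: "\<And>e. e > 0 \<Longrightarrow> F e 0 = 0" by metis
  have L: "lip_const M (F e)" if "e > 0" for e
    using lip_const_avg_potential[OF that D[OF that]] .
  have comm: "avg d (F e) (z + v) - avg d (F e) z = avg e (F d) (z + v) - avg e (F d) z"
    if "e > 0" "d > 0" for e d z v
    unfolding increment_avg_avg[OF that D[OF that(1)]] increment_avg_avg[OF that(2,1) D[OF that(2)]]
    using avg_commute[OF that(2,1) pairing_measurable pairing_bound] by simp
  \<comment> \<open>Four averaging errors, at \<open>z\<close> and at the origin for each of the two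
    scales, cost \<open>4 * M * (e + d)\<close> together.\<close>
  have near: "\<bar>F e z - F d z\<bar> \<le> 4 * M * (e + d)" if "e > 0" "d > 0" for e d z
    using comm[OF that, of 0 z] lip_const_avg_near[OF L[OF that(1)] that(2), of z]
      lip_const_avg_near[OF L[OF that(1)] that(2), of 0] lip_const_avg_near[OF L[OF that(2)] that(1), of z]
      lip_const_avg_near[OF L[OF that(2)] that(1), of 0] F0[OF that(1)] F0[OF that(2)]
    by (simp add: algebra_simps)
  define r where "r n = 1 / real (Suc n)" for n
  have r: "r n > 0" for n by (simp add: r_def)
  have r0: "r \<longlonglongrightarrow> 0" unfolding r_def by (rule LIMSEQ_Suc) (rule lim_1_over_n)
  have "Cauchy (\<lambda>n. F (r n) z)" for z
  proof (rule metric_CauchyI)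
    fix c :: real assume c: "c > 0"
    have "(\<lambda>n. 8 * M * r n) \<longlonglongrightarrow> 8 * M * 0" by (intro tendsto_intros r0)
    then have "eventually (\<lambda>n. 8 * M * r n < c) sequentially" using c by (simp add: order_tendstoD(2))
    then obtain K where K: "\<And>n. n \<ge> K \<Longrightarrow> 8 * M * r n < c" by (auto simp: eventually_sequentially)
    have "dist (F (r m) z) (F (r n) z) < c" if "m \<ge> K" "n \<ge> K" for m n
      using near[OF r[of m] r[of n], of z] K[OF that(1)] K[OF that(2)]
      by (simp add: dist_real_def algebra_simps)
    then show "\<exists>K. \<forall>m\<ge>K. \<forall>n\<ge>K. dist (F (r m) z) (F (r n) z) < c" by blast
  qed
  then have "\<forall>z. \<exists>l. (\<lambda>n. F (r n) z) \<longlonglongrightarrow> l" by (simp add: Cauchy_convergent_iff convergent_def)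
  then obtain U where U: "\<And>z. (\<lambda>n. F (r n) z) \<longlonglongrightarrow> U z" by metis
  have LU: "lip_const M U"
    unfolding lip_const_def
  proof safe
    fix z v
    have "(\<lambda>n. \<bar>F (r n) (z + v) - F (r n) z\<bar>) \<longlonglongrightarrow> \<bar>U (z + v) - U z\<bar>"
      by (intro tendsto_intros U)
    then show "\<bar>U (z + v) - U z\<bar> \<le> M * (\<bar>fst v\<bar> + \<bar>snd v\<bar>)"
      by (rule LIMSEQ_le_const2) (use lip_constD[OF L[OF r]] in auto)
  qed
  have U0: "U 0 = 0"
    using U[of 0] F0[OF r] by (simp add: LIMSEQ_const_iff)
  have near_U: "\<bar>F e z - U z\<bar> \<le> 4 * M * e" if e: "e > 0" for e z
  proof (rule LIMSEQ_le)
    show "(\<lambda>n. \<bar>F e z - F (r n) z\<bar>) \<longlonglongrightarrow> \<bar>F e z - U z\<bar>" by (intro tendsto_intros U)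
    show "(\<lambda>n. 4 * M * (e + r n)) \<longlonglongrightarrow> 4 * M * e"
      using tendsto_mult[OF tendsto_const[of "4 * M"] tendsto_add[OF tendsto_const[of e] r0]] by simp
    show "\<exists>N. \<forall>n\<ge>N. \<bar>F e z - F (r n) z\<bar> \<le> 4 * M * (e + r n)" using near[OF e r] by blast
  qed
  have avgU: "(\<lambda>n. avg d (F (r n)) z) \<longlonglongrightarrow> avg d U z" if d: "d > 0" for d z
  proof (rule LIMSEQ_I)
    fix c :: real assume c: "c > 0"
    have "(\<lambda>n. 4 * M * r n) \<longlonglongrightarrow> 4 * M * 0" by (intro tendsto_intros r0)
    then have "eventually (\<lambda>n. 4 * M * r n < c) sequentially" using c by (simp add: order_tendstoD(2))
    then obtain K where K: "\<And>n. n \<ge> K \<Longrightarrow> 4 * M * r n < c" by (auto simp: eventually_sequentially)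
    have "norm (avg d (F (r n)) z - avg d U z) < c" if n: "n \<ge> K" for n
    proof -
      have "avg d (F (r n)) z - avg d U z = avg d (\<lambda>z. F (r n) z - U z) z"
        by (rule avg_diff[symmetric]) (auto intro!: lip_const_avg_integrable[OF LU d] lip_const_avg_integrable[OF L[OF r] d])
      moreover have "\<bar>avg d (\<lambda>z. F (r n) z - U z) z\<bar> \<le> 4 * M * r n"
        by (rule avg_bound[OF d])
          (use near_U[OF r] lip_const_measurable[OF LU] lip_const_measurable[OF L[OF r]] in auto)
      ultimately show ?thesis using K[OF n] by simp
    qed
    then show "\<exists>no. \<forall>n\<ge>no. norm (avg d (F (r n)) z - avg d U z) < c" by blast
  qed
  have avgF: "(\<lambda>n. avg (r n) (F d) z) \<longlonglongrightarrow> F d z" if d: "d > 0" for d z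
  proof (rule LIM_zero_cancel, rule Lim_null_comparison)
    show "\<forall>\<^sub>F n in sequentially. norm (avg (r n) (F d) z - F d z) \<le> 2 * M * r n"
      using lip_const_avg_near[OF L[OF d] r] by simp
    show "(\<lambda>n. 2 * M * r n) \<longlonglongrightarrow> 0"
      using tendsto_mult[OF tendsto_const[of "2 * M"] r0] by simp
  qed
  \<comment> \<open>Let the first scale tend to zero in \<open>comm\<close>: on one side
    \<open>F (r n)\<close> becomes \<open>U\<close> under the average, on the other side the average
    disappears.\<close>
  have eq: "F d z + avg d U 0 = avg d U z" if d: "d > 0" for d z
  proof -
    have "(\<lambda>n. avg d (F (r n)) z - avg d (F (r n)) 0) \<longlonglongrightarrow> avg d U z - avg d U 0"
      by (intro tendsto_intros avgU d)
    moreover have "(\<lambda>n. avg (r n) (F d) z - avg (r n) (F d) 0) \<longlonglongrightarrow> F d z - F d 0"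
      by (intro tendsto_intros avgF d)
    ultimately have "avg d U z - avg d U 0 = F d z - F d 0"
      using comm[OF r d, of _ 0 z] by (simp add: LIMSEQ_unique)
    then show ?thesis using F0[OF d] by simp
  qed
  have "(avg d U has_derivative (\<lambda>(h, k). avg d a z * h - avg d b z * k)) (at z)" if d: "d > 0" for d z
    using has_derivative_add[OF D[OF d, of z] has_derivative_const[of "avg d U 0"]]
    unfolding eq[OF d] add_0_right .
  then show ?thesis using LU U0 by (auto simp: potential_def)
qed

end

section \<open>Divergence-free fields have a potential\<close>

text \<open>The equation is imposed on the whole plane, the initial data being part of the field.
  Test functions are nonnegative, so only nonnegative products may be inserted.\<close>

locale div_free_field = bounded_field +
  assumes weak: "test_fun ph phx pht \<Longrightarrow> (LINT w|lborel. a w * pht w + b w * phx w) = 0"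

text \<open>Derivatives of test functions must be continuous, which excludes the box indicator as a
  kernel; a continuous kernel below it is used first and sharpened afterwards.\<close>

definition bump :: "real \<Rightarrow> (real \<Rightarrow> real) \<Rightarrow> bool" where
  "bump e k \<longleftrightarrow> e > 0 \<and> continuous_on UNIV k \<and> (\<forall>s. 0 \<le> k s \<and> k s \<le> indicator {0<..<e} s)"

lemma bumpD:
  assumes "bump e k"
  shows "e > 0" "continuous_on UNIV k" "0 \<le> k s" "k s \<le> indicator {0<..<e} s" "k s \<le> 1"
    "s \<le> 0 \<Longrightarrow> k s = 0" "e \<le> s \<Longrightarrow> k s = 0" "k \<in> borel_measurable borel"
proof -
  show *: "e > 0" "continuous_on UNIV k" "0 \<le> k s" "k s \<le> indicator {0<..<e} s"
    using assms by (auto simp: bump_def)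
  show "k s \<le> 1" using *(4) indicator_le_1[of "{0<..<e}" s] by (rule order_trans)
  show "s \<le> 0 \<Longrightarrow> k s = 0" "e \<le> s \<Longrightarrow> k s = 0" using *(3,4) by (auto simp: indicator_def intro: antisym)
  show "k \<in> borel_measurable borel" using *(2) by (rule borel_measurable_continuous_onI)
qed

text \<open>Being constant on either side of \<open>(0, e)\<close>, the antiderivative has compactly
  supported differences of translates; monotonicity fixes their sign.\<close>

lemma bump_antiderivative:
  assumes k: "bump e k"
  obtains K where "\<And>s. (K has_real_derivative k s) (at s)" "mono K"
    "\<And>s. s \<le> 0 \<Longrightarrow> K s = K 0" "\<And>s. e \<le> s \<Longrightarrow> K s = K e"
proof -
  note k = bumpD[OF k]
  have "isCont k s" for s using k(2) by (simp add: continuous_on_eq_continuous_at)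
  then obtain K where "\<forall>s::real. - \<infinity> < ereal s \<longrightarrow> ereal s < \<infinity> \<longrightarrow> (K has_vector_derivative k s) (at s)"
    using einterval_antiderivative[of "-\<infinity>" "\<infinity>" k] by auto
  then have K: "(K has_real_derivative k s) (at s)" for s
    by (auto simp: has_real_derivative_iff_has_vector_derivative)
  have m: "mono K"
    by (rule monoI, rule DERIV_nonneg_imp_nondecreasing) (use K k(3) in auto)
  have c: "K s = K s'" if "\<And>x. min s s' \<le> x \<Longrightarrow> x \<le> max s s' \<Longrightarrow> k x = 0" for s s'
  proof -
    have "(K has_field_derivative 0) (at x within {min s s'..max s s'})" if "x \<in> {min s s'..max s s'}" for x
      using K[of x] \<open>\<And>x. min s s' \<le> x \<Longrightarrow> x \<le> max s s' \<Longrightarrow> k x = 0\<close>[of x] that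
      by (auto intro: DERIV_subset)
    from has_field_derivative_zero_constant[OF _ this] obtain c where "\<And>x. x \<in> {min s s'..max s s'} \<Longrightarrow> K x = c"
      by auto
    then show ?thesis by (auto simp: min_def max_def split: if_splits)
  qed
  show thesis
  proof (rule that[OF K m])
    show "s \<le> 0 \<Longrightarrow> K s = K 0" for s by (intro c k(6)) auto
    show "e \<le> s \<Longrightarrow> K s = K e" for s by (intro c k(7)) auto
  qed
qed

lemma integral_translate_bump:
  fixes k K :: "real \<Rightarrow> real"
  assumes K: "\<And>s. (K has_real_derivative k s) (at s)" and k: "continuous_on UNIV k" and le: "x1 \<le> x2"
  shows "(LINT y:{x1..x2}|lborel. k (s - y)) = K (s - x1) - K (s - x2)"
proof -
  have "((\<lambda>y. - K (s - y)) has_vector_derivative k (s - y)) (at y within {x1..x2})" for y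
    unfolding has_real_derivative_iff_has_vector_derivative[symmetric]
    by (rule derivative_eq_intros DERIV_subset[OF DERIV_chain2[OF K]] refl subset_UNIV | simp)+
  then show ?thesis unfolding set_lebesgue_integral_def
    by (subst integral_FTC_atLeastAtMost[OF le, where F="\<lambda>y. - K (s - y)"])
      (auto intro!: continuous_intros continuous_on_compose2[OF k])
qed

text \<open>Unnormalised: as \<open>k\<close> approaches the indicator of \<open>(0, e)\<close>, it
  tends to \<open>e * e * avg e g (x, t)\<close>.\<close>

definition kavg :: "(real \<Rightarrow> real) \<Rightarrow> (real \<times> real \<Rightarrow> real) \<Rightarrow> real \<Rightarrow> real \<Rightarrow> real" where
  "kavg k g x t = (LINT w|lborel. g w * (k (fst w - x) * k (snd w - t)))"

lemma product_test_fun: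
  fixes A B A' B' :: "real \<Rightarrow> real"
  assumes A: "\<And>s. (A has_real_derivative A' s) (at s)" and B: "\<And>s. (B has_real_derivative B' s) (at s)"
    and cA: "continuous_on UNIV A'" and cB: "continuous_on UNIV B'"
    and pos: "\<And>s. 0 \<le> A s" "\<And>s. 0 \<le> B s"
    and supp: "\<And>s. \<bar>s\<bar> > R \<Longrightarrow> A s = 0" "\<And>s. \<bar>s\<bar> > R \<Longrightarrow> B s = 0"
  shows "test_fun (\<lambda>z. A (fst z) * B (snd z)) (\<lambda>z. A' (fst z) * B (snd z)) (\<lambda>z. A (fst z) * B' (snd z))"
  unfolding test_fun_def
proof (intro conjI allI)
  fix z :: "real \<times> real"
  have "((\<lambda>z. A (fst z)) has_derivative (\<lambda>h. A' (fst z) * fst h)) (at z)"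
    by (rule has_derivative_eq_rhs[OF has_derivative_compose[OF has_derivative_fst[OF has_derivative_ident]
          A[unfolded has_field_derivative_def]]]) auto
  moreover have "((\<lambda>z. B (snd z)) has_derivative (\<lambda>h. B' (snd z) * snd h)) (at z)"
    by (rule has_derivative_eq_rhs[OF has_derivative_compose[OF has_derivative_snd[OF has_derivative_ident]
          B[unfolded has_field_derivative_def]]]) auto
  ultimately show "((\<lambda>z. A (fst z) * B (snd z)) has_derivative
      (\<lambda>(h, k). A' (fst z) * B (snd z) * h + A (fst z) * B' (snd z) * k)) (at z)"
    by (rule has_derivative_eq_rhs[OF has_derivative_mult]) (auto simp: fun_eq_iff algebra_simps)
  have cA0: "continuous_on UNIV A" and cB0: "continuous_on UNIV B"
    using A B by (auto intro!: continuous_at_imp_continuous_on DERIV_isCont)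
  show "continuous_on UNIV (\<lambda>z::real\<times>real. A' (fst z) * B (snd z))"
    by (intro continuous_intros continuous_on_compose2[OF cA] continuous_on_compose2[OF cB0]) auto
  show "continuous_on UNIV (\<lambda>z::real\<times>real. A (fst z) * B' (snd z))"
    by (intro continuous_intros continuous_on_compose2[OF cB] continuous_on_compose2[OF cA0]) auto
  show "\<exists>R. \<forall>z. norm z > R \<longrightarrow> A (fst z) * B (snd z) = 0"
  proof (intro exI[of _ "2 * R"] allI impI)
    fix z :: "real \<times> real" assume "norm z > 2 * R"
    then have "\<bar>fst z\<bar> > R \<or> \<bar>snd z\<bar> > R"
      using norm_Pair_le[of "fst z" "snd z"] by auto
    then show "A (fst z) * B (snd z) = 0" using supp by auto
  qed
  show "0 \<le> A (fst z) * B (snd z)" by (simp add: pos)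
qed

context div_free_field
begin

text \<open>The test function is a product of smoothed indicators of \<open>[x1, x2]\<close> and
  \<open>[t1, t2]\<close>, each a difference of two translates of \<open>K\<close>; its derivatives
  are kernels concentrated near the edges of the rectangle.\<close>

lemma weak_bump:
  assumes k: "bump e k" and K: "\<And>s. (K has_real_derivative k s) (at s)" "mono K"
    "\<And>s. s \<le> 0 \<Longrightarrow> K s = K 0" "\<And>s. e \<le> s \<Longrightarrow> K s = K e"
    and le: "x1 \<le> x2" "t1 \<le> t2"
  shows "(LINT w|lborel. a w * ((K (fst w - x1) - K (fst w - x2)) * (k (snd w - t1) - k (snd w - t2)))
      + b w * ((k (fst w - x1) - k (fst w - x2)) * (K (snd w - t1) - K (snd w - t2)))) = 0"
proof (rule weak, rule product_test_fun)
  let ?R = "\<bar>x1\<bar> + \<bar>x2\<bar> + \<bar>t1\<bar> + \<bar>t2\<bar> + e"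
  note k = bumpD[OF k]
  have D: "((\<lambda>s. K (s - p) - K (s - q)) has_real_derivative (k (s - p) - k (s - q))) (at s)" for s p q
    by (rule derivative_eq_intros DERIV_chain2[OF K(1)] refl | simp)+
  show "((\<lambda>s. K (s - x1) - K (s - x2)) has_real_derivative (k (s - x1) - k (s - x2))) (at s)" for s by (rule D)
  show "((\<lambda>s. K (s - t1) - K (s - t2)) has_real_derivative (k (s - t1) - k (s - t2))) (at s)" for s by (rule D)
  show "continuous_on UNIV (\<lambda>s. k (s - x1) - k (s - x2))" "continuous_on UNIV (\<lambda>s. k (s - t1) - k (s - t2))"
    by (intro continuous_intros continuous_on_compose2[OF k(2)], auto)+
  show "0 \<le> K (s - x1) - K (s - x2)" "0 \<le> K (s - t1) - K (s - t2)" for s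
    using le by (simp_all add: monoD[OF K(2)])
  have z: "K (s - p) - K (s - q) = 0" if "\<bar>p\<bar> + \<bar>q\<bar> + e < \<bar>s\<bar>" for s p q
  proof (cases "s > 0")
    case True
    then have "e \<le> s - p" "e \<le> s - q" using that k(1) by linarith+
    then show ?thesis using K(4)[of "s - p"] K(4)[of "s - q"] by simp
  next
    case False
    then have "s - p \<le> 0" "s - q \<le> 0" using that k(1) by linarith+
    then show ?thesis using K(3)[of "s - p"] K(3)[of "s - q"] by simp
  qed
  show "K (s - x1) - K (s - x2) = 0" if "?R < \<bar>s\<bar>" for s using that by (intro z) linarith
  show "K (s - t1) - K (s - t2) = 0" if "?R < \<bar>s\<bar>" for s using that by (intro z) linarith
qed

end

section \<open>Circulation of mollified fields around rectangles\<close>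

lemma integrable_bounded_cbox:
  fixes g :: "'n::euclidean_space \<Rightarrow> real"
  assumes "g \<in> borel_measurable borel" "\<And>w. \<bar>g w\<bar> \<le> B" "\<And>w. w \<notin> cbox l u \<Longrightarrow> g w = 0"
  shows "integrable lborel g"
  by (rule integrableI_bounded_set[of "cbox l u" _ _ B])
    (use assms emeasure_lborel_cbox_finite[of l u] in auto)

lemma kernel_bound:
  assumes k: "bump e k" and "\<And>w. \<bar>g w\<bar> \<le> M"
  shows "\<bar>g w * (k (fst w - x) * k (snd w - t))\<bar> \<le> M * indicator (box 0 (e, e)) (w - (x, t))"
proof -
  note k = bumpD[OF k]
  have "k (fst w - x) * k (snd w - t) \<le> indicator (box 0 (e, e)) (w - (x, t))"
  proof -
    have "k (fst w - x) * k (snd w - t) \<le> indicator {0<..<e} (fst w - x) * indicator {0<..<e} (snd w - t)"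
      by (intro mult_mono k) auto
    also have "\<dots> = indicator (box 0 (e, e)) (w - (x, t))"
      unfolding indicator_def mem_box_zero_pair by auto
    finally show ?thesis .
  qed
  then show ?thesis using assms(2)[of w] k(3) by (simp add: abs_mult mult_mono)
qed

text \<open>By Fubini, integrating the kernel over its base point produces a difference of
  antiderivatives, the very factor that occurs in the tested equation.\<close>

lemma kavg_integral_fst:
  fixes g :: "real \<times> real \<Rightarrow> real"
  assumes k: "bump e k" and K: "\<And>s. (K has_real_derivative k s) (at s)"
    and [measurable]: "g \<in> borel_measurable borel" and B: "\<And>w. \<bar>g w\<bar> \<le> M" and le: "x1 \<le> x2"
  shows "(LINT y:{x1..x2}|lborel. kavg k g y t) = (LINT w|lborel. g w * ((K (fst w - x1) - K (fst w - x2)) * k (snd w - t)))"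
proof -
  have [measurable]: "k \<in> borel_measurable borel" using bumpD(8)[OF k] .
  let ?h = "\<lambda>(y, w). indicator {x1..x2} y * (g w * (k (fst w - y) * k (snd w - t)))"
  have "integrable lborel ?h"
  proof (rule integrable_bounded_cbox[of _ M "(x1, (x1, t))" "(x2, (x2 + e, t + e))"])
    have [measurable]: "g \<in> borel_measurable (borel \<Otimes>\<^sub>M borel)" using assms(3) by (simp add: borel_prod)
    have "?h \<in> borel_measurable (borel \<Otimes>\<^sub>M (borel \<Otimes>\<^sub>M borel))" by measurable
    then show "?h \<in> borel_measurable borel" by (simp add: borel_prod)
    have b: "\<bar>?h yw\<bar> \<le> indicator {x1..x2} (fst yw) * (M * indicator (box 0 (e, e)) (snd yw - (fst yw, t)))" for yw
      using kernel_bound[OF k B, where w="snd yw" and x="fst yw" and t=t]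
      by (auto simp: split_beta abs_mult indicator_def split: if_splits)
    have M: "0 \<le> M" using B[of 0] by linarith
    show "\<bar>?h yw\<bar> \<le> M" for yw by (rule order_trans[OF b]) (use M in \<open>auto simp: indicator_def\<close>)
    show "?h yw = 0" if "yw \<notin> cbox (x1, (x1, t)) (x2, (x2 + e, t + e))" for yw
    proof -
      have "\<not> (fst yw \<in> {x1..x2} \<and> snd yw - (fst yw, t) \<in> box 0 (e, e))"
        using that unfolding mem_box_zero_pair by (cases yw) (auto simp: cbox_Pair_eq)
      then have "\<bar>?h yw\<bar> \<le> 0" by (intro order_trans[OF b]) (auto simp: indicator_def)
      then show ?thesis by simp
    qed
  qed
  then have i: "integrable (lborel \<Otimes>\<^sub>M lborel) ?h" by (simp add: lborel_prod)
  have "(LINT y:{x1..x2}|lborel. kavg k g y t) = (LINT y|lborel. LINT w|lborel. ?h (y, w))"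
    unfolding set_lebesgue_integral_def kavg_def by simp
  also have "\<dots> = (LINT w|lborel. LINT y|lborel. ?h (y, w))"
    by (rule lborel_pair.Fubini_integral[symmetric]) (use i in simp)
  also have "\<dots> = (LINT w|lborel. g w * ((LINT y:{x1..x2}|lborel. k (fst w - y)) * k (snd w - t)))"
    unfolding set_lebesgue_integral_def
    by (auto intro!: Bochner_Integration.integral_cong simp: ac_simps
        simp flip: integral_mult_right_zero integral_mult_left_zero)
  also have "\<dots> = (LINT w|lborel. g w * ((K (fst w - x1) - K (fst w - x2)) * k (snd w - t)))"
    by (simp add: integral_translate_bump[OF K bumpD(2)[OF k] le])
  finally show ?thesis .
qed

lemma integral_lborel_swap:
  fixes G :: "real \<times> real \<Rightarrow> real"
  assumes "G \<in> borel_measurable borel"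
  shows "(LINT w|lborel. G (snd w, fst w)) = (LINT w|lborel. G w)"
  using lborel_pair.integral_product_swap[of G] assms
  by (simp add: lborel_prod case_prod_beta')

lemma integrable_kernel:
  fixes g :: "real \<times> real \<Rightarrow> real"
  assumes [measurable]: "g \<in> borel_measurable borel" "p \<in> borel_measurable borel" "q \<in> borel_measurable borel"
    and B: "\<And>w. \<bar>g w\<bar> \<le> M" "\<And>s. \<bar>p s\<bar> \<le> C" "\<And>s. \<bar>q s\<bar> \<le> D"
    and z: "\<And>s. \<bar>s\<bar> > R \<Longrightarrow> p s = 0" "\<And>s. \<bar>s\<bar> > R \<Longrightarrow> q s = 0"
  shows "integrable lborel (\<lambda>w. g w * (p (fst w) * q (snd w)))"
proof (rule integrable_bounded_cbox[of _ "M * (C * D)" "(-R, -R)" "(R, R)"])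
  have [measurable]: "g \<in> borel_measurable (borel \<Otimes>\<^sub>M borel)" using assms(1) by (simp add: borel_prod)
  have "(\<lambda>w. g w * (p (fst w) * q (snd w))) \<in> borel_measurable (borel \<Otimes>\<^sub>M borel)" by measurable
  then show "(\<lambda>w. g w * (p (fst w) * q (snd w))) \<in> borel_measurable borel" by (simp add: borel_prod)
  have "\<bar>g w\<bar> * (\<bar>p (fst w)\<bar> * \<bar>q (snd w)\<bar>) \<le> M * (C * D)" for w
    by (intro mult_mono B) (use B(1)[of w] B(2)[of 0] B(3)[of 0] in \<open>auto intro!: mult_nonneg_nonneg\<close>)
  then show "\<bar>g w * (p (fst w) * q (snd w))\<bar> \<le> M * (C * D)" for w by (simp add: abs_mult)
  show "g w * (p (fst w) * q (snd w)) = 0" if "w \<notin> cbox (- R, - R) (R, R)" for w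
  proof -
    have "\<bar>fst w\<bar> > R \<or> \<bar>snd w\<bar> > R" using that by (cases w) (auto simp: cbox_Pair_eq)
    then show ?thesis using z by auto
  qed
qed

text \<open>The product kernel uses the same \<open>k\<close> in both coordinates, so swapping them
  reduces this to the other edge direction.\<close>

lemma kavg_integral_snd:
  fixes g :: "real \<times> real \<Rightarrow> real"
  assumes k: "bump e k" and K: "\<And>s. (K has_real_derivative k s) (at s)"
    and g: "g \<in> borel_measurable borel" and B: "\<And>w. \<bar>g w\<bar> \<le> M" and le: "t1 \<le> t2"
  shows "(LINT y:{t1..t2}|lborel. kavg k g x y) = (LINT w|lborel. g w * (k (fst w - x) * (K (snd w - t1) - K (snd w - t2))))"
proof -
  have [measurable]: "g \<in> borel_measurable (borel \<Otimes>\<^sub>M borel)" using g by (simp add: borel_prod)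
  have [measurable]: "k \<in> borel_measurable borel" using bumpD(8)[OF k] .
  have "continuous_on UNIV K" using K by (auto intro!: continuous_at_imp_continuous_on DERIV_isCont)
  then have [measurable]: "K \<in> borel_measurable borel" by (rule borel_measurable_continuous_onI)
  have m: "(\<lambda>w. g (snd w, fst w)) \<in> borel_measurable borel"
  proof -
    have "(\<lambda>w. g (snd w, fst w)) \<in> borel_measurable (borel \<Otimes>\<^sub>M borel)" by measurable
    then show ?thesis by (simp add: borel_prod)
  qed
  have s: "kavg k g x t = kavg k (\<lambda>w. g (snd w, fst w)) t x" for t
  proof -
    have "(\<lambda>w. g w * (k (fst w - x) * k (snd w - t))) \<in> borel_measurable (borel \<Otimes>\<^sub>M borel)" by measurable
    then have "(\<lambda>w. g w * (k (fst w - x) * k (snd w - t))) \<in> borel_measurable borel" by (simp add: borel_prod)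
    from integral_lborel_swap[OF this] show ?thesis by (simp add: kavg_def mult.commute mult.left_commute)
  qed
  have "(\<lambda>w. g w * (k (fst w - x) * (K (snd w - t1) - K (snd w - t2)))) \<in> borel_measurable (borel \<Otimes>\<^sub>M borel)" by measurable
  then have "(\<lambda>w. g w * (k (fst w - x) * (K (snd w - t1) - K (snd w - t2)))) \<in> borel_measurable borel" by (simp add: borel_prod)
  from integral_lborel_swap[OF this] show ?thesis
    unfolding s using kavg_integral_fst[OF k K m _ le, of M] B
    by (simp add: mult.commute mult.left_commute)
qed

lemma kavg_bound:
  assumes k: "bump e k" and B: "\<And>w. \<bar>g w\<bar> \<le> M"
  shows "\<bar>kavg k g x t\<bar> \<le> M * (e * e)"
proof -
  have e: "e > 0" using bumpD(1)[OF k] .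
  have "(LINT w|lborel. indicat_real (box 0 (e, e)) (w - (x, t))) = e * e"
    using avg_lborel[OF e, of "\<lambda>_. 1" "(x, t)"] prob_space.prob_space[OF prob_space_unif[OF e]] e
    by (simp add: avg_def field_simps)
  moreover have "integrable lborel (\<lambda>w. indicat_real (box 0 (e, e)) (w - (x, t)))"
  proof (rule integrable_bounded_cbox[of _ 1 "(x, t)" "(x + e, t + e)"])
    show "indicat_real (box 0 (e, e)) (w - (x, t)) = 0" if "w \<notin> cbox (x, t) (x + e, t + e)" for w
      using that unfolding indicator_def mem_box_zero_pair by (cases w) (auto simp: cbox_Pair_eq)
  qed (auto simp: indicator_def)
  moreover have "\<bar>kavg k g x t\<bar> \<le> (LINT w|lborel. M * indicat_real (box 0 (e, e)) (w - (x, t)))"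
    if i: "integrable lborel (\<lambda>w. M * indicat_real (box 0 (e, e)) (w - (x, t)))"
  proof (cases "integrable lborel (\<lambda>w. g w * (k (fst w - x) * k (snd w - t)))")
    case True
    have "\<bar>kavg k g x t\<bar> \<le> (LINT w|lborel. \<bar>g w * (k (fst w - x) * k (snd w - t))\<bar>)"
      unfolding kavg_def by (rule integral_abs_bound)
    also have "\<dots> \<le> (LINT w|lborel. M * indicat_real (box 0 (e, e)) (w - (x, t)))"
      by (intro integral_mono integrable_abs True i kernel_bound[OF k B])
    finally show ?thesis .
  next
    case False
    \<comment> \<open>The integral of a non-integrable function is zero by convention, so here only
      \<open>0 \<le> M\<close> is needed.\<close>
    then have "kavg k g x t = 0" unfolding kavg_def by (rule not_integrable_integral_eq)
    then show ?thesis using B[of 0] by (auto intro!: integral_nonneg)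
  qed
  ultimately show ?thesis by simp
qed

context div_free_field
begin

text \<open>The four integrals are the circulation of the mollified form \<open>a dx - b dt\<close>;
  by Fubini they combine into the equation tested in \<open>weak_bump\<close>.\<close>

lemma kavg_circulation:
  assumes k: "bump e k" and le: "x1 \<le> x2" "t1 \<le> t2"
  shows "(LINT y:{x1..x2}|lborel. kavg k a y t1) - (LINT y:{x1..x2}|lborel. kavg k a y t2)
    + (LINT s:{t1..t2}|lborel. kavg k b x1 s) - (LINT s:{t1..t2}|lborel. kavg k b x2 s) = 0"
proof -
  note kD = bumpD[OF k]
  obtain K where K: "\<And>s. (K has_real_derivative k s) (at s)" "mono K"
    "\<And>s. s \<le> 0 \<Longrightarrow> K s = K 0" "\<And>s. e \<le> s \<Longrightarrow> K s = K e"
    using bump_antiderivative[OF k] by metis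
  have [measurable]: "k \<in> borel_measurable borel" using kD(8) .
  have "continuous_on UNIV K" using K(1) by (auto intro!: continuous_at_imp_continuous_on DERIV_isCont)
  then have [measurable]: "K \<in> borel_measurable borel" by (rule borel_measurable_continuous_onI)
  let ?R = "\<bar>x1\<bar> + \<bar>x2\<bar> + \<bar>t1\<bar> + \<bar>t2\<bar> + e"
  have z: "K (s - p) = K (s - q)" if "\<bar>p\<bar> + \<bar>q\<bar> + e < \<bar>s\<bar>" for s p q
  proof (cases "s > 0")
    case True
    then have "e \<le> s - p" "e \<le> s - q" using that kD(1) by linarith+
    then show ?thesis using K(4)[of "s - p"] K(4)[of "s - q"] by simp
  next
    case False
    then have "s - p \<le> 0" "s - q \<le> 0" using that kD(1) by linarith+
    then show ?thesis using K(3)[of "s - p"] K(3)[of "s - q"] by simp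
  qed
  have z': "k (s - p) = 0" if "\<bar>p\<bar> + e < \<bar>s\<bar>" for s p
    using that kD(6)[of "s - p"] kD(7)[of "s - p"] kD(1) by linarith
  define C where "C = \<bar>K 0\<bar> + \<bar>K e\<bar>"
  have bK: "\<bar>K s\<bar> \<le> C" for s
    unfolding C_def using monoD[OF K(2), of 0 s] monoD[OF K(2), of s e] K(3)[of s] K(4)[of s] by linarith
  have bK2: "\<bar>K (s - p) - K (s - q)\<bar> \<le> 2 * C" for s p q
    using bK[of "s - p"] bK[of "s - q"] by linarith
  have bk: "\<bar>k s\<bar> \<le> 1" for s using kD(3)[of s] kD(5)[of s] by simp
  have iA: "integrable lborel (\<lambda>w. a w * ((K (fst w - x1) - K (fst w - x2)) * k (snd w - t)))"
    if "t = t1 \<or> t = t2" for t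
    by (rule integrable_kernel[where M=M and C="2 * C" and D=1 and R="?R"])
      (use that a_bound bK2 bk in \<open>auto intro!: z z'\<close>)
  have iB: "integrable lborel (\<lambda>w. b w * (k (fst w - x) * (K (snd w - t1) - K (snd w - t2))))"
    if "x = x1 \<or> x = x2" for x
    by (rule integrable_kernel[where M=M and D="2 * C" and C=1 and R="?R"])
      (use that b_bound bK2 bk in \<open>auto intro!: z z'\<close>)
  have "(LINT y:{x1..x2}|lborel. kavg k a y t1) - (LINT y:{x1..x2}|lborel. kavg k a y t2)
    + (LINT s:{t1..t2}|lborel. kavg k b x1 s) - (LINT s:{t1..t2}|lborel. kavg k b x2 s)
    = (LINT w|lborel. a w * ((K (fst w - x1) - K (fst w - x2)) * k (snd w - t1))
       - a w * ((K (fst w - x1) - K (fst w - x2)) * k (snd w - t2))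
       + b w * (k (fst w - x1) * (K (snd w - t1) - K (snd w - t2)))
       - b w * (k (fst w - x2) * (K (snd w - t1) - K (snd w - t2))))"
    unfolding kavg_integral_fst[OF k K(1) a_meas a_bound le(1)] kavg_integral_snd[OF k K(1) b_meas b_bound le(2)]
    using iA[of t1] iA[of t2] iB[of x1] iB[of x2] by simp
  also have "\<dots> = (LINT w|lborel. a w * ((K (fst w - x1) - K (fst w - x2)) * (k (snd w - t1) - k (snd w - t2)))
      + b w * ((k (fst w - x1) - k (fst w - x2)) * (K (snd w - t1) - K (snd w - t2))))"
    by (rule Bochner_Integration.integral_cong) (simp_all add: algebra_simps)
  also have "\<dots> = 0" by (rule weak_bump[OF k K le])
  finally show ?thesis .
qed

end

section \<open>Sharpening the kernels to box indicators\<close>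

definition bump_seq :: "real \<Rightarrow> nat \<Rightarrow> real \<Rightarrow> real" where
  "bump_seq e n s = min 1 (real n * max 0 (s * (e - s)))"

lemma bump_bump_seq: "e > 0 \<Longrightarrow> bump e (bump_seq e n)"
  unfolding bump_def
proof (intro conjI allI)
  show "continuous_on UNIV (bump_seq e n)"
    unfolding bump_seq_def by (intro continuous_intros)
  show "0 \<le> bump_seq e n s" for s by (simp add: bump_seq_def)
  assume "e > 0"
  then show "bump_seq e n s \<le> indicator {0<..<e} s" for s
    by (auto simp: bump_seq_def indicator_def max_def zero_le_mult_iff)
qed

lemma bump_seq_tendsto:
  assumes e: "e > 0" shows "(\<lambda>n. bump_seq e n s) \<longlonglongrightarrow> indicator {0<..<e} s"
proof (cases "0 < s \<and> s < e")
  case True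
  then have p: "s * (e - s) > 0" by simp
  obtain N where N: "real N > 1 / (s * (e - s))" using reals_Archimedean2 by blast
  have "bump_seq e n s = 1" if "n \<ge> N" for n
  proof -
    have "real n > 1 / (s * (e - s))" using N that by (meson le_less_trans not_le of_nat_le_iff order_less_le_trans)
    then have "real n * (s * (e - s)) > 1" using p by (simp add: pos_divide_less_eq)
    then show ?thesis using p by (simp add: bump_seq_def)
  qed
  then have "eventually (\<lambda>n. bump_seq e n s = 1) sequentially" by (auto simp: eventually_sequentially)
  then show ?thesis using True by (simp add: tendsto_eventually)
next
  case False
  then have "bump_seq e n s = 0" for n
    using bumpD(6,7)[OF bump_bump_seq[OF e], of s n] by auto
  then show ?thesis using False by (auto simp: indicator_def)
qed

lemma kavg_tendsto:
  assumes e: "e > 0" and [measurable]: "g \<in> borel_measurable borel" and B: "\<And>w. \<bar>g w\<bar> \<le> M"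
  shows "(\<lambda>n. kavg (bump_seq e n) g x t) \<longlonglongrightarrow> e * e * avg e g (x, t)"
proof -
  have i: "integrable lborel (\<lambda>w. M * indicat_real (box 0 (e, e)) (w - (x, t)))"
  proof (rule integrable_mult_right, rule integrable_bounded_cbox[of _ 1 "(x, t)" "(x + e, t + e)"])
    show "indicat_real (box 0 (e, e)) (w - (x, t)) = 0" if "w \<notin> cbox (x, t) (x + e, t + e)" for w
      using that unfolding indicator_def mem_box_zero_pair by (cases w) (auto simp: cbox_Pair_eq)
  qed (auto simp: indicator_def)
  have "(\<lambda>n. kavg (bump_seq e n) g x t) \<longlonglongrightarrow> (LINT w|lborel. g w * indicat_real (box 0 (e, e)) (w - (x, t)))"
    unfolding kavg_def
  proof (rule integral_dominated_convergence[OF _ _ i])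
    have [measurable]: "bump_seq e n \<in> borel_measurable borel" for n using bumpD(8)[OF bump_bump_seq[OF e]] .
    have [measurable]: "g \<in> borel_measurable (borel \<Otimes>\<^sub>M borel)" by (simp add: borel_prod)
    show "(\<lambda>w. g w * (bump_seq e n (fst w - x) * bump_seq e n (snd w - t))) \<in> borel_measurable lborel" for n
    proof -
      have "(\<lambda>w. g w * (bump_seq e n (fst w - x) * bump_seq e n (snd w - t))) \<in> borel_measurable (borel \<Otimes>\<^sub>M borel)" by measurable
      then show ?thesis by (simp add: borel_prod)
    qed
    show "AE w in lborel. (\<lambda>n. g w * (bump_seq e n (fst w - x) * bump_seq e n (snd w - t)))
      \<longlonglongrightarrow> g w * indicat_real (box 0 (e, e)) (w - (x, t))"
    proof (rule AE_I2)
      fix w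
      have "(\<lambda>n. bump_seq e n (fst w - x) * bump_seq e n (snd w - t))
        \<longlonglongrightarrow> indicator {0<..<e} (fst w - x) * indicator {0<..<e} (snd w - t)"
        by (intro tendsto_mult bump_seq_tendsto e)
      moreover have "indicator {0<..<e} (fst w - x) * indicator {0<..<e} (snd w - t) = indicat_real (box 0 (e, e)) (w - (x, t))"
        unfolding indicator_def mem_box_zero_pair by auto
      ultimately show "(\<lambda>n. g w * (bump_seq e n (fst w - x) * bump_seq e n (snd w - t)))
        \<longlonglongrightarrow> g w * indicat_real (box 0 (e, e)) (w - (x, t))"
        by (intro tendsto_mult tendsto_const) simp
    qed
    show "AE w in lborel. norm (g w * (bump_seq e n (fst w - x) * bump_seq e n (snd w - t)))
      \<le> M * indicat_real (box 0 (e, e)) (w - (x, t))" for n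
      using kernel_bound[OF bump_bump_seq[OF e] B] by (intro AE_I2) simp
  qed auto
  then show ?thesis using avg_lborel[OF e assms(2), of "(x, t)"] e by simp
qed

lemma set_integral_kavg_tendsto:
  fixes c :: "real \<Rightarrow> real" and d :: "real \<Rightarrow> real"
  assumes e: "e > 0" and g: "g \<in> borel_measurable borel" and B: "\<And>w. \<bar>g w\<bar> \<le> M"
    and cd: "continuous_on UNIV c" "continuous_on UNIV d"
  shows "(\<lambda>n. LINT y:{p..q}|lborel. kavg (bump_seq e n) g (c y) (d y)) \<longlonglongrightarrow> e * e * (LINT y:{p..q}|lborel. avg e g (c y, d y))"
proof -
  have [measurable]: "c \<in> borel_measurable borel" "d \<in> borel_measurable borel"
    using cd by (auto intro: borel_measurable_continuous_onI)
  have [measurable]: "g \<in> borel_measurable (borel \<Otimes>\<^sub>M borel)" using g by (simp add: borel_prod)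
  have [measurable]: "g \<in> borel_measurable (lborel \<Otimes>\<^sub>M lborel)" using g by (simp add: lborel_prod)
  have "(\<lambda>n. LINT y:{p..q}|lborel. kavg (bump_seq e n) g (c y) (d y)) \<longlonglongrightarrow> (LINT y:{p..q}|lborel. e * e * avg e g (c y, d y))"
    unfolding set_lebesgue_integral_def
  proof (rule integral_dominated_convergence[where w="\<lambda>y. M * (e * e) * indicator {p..q} y"])
    have [measurable]: "bump_seq e n \<in> borel_measurable borel" for n using bumpD(8)[OF bump_bump_seq[OF e]] .
    have [measurable]: "(\<lambda>y. kavg (bump_seq e n) g (c y) (d y)) \<in> borel_measurable borel" for n
    proof -
      have "(\<lambda>y. kavg (bump_seq e n) g (c y) (d y)) = (\<lambda>y. LINT w|(lborel \<Otimes>\<^sub>M lborel). g w * (bump_seq e n (fst w - c y) * bump_seq e n (snd w - d y)))"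
        by (simp add: kavg_def lborel_prod)
      moreover have "sigma_finite_measure (lborel \<Otimes>\<^sub>M lborel :: (real \<times> real) measure)"
        unfolding lborel_prod by (rule sigma_finite_lborel)
      ultimately show ?thesis
        by (simp only:) (rule sigma_finite_measure.borel_measurable_lebesgue_integral, assumption, measurable)
    qed
    show "(\<lambda>y. indicat_real {p..q} y *\<^sub>R kavg (bump_seq e n) g (c y) (d y)) \<in> borel_measurable lborel" for n by measurable
    have "continuous_on UNIV (\<lambda>y. avg e g (c y, d y))"
      by (rule continuous_on_compose2[OF continuous_avg[OF e g B]]) (auto intro!: continuous_intros cd)
    then have [measurable]: "(\<lambda>y. avg e g (c y, d y)) \<in> borel_measurable borel" by (rule borel_measurable_continuous_onI)
    show "(\<lambda>y. indicat_real {p..q} y *\<^sub>R (e * e * avg e g (c y, d y))) \<in> borel_measurable lborel" by measurable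
    show "integrable lborel (\<lambda>y. M * (e * e) * indicat_real {p..q} y)"
      by (intro integrable_mult_right integrable_real_indicator) (use emeasure_lborel_cbox_finite[of p q] in auto)
    show "AE y in lborel. (\<lambda>n. indicat_real {p..q} y *\<^sub>R kavg (bump_seq e n) g (c y) (d y))
       \<longlonglongrightarrow> indicat_real {p..q} y *\<^sub>R (e * e * avg e g (c y, d y))"
      by (intro AE_I2 tendsto_scaleR tendsto_const kavg_tendsto[OF e g B])
    show "AE y in lborel. norm (indicat_real {p..q} y *\<^sub>R kavg (bump_seq e n) g (c y) (d y)) \<le> M * (e * e) * indicat_real {p..q} y" for n
      using kavg_bound[OF bump_bump_seq[OF e] B] by (intro AE_I2) (auto simp: indicator_def)
  qed
  then show ?thesis by simp
qed

context div_free_field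
begin

lemma avg_circulation:
  assumes e: "e > 0" and le: "x1 \<le> x2" "t1 \<le> t2"
  shows "(LINT y:{x1..x2}|lborel. avg e a (y, t1)) - (LINT y:{x1..x2}|lborel. avg e a (y, t2))
    + (LINT s:{t1..t2}|lborel. avg e b (x1, s)) - (LINT s:{t1..t2}|lborel. avg e b (x2, s)) = 0" (is "?L = 0")
proof -
  have "(\<lambda>n. (LINT y:{x1..x2}|lborel. kavg (bump_seq e n) a y t1) - (LINT y:{x1..x2}|lborel. kavg (bump_seq e n) a y t2)
    + (LINT s:{t1..t2}|lborel. kavg (bump_seq e n) b x1 s) - (LINT s:{t1..t2}|lborel. kavg (bump_seq e n) b x2 s))
    \<longlonglongrightarrow> e * e * (LINT y:{x1..x2}|lborel. avg e a (y, t1)) - e * e * (LINT y:{x1..x2}|lborel. avg e a (y, t2))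
    + e * e * (LINT s:{t1..t2}|lborel. avg e b (x1, s)) - e * e * (LINT s:{t1..t2}|lborel. avg e b (x2, s))"
    by (intro tendsto_add tendsto_diff set_integral_kavg_tendsto[where M=M] e a_meas b_meas a_bound b_bound continuous_intros)
  then have "e * e * ?L = 0"
    using kavg_circulation[OF bump_bump_seq[OF e] le] by (simp add: LIMSEQ_const_iff algebra_simps)
  then show ?thesis using e by simp
qed

text \<open>The averaged form \<open>a dx - b dt\<close> is continuous with zero circulation around
  rectangles, hence exact on the plane.\<close>

lemma avg_potential_exists:
  assumes e: "e > 0"
  shows "\<exists>F. \<forall>z. (F has_derivative (\<lambda>(h, k). avg e a z * h - avg e b z * k)) (at z)"
proof -
  let ?A = "avg e a" and ?B = "avg e b"
  have cA: "continuous_on UNIV ?A" and cB: "continuous_on UNIV ?B"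
    by (auto intro!: continuous_avg[of _ _ M] e a_bound b_bound)
  have anti: "\<exists>P. (\<forall>s. (P has_real_derivative h s) (at s)) \<and> P 0 = 0" if "continuous_on UNIV h" for h :: "real \<Rightarrow> real"
  proof -
    have "isCont h s" for s using that by (simp add: continuous_on_eq_continuous_at)
    then obtain P where "\<forall>s::real. - \<infinity> < ereal s \<longrightarrow> ereal s < \<infinity> \<longrightarrow> (P has_vector_derivative h s) (at s)"
      using einterval_antiderivative[of "-\<infinity>" "\<infinity>" h] by auto
    then have "(P has_real_derivative h s) (at s)" for s
      by (auto simp: has_real_derivative_iff_has_vector_derivative)
    then have "((\<lambda>s. P s - P 0) has_real_derivative h s) (at s)" for s
      using DERIV_diff[OF _ DERIV_const[where k="P 0"]] by fastforce
    then show ?thesis by (intro exI[of _ "\<lambda>s. P s - P 0"]) simp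
  qed
  have "\<exists>P. (\<forall>s. (P has_real_derivative ?A (s, t)) (at s)) \<and> P 0 = 0" for t
    by (rule anti) (intro continuous_on_compose2[OF cA] continuous_intros, auto)
  then obtain P where P: "\<And>t s. (P t has_real_derivative ?A (s, t)) (at s)" and P0: "\<And>t. P t 0 = 0" by metis
  have "\<exists>Q. (\<forall>s. (Q has_real_derivative ?B (x, s)) (at s)) \<and> Q 0 = 0" for x
    by (rule anti) (intro continuous_on_compose2[OF cB] continuous_intros, auto)
  then obtain Q where Q: "\<And>x s. (Q x has_real_derivative ?B (x, s)) (at s)" and Q0: "\<And>x. Q x 0 = 0" by metis
  have ftc: "(LINT s:{p..q}|lborel. h s) = H q - H p"
    if "\<And>s. (H has_real_derivative h s) (at s)" "continuous_on UNIV h" "p \<le> q" for H h :: "real \<Rightarrow> real" and p q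
    unfolding set_lebesgue_integral_def using that
    by (intro integral_FTC_atLeastAtMost)
      (auto simp: has_real_derivative_iff_has_vector_derivative intro: has_vector_derivative_at_within continuous_on_subset)
  have iA: "(LINT y:{p..q}|lborel. ?A (y, t)) = P t q - P t p" if "p \<le> q" for p q t
    by (rule ftc[OF P _ that]) (intro continuous_on_compose2[OF cA] continuous_intros, auto)
  have iB: "(LINT s:{p..q}|lborel. ?B (x, s)) = Q x q - Q x p" if "p \<le> q" for p q x
    by (rule ftc[OF Q _ that]) (intro continuous_on_compose2[OF cB] continuous_intros, auto)
  have circ: "(P t1 x2 - P t1 x1) - (P t2 x2 - P t2 x1) + (Q x1 t2 - Q x1 t1) - (Q x2 t2 - Q x2 t1) = 0"
    if "x1 \<le> x2" "t1 \<le> t2" for x1 x2 t1 t2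
    using avg_circulation[OF e that] by (simp add: iA iB that)
  \<comment> \<open>The two L-shaped paths from the origin to \<open>(x, t)\<close> give the same
    value; the signs of \<open>x\<close> and \<open>t\<close> lead to four rectangles.\<close>
  have key: "P 0 x - Q x t = P t x - Q 0 t" for x t
  proof -
    consider "0 \<le> x" "0 \<le> t" | "0 \<le> x" "t \<le> 0" | "x \<le> 0" "0 \<le> t" | "x \<le> 0" "t \<le> 0" by linarith
    then show ?thesis
      by cases (use circ[of 0 x 0 t] circ[of 0 x t 0] circ[of x 0 0 t] circ[of x 0 t 0] P0 Q0 in auto)
  qed
  \<comment> \<open>This form shows the derivative in \<open>x\<close>, the other side of
    \<open>key\<close> the derivative in \<open>t\<close>; continuity of the latter gives joint
    differentiability.\<close>
  let ?f = "\<lambda>x t. P t x - Q 0 t"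
  have "((\<lambda>(x, t). ?f x t) has_derivative (\<lambda>(h, k). ?A z * h - ?B z * k)) (at z)" for z
  proof -
    obtain x t where z: "z = (x, t)" by (cases z)
    have "((\<lambda>(x, t). ?f x t) has_derivative
      (\<lambda>(h, k). (?A (x, t) * h) + blinfun_apply (blinfun_scaleR_right (- ?B (x, t))) k)) (at (x, t) within UNIV \<times> UNIV)"
    proof (rule has_derivative_partialsI[where fy="\<lambda>x t. blinfun_scaleR_right (- ?B (x, t))"])
      show "((\<lambda>x. ?f x t) has_derivative (\<lambda>h. ?A (x, t) * h)) (at x within UNIV)"
        using P[of t x] unfolding has_field_derivative_def by (auto intro!: derivative_eq_intros)
      show "((\<lambda>t. ?f x t) has_derivative blinfun_apply (blinfun_scaleR_right (- ?B (x, t)))) (at t within UNIV)" for x t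
      proof -
        have "(\<lambda>t. ?f x t) = (\<lambda>t. P 0 x - Q x t)" by (simp add: key)
        moreover have "((\<lambda>t. P 0 x - Q x t) has_real_derivative (- ?B (x, t))) (at t)"
          using DERIV_diff[OF DERIV_const[where k="P 0 x"] Q[of x t]] by simp
        ultimately show ?thesis unfolding has_field_derivative_def
          by (auto elim!: has_derivative_eq_rhs)
      qed
      have "continuous_on UNIV (\<lambda>z. blinfun_scaleR_right (- ?B z) :: real \<Rightarrow>\<^sub>L real)"
        by (intro bounded_linear.continuous_on[OF bounded_linear_blinfun_scaleR_right] continuous_intros cB)
      then show "continuous (at (x, t) within UNIV \<times> UNIV) (\<lambda>(x, t). blinfun_scaleR_right (- ?B (x, t)) :: real \<Rightarrow>\<^sub>L real)"
        unfolding case_prod_beta' prod.collapse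
        by (simp add: continuous_on_eq_continuous_at del: split_paired_All)
    qed auto
    then show ?thesis unfolding z UNIV_Times_UNIV by simp
  qed
  then show ?thesis by blast
qed

lemma potential_exists: "\<exists>U. potential M a b U \<and> U 0 = 0"
  by (rule potential_if_avg_potentials) (rule avg_potential_exists)

end

section \<open>Potentials of entropy solutions are viscosity supersolutions\<close>

lemma potentialD:
  assumes "potential M a b U"
  shows "lip_const M U"
    "e > 0 \<Longrightarrow> (avg e U has_derivative (\<lambda>(h, k). avg e a z * h - avg e b z * k)) (at z)"
  using assms unfolding potential_def by blast+

lemma lip_const_avg_tendsto:
  assumes "lip_const M U" and r: "\<And>n. r n > 0" "r \<longlonglongrightarrow> 0"
  shows "(\<lambda>n. avg (r n) U z) \<longlonglongrightarrow> U z"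
proof (rule LIM_zero_cancel, rule Lim_null_comparison)
  show "\<forall>\<^sub>F n in sequentially. norm (avg (r n) U z - U z) \<le> 2 * M * r n"
    using lip_const_avg_near[OF assms(1) r(1)] by simp
  show "(\<lambda>n. 2 * M * r n) \<longlonglongrightarrow> 0"
    using tendsto_mult[OF tendsto_const[of "2 * M"] r(2)] by simp
qed

lemma has_real_derivative_quadratic_error:
  fixes g :: "real \<Rightarrow> real"
  assumes "\<And>h. \<bar>g (y + h) - g y - D * h\<bar> \<le> h\<^sup>2"
  shows "(g has_real_derivative D) (at y)"
  unfolding DERIV_def
proof (rule LIM_zero_cancel, rule Lim_null_comparison)
  have "norm ((g (y + h) - g y) / h - D) \<le> \<bar>h\<bar>" if "h \<noteq> 0" for h
  proof -
    have "\<bar>(g (y + h) - g y) / h - D\<bar> = \<bar>g (y + h) - g y - D * h\<bar> / \<bar>h\<bar>"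
      using that by (simp add: field_simps flip: abs_divide)
    also have "\<dots> \<le> h\<^sup>2 / \<bar>h\<bar>" by (intro divide_right_mono assms) auto
    also have "\<dots> = \<bar>h\<bar>" using that by (simp add: power2_eq_square field_simps abs_mult_self_eq)
    finally show ?thesis by simp
  qed
  then show "\<forall>\<^sub>F h in at 0. norm ((g (y + h) - g y) / h - D) \<le> \<bar>h\<bar>"
    by (auto simp: eventually_at_filter)
  show "((\<lambda>h::real. \<bar>h\<bar>) \<longlongrightarrow> 0) (at 0)"
    using tendsto_rabs[OF tendsto_ident_at, of "0::real" UNIV] by simp
qed

text \<open>Squaring makes the positive part continuously differentiable, as a test function must
  be. Its error beyond first order lies between \<open>0\<close> and
  \<open>h\<^sup>2\<close>.\<close>

lemma DERIV_square_positive_part: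
  "((\<lambda>y::real. (max 0 y)\<^sup>2) has_real_derivative 2 * max 0 y) (at y)"
proof (rule has_real_derivative_quadratic_error)
  fix h :: real
  have *: "0 \<le> (max 0 (y + h))\<^sup>2 - (max 0 y)\<^sup>2 - 2 * max 0 y * h"
  proof (cases "0 \<le> y"; cases "0 \<le> y + h")
    assume "0 \<le> y" "\<not> 0 \<le> y + h"
    then have "0 \<le> y * (- y - 2 * h)" by (intro mult_nonneg_nonneg) auto
    then show ?thesis using \<open>0 \<le> y\<close> \<open>\<not> 0 \<le> y + h\<close> by (simp add: max_def power2_eq_square algebra_simps)
  next
    assume "\<not> 0 \<le> y" "0 \<le> y + h"
    then show ?thesis by (simp add: max_def)
  qed (auto simp: max_def power2_eq_square algebra_simps)
  have **: "(max 0 (y + h))\<^sup>2 - (max 0 y)\<^sup>2 - 2 * max 0 y * h \<le> h\<^sup>2"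
  proof (cases "0 \<le> y"; cases "0 \<le> y + h")
    assume "0 \<le> y" "\<not> 0 \<le> y + h"
    have "0 \<le> (y + h)\<^sup>2" by simp
    then show ?thesis using \<open>0 \<le> y\<close> \<open>\<not> 0 \<le> y + h\<close> by (simp add: max_def power2_eq_square algebra_simps)
  next
    assume "\<not> 0 \<le> y" "0 \<le> y + h"
    then have "(y + h)\<^sup>2 \<le> h\<^sup>2" by (intro power_mono) auto
    then show ?thesis using \<open>\<not> 0 \<le> y\<close> \<open>0 \<le> y + h\<close> by (simp add: max_def)
  qed (auto simp: max_def power2_eq_square algebra_simps)
  show "\<bar>(max 0 (y + h))\<^sup>2 - (max 0 y)\<^sup>2 - 2 * max 0 y * h\<bar> \<le> h\<^sup>2" using * ** by linarith
qed

lemma lipschitz_on_interval: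
  fixes f f' :: "real \<Rightarrow> real"
  assumes D: "\<And>v. (f has_real_derivative f' v) (at v)" and c: "continuous_on UNIV f'"
  obtains L where "L > 0" "\<And>x y. \<bar>x\<bar> \<le> R \<Longrightarrow> \<bar>y\<bar> \<le> R \<Longrightarrow> \<bar>f x - f y\<bar> \<le> L * \<bar>x - y\<bar>"
proof -
  have "bounded (f' ` {-R..R})"
    by (intro compact_imp_bounded compact_continuous_image continuous_on_subset[OF c]) auto
  then obtain L where L: "L > 0" "\<And>x. x \<in> {-R..R} \<Longrightarrow> \<bar>f' x\<bar> \<le> L"
    unfolding bounded_pos by auto
  have "\<bar>f x - f y\<bar> \<le> L * \<bar>x - y\<bar>" if "\<bar>x\<bar> \<le> R" "\<bar>y\<bar> \<le> R" for x y
  proof -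
    have "norm (f x - f y) \<le> L * norm (x - y)"
      by (rule field_differentiable_bound[of "{-R..R}" f f'])
        (use D L that in \<open>auto intro: DERIV_subset simp: abs_le_iff\<close>)
    then show ?thesis by simp
  qed
  then show thesis using L(1) that by blast
qed

text \<open>\<open>tangent\<close> is convexity in the form used. \<open>kruzkov\<close> asks only
  for test functions vanishing in the past, since the initial data are carried by the values of
  \<open>U\<close> at time zero.\<close>

locale entropy_field = bounded_field +
  fixes f f' :: "real \<Rightarrow> real" and U :: "real \<times> real \<Rightarrow> real"
  assumes f_deriv: "\<And>v. (f has_real_derivative f' v) (at v)"
    and f'_cont: "continuous_on UNIV f'"
    and tangent: "f k + f' k * (v - k) \<le> f v"
    and pot: "potential M a b U"
    and flux: "snd z > 0 \<Longrightarrow> b z = f (a z)"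
    and kruzkov: "test_fun ph phx pht \<Longrightarrow> (\<And>z. snd z \<le> 0 \<Longrightarrow> ph z = 0) \<Longrightarrow>
        0 \<le> (LINT z : {z. snd z > 0} | lborel. \<bar>a z - k\<bar> * pht z + sgn (a z - k) * (f (a z) - f k) * phx z)"
begin

lemma f_cont: "continuous_on UNIV f"
  using f_deriv by (auto intro!: continuous_at_imp_continuous_on DERIV_isCont)

lemma f_measurable [measurable]: "f \<in> borel_measurable borel"
  using f_cont by (rule borel_measurable_continuous_onI)

lemmas U_lip = potentialD(1)[OF pot]
lemmas avg_U_deriv = potentialD(2)[OF pot]

text \<open>Jensen's inequality, by averaging the tangent line of \<open>f\<close> at the mean. Time
  zero is allowed because the box contains only later times.\<close>

lemma avg_subsolution:
  assumes e: "e > 0" and z: "0 \<le> snd z"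
  shows "f (avg e a z) \<le> avg e b z"
proof -
  interpret e: prob_space "unif e" using e by (rule prob_space_unif)
  let ?k = "avg e a z"
  have ia: "integrable (unif e) (\<lambda>w. a (z + w))" and ib: "integrable (unif e) (\<lambda>w. b (z + w))"
    by (auto intro!: integrable_avg[where B=M] e a_bound b_bound)
  have "f ?k = f ?k + f' ?k * (avg e a z - ?k)" by simp
  also have "\<dots> = (LINT w|unif e. f ?k + f' ?k * (a (z + w) - ?k))"
    using ia e.prob_space by (simp add: avg_def)
  also have "\<dots> \<le> avg e b z" unfolding avg_def
  proof (rule integral_mono_AE)
    have "AE w in unif e. w \<in> box 0 (e, e)" by (rule AE_unif[OF e])
    then show "AE w in unif e. f (LINT w|unif e. a (z + w)) + f' (LINT w|unif e. a (z + w)) * (a (z + w) - (LINT w|unif e. a (z + w))) \<le> b (z + w)"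
    proof eventually_elim
      fix w assume "w \<in> box 0 (e, e)"
      then have "snd (z + w) > 0" using z by (simp add: mem_box_zero_pair)
      then show "f (LINT w|unif e. a (z + w)) + f' (LINT w|unif e. a (z + w)) * (a (z + w) - (LINT w|unif e. a (z + w))) \<le> b (z + w)"
        using tangent flux by simp
    qed
  qed (use ia ib in auto)
  finally show ?thesis .
qed

text \<open>The test function is the squared positive part of \<open>\<theta>\<close> minus the excess of the averaged potential
  over \<open>\<phi>\<close>; with \<open>k\<close> the slope of \<open>\<phi>\<close> at the contact point the quadratic terms of
  Kruzkov's inequality cancel in the limit, so that \<open>a = k\<close> near that point.\<close>

lemma potential_supersolution:
  assumes D: "\<And>z. (\<phi> has_derivative (\<lambda>(h, k). \<phi>x z * h + \<phi>t z * k)) (at z)"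
    and cx: "continuous_on UNIV \<phi>x" and ct: "continuous_on UNIV \<phi>t"
    and z0: "snd z0 > 0"
    and min: "\<And>z. U z0 - \<phi> z0 + (norm (z - z0))\<^sup>2 \<le> U z - \<phi> z"
  shows "0 \<le> \<phi>t z0 + f (\<phi>x z0)"
proof (rule ccontr)
  define k where "k = \<phi>x z0"
  \<comment> \<open>A quarter of the defect: near \<open>z0\<close> the oscillation of
    \<open>\<phi>t\<close>, and that of \<open>\<phi>x\<close> multiplied by \<open>L\<close>, use
    up \<open>\<eta>\<close> each, which still leaves \<open>- 2 * \<eta>\<close>.\<close>
  define \<eta> where "\<eta> = - (\<phi>t z0 + f k) / 4"
  define m where "m = U z0 - \<phi> z0"
  assume "\<not> 0 \<le> \<phi>t z0 + f (\<phi>x z0)"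
  then have \<eta>: "\<eta> > 0" "\<phi>t z0 + f k = - 4 * \<eta>" by (auto simp: \<eta>_def k_def)
  obtain L where L: "L > 0" "\<And>x y. \<bar>x\<bar> \<le> max M \<bar>k\<bar> \<Longrightarrow> \<bar>y\<bar> \<le> max M \<bar>k\<bar> \<Longrightarrow> \<bar>f x - f y\<bar> \<le> L * \<bar>x - y\<bar>"
    using lipschitz_on_interval[OF f_deriv f'_cont, of "max M \<bar>k\<bar>"] by blast
  have Lk: "\<bar>f (a z) - f k\<bar> \<le> L * \<bar>a z - k\<bar>" for z
    by (rule L(2)) (use a_bound[of z] in auto)
  have "isCont \<phi>x z0" "isCont \<phi>t z0" using cx ct continuous_on_eq_continuous_at[OF open_UNIV] by blast+
  then obtain r1 r2 where r12: "r1 > 0" "\<And>z. dist z z0 < r1 \<Longrightarrow> dist (\<phi>x z) (\<phi>x z0) < \<eta> / L"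
    "r2 > 0" "\<And>z. dist z z0 < r2 \<Longrightarrow> dist (\<phi>t z) (\<phi>t z0) < \<eta>"
    unfolding continuous_at_eps_delta using \<eta>(1) L(1) by (metis divide_pos_pos)
  define r where "r = min (snd z0) (min r1 r2)"
  have r: "r > 0" using z0 r12 by (simp add: r_def)
  have near: "snd z > 0" "L * \<bar>\<phi>x z - k\<bar> \<le> \<eta>" "\<bar>\<phi>t z - \<phi>t z0\<bar> \<le> \<eta>" if "norm (z - z0) < r" for z
  proof -
    have "\<bar>snd (z - z0)\<bar> \<le> norm (z - z0)" using norm_snd_le[of "snd (z - z0)" "fst (z - z0)"] unfolding prod.collapse by simp
    moreover have "norm (z - z0) < snd z0" using that by (simp add: r_def)
    ultimately show "snd z > 0" unfolding snd_diff by linarith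
    have "\<bar>\<phi>x z - k\<bar> < \<eta> / L" using r12(2)[of z] that by (simp add: r_def dist_norm k_def)
    then show "L * \<bar>\<phi>x z - k\<bar> \<le> \<eta>" using L(1) by (simp add: field_simps)
    show "\<bar>\<phi>t z - \<phi>t z0\<bar> \<le> \<eta>" using r12(4)[of z] that by (simp add: r_def dist_norm)
  qed
  \<comment> \<open>By \<open>min\<close>, \<open>\<xi>\<close> is positive only where the squared
    distance to \<open>z0\<close> is below \<open>\<theta>\<close>; an averaging error of at most
    \<open>\<theta>\<close> doubles this to \<open>r\<^sup>2 / 2\<close>, still inside the
    ball.\<close>
  define \<theta> where "\<theta> = r\<^sup>2 / 4"
  have \<theta>: "\<theta> > 0" using r by (simp add: \<theta>_def)
  define \<xi> where "\<xi> z = max 0 (m + \<theta> - U z + \<phi> z)" for z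
  define X where "X e z = max 0 (m + \<theta> - avg e U z + \<phi> z)" for e z
  have cphi: "continuous_on UNIV \<phi>"
    using D by (auto intro!: continuous_at_imp_continuous_on has_derivative_continuous)
  have c\<xi>: "continuous_on UNIV \<xi>"
    unfolding \<xi>_def by (intro continuous_intros cphi lip_const_continuous[OF U_lip])
  have \<xi>_pos: "norm (z - z0) < r" if "\<xi> z > 0" for z
  proof -
    have "(norm (z - z0))\<^sup>2 < \<theta>" using that min[of z] by (simp add: \<xi>_def m_def)
    also have "\<dots> < r\<^sup>2" using r by (simp add: \<theta>_def)
    finally show ?thesis using r by (simp add: power2_less_imp_less)
  qed
  define e0 where "e0 = \<theta> / (2 * M + 1)"
  have e0: "e0 > 0" "2 * M * e0 \<le> \<theta>"
    using \<theta> M_nonneg by (auto simp: e0_def field_simps)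
  have avgU: "\<bar>avg e U z - U z\<bar> \<le> \<theta>" if "0 < e" "e \<le> e0" for e z
  proof -
    have "2 * M * e \<le> 2 * M * e0" using that M_nonneg by (intro mult_left_mono) auto
    then show ?thesis using lip_const_avg_near[OF U_lip that(1), of z] e0(2) by linarith
  qed
  have X_pos: "norm (z - z0) < r" if "0 < e" "e \<le> e0" "X e z > 0" for e z
  proof -
    have "m + \<theta> - avg e U z + \<phi> z > 0" using that(3) by (simp add: X_def)
    then have "(norm (z - z0))\<^sup>2 < 2 * \<theta>" using min[of z] avgU[OF that(1,2), of z] by (simp add: m_def)
    also have "\<dots> < r\<^sup>2" using r by (simp add: \<theta>_def)
    finally show ?thesis using r by (simp add: power2_less_imp_less)
  qed
  have X_le: "0 \<le> X e z" "X e z \<le> 2 * \<theta>" if "0 < e" "e \<le> e0" for e z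
  proof -
    show "0 \<le> X e z" by (simp add: X_def)
    have "0 \<le> (norm (z - z0))\<^sup>2" by simp
    then have "m + \<theta> - avg e U z + \<phi> z \<le> 2 * \<theta>" using min[of z] avgU[OF that, of z] unfolding m_def by linarith
    then show "X e z \<le> 2 * \<theta>" using \<theta> by (simp add: X_def)
  qed
  have cX: "continuous_on UNIV (X e)" if "e > 0" for e
  proof -
    have "continuous_on UNIV (avg e U)"
      using avg_U_deriv[OF that] by (auto intro!: continuous_at_imp_continuous_on has_derivative_continuous)
    then show ?thesis unfolding X_def by (intro continuous_intros cphi)
  qed
  \<comment> \<open>These are the partial derivatives of the square of \<open>X e\<close>, the
    gradient of the averaged potential being the averaged field.\<close>
  define px where "px e z = 2 * X e z * (\<phi>x z - avg e a z)" for e z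
  define pt where "pt e z = 2 * X e z * (\<phi>t z + avg e b z)" for e z
  have test: "test_fun (\<lambda>z. (X e z)\<^sup>2) (px e) (pt e)" if e: "0 < e" "e \<le> e0" for e
    unfolding test_fun_def
  proof (intro conjI allI)
    fix z
    have "((\<lambda>z. m + \<theta> - avg e U z + \<phi> z) has_derivative
        (\<lambda>v. - (avg e a z * fst v - avg e b z * snd v) + (\<phi>x z * fst v + \<phi>t z * snd v))) (at z)"
      using avg_U_deriv[OF e(1), of z] D[of z] unfolding case_prod_beta'
      by (auto intro!: derivative_eq_intros)
    from has_derivative_compose[OF this DERIV_square_positive_part[unfolded has_field_derivative_def]]
    have "((\<lambda>z. (X e z)\<^sup>2) has_derivative (\<lambda>v. 2 * X e z * (- (avg e a z * fst v - avg e b z * snd v) + (\<phi>x z * fst v + \<phi>t z * snd v)))) (at z)"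
      by (simp add: X_def)
    then show "((\<lambda>z. (X e z)\<^sup>2) has_derivative (\<lambda>(h, k). px e z * h + pt e z * k)) (at z)"
      by (rule has_derivative_eq_rhs) (auto simp: fun_eq_iff px_def pt_def algebra_simps)
    show "continuous_on UNIV (px e)" "continuous_on UNIV (pt e)"
      unfolding px_def pt_def
      by (intro continuous_intros cX[OF e(1)] cx ct continuous_avg[where B=M] e a_meas b_meas a_bound b_bound)+
    show "\<exists>R. \<forall>z. R < norm z \<longrightarrow> (X e z)\<^sup>2 = 0"
    proof (intro exI[of _ "norm z0 + r"] allI impI)
      fix z :: "real \<times> real" assume "norm z0 + r < norm z"
      then have "\<not> norm (z - z0) < r" using norm_triangle_ineq2[of z z0] by linarith
      then show "(X e z)\<^sup>2 = 0" using X_pos[OF e, of z] X_le(1)[OF e, of z] by fastforce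
    qed
  qed auto
  define G where "G e z = indicator {z. snd z > 0} z * (\<bar>a z - k\<bar> * pt e z + sgn (a z - k) * (f (a z) - f k) * px e z)" for e z
  \<comment> \<open>The almost everywhere limit of \<open>G e\<close>, in which the averages have
    become \<open>a\<close> and \<open>b\<close> themselves.\<close>
  define G0 where "G0 z = indicator {z. snd z > 0} z * (\<bar>a z - k\<bar> * (2 * \<xi> z * (\<phi>t z + b z)) + sgn (a z - k) * (f (a z) - f k) * (2 * \<xi> z * (\<phi>x z - a z)))" for z
  have pos: "0 \<le> (LINT z|lborel. G e z)" if e: "0 < e" "e \<le> e0" for e
  proof -
    have "(X e z)\<^sup>2 = 0" if "snd z \<le> 0" for z
      using X_pos[OF e, of z] X_le(1)[OF e, of z] near(1)[of z] that by fastforce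
    from kruzkov[OF test[OF e] this, of k] show ?thesis
      unfolding set_lebesgue_integral_def G_def by simp
  qed
  have [measurable]: "\<phi>x \<in> borel_measurable borel" "\<phi>t \<in> borel_measurable borel" "\<xi> \<in> borel_measurable borel"
    using cx ct c\<xi> by (auto intro: borel_measurable_continuous_onI)
  have [measurable]: "{z::real\<times>real. snd z > 0} \<in> sets borel"
    by (intro borel_open open_Collect_less continuous_intros)
  define rs where "rs n = e0 / real (Suc n)" for n
  have rs: "rs n > 0" "rs n \<le> e0" for n
    using e0(1) by (auto simp: rs_def field_simps)
  have rs0: "rs \<longlonglongrightarrow> 0"
    unfolding rs_def using tendsto_mult[OF tendsto_const[of e0] LIMSEQ_Suc[OF lim_1_over_n]] by simp
  have rs_right: "filterlim rs (at_right 0) sequentially"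
    by (rule tendsto_imp_filterlim_at_right[OF rs0]) (simp add: rs(1))
  have [measurable]: "X (rs n) \<in> borel_measurable borel" "avg (rs n) a \<in> borel_measurable borel" "avg (rs n) b \<in> borel_measurable borel" for n
    using cX[OF rs(1)] by (auto intro: borel_measurable_continuous_onI avg_measurable rs)
  \<comment> \<open>A majorant independent of \<open>e\<close>, assembled from
    \<open>X e z \<le> 2 * \<theta>\<close>, the Lipschitz bound of \<open>f\<close>, and the values
    of \<open>\<phi>x\<close> and \<open>\<phi>t\<close> near \<open>z0\<close>.\<close>
  define C where "C = (M + \<bar>k\<bar>) * (4 * \<theta> * (\<bar>\<phi>t z0\<bar> + \<eta> + M)) + L * (M + \<bar>k\<bar>) * (4 * \<theta> * (\<bar>k\<bar> + \<eta> / L + M))"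
  have ak: "\<bar>a z - k\<bar> \<le> M + \<bar>k\<bar>" for z using a_bound[of z] by linarith
  have G_bound: "\<bar>G e z\<bar> \<le> C * indicator (cball z0 r) z" if e: "0 < e" "e \<le> e0" for e z
  proof (cases "X e z > 0")
    case False
    then have "X e z = 0" using X_le(1)[OF e, of z] by linarith
    then have "G e z = 0" by (simp add: G_def px_def pt_def)
    then show ?thesis using \<eta>(1) L(1) \<theta> M_nonneg by (auto simp: C_def indicator_def)
  next
    case True
    from X_pos[OF e True] have z: "norm (z - z0) < r" .
    then have ind: "indicat_real (cball z0 r) z = 1" by (simp add: dist_norm norm_minus_commute)
    have t: "\<bar>\<phi>t z + avg e b z\<bar> \<le> \<bar>\<phi>t z0\<bar> + \<eta> + M"
      using near(3)[OF z] avg_bound[OF e(1) b_meas b_bound, of z] by linarith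
    have "\<bar>\<phi>x z - k\<bar> \<le> \<eta> / L" using near(2)[OF z] L(1) by (simp add: field_simps)
    then have x: "\<bar>\<phi>x z - avg e a z\<bar> \<le> \<bar>k\<bar> + \<eta> / L + M"
      using avg_bound[OF e(1) a_meas a_bound, of z] by linarith
    have pt: "\<bar>pt e z\<bar> \<le> 4 * \<theta> * (\<bar>\<phi>t z0\<bar> + \<eta> + M)"
      unfolding pt_def abs_mult by (rule mult_mono) (use X_le[OF e, of z] t \<theta> in auto)
    have px: "\<bar>px e z\<bar> \<le> 4 * \<theta> * (\<bar>k\<bar> + \<eta> / L + M)"
      unfolding px_def abs_mult by (rule mult_mono) (use X_le[OF e, of z] x \<theta> in auto)
    have 1: "\<bar>\<bar>a z - k\<bar> * pt e z\<bar> \<le> (M + \<bar>k\<bar>) * (4 * \<theta> * (\<bar>\<phi>t z0\<bar> + \<eta> + M))"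
      unfolding abs_mult by (rule mult_mono) (use ak[of z] pt M_nonneg in auto)
    have "\<bar>f (a z) - f k\<bar> \<le> L * (M + \<bar>k\<bar>)"
      using Lk[of z] mult_left_mono[OF ak[of z], of L] L(1) by linarith
    then have "\<bar>sgn (a z - k) * (f (a z) - f k)\<bar> \<le> L * (M + \<bar>k\<bar>)"
      using L(1) M_nonneg by (auto simp: abs_mult sgn_if)
    then have 2: "\<bar>sgn (a z - k) * (f (a z) - f k) * px e z\<bar> \<le> L * (M + \<bar>k\<bar>) * (4 * \<theta> * (\<bar>k\<bar> + \<eta> / L + M))"
      unfolding abs_mult[of _ "px e z"] by (rule mult_mono) (use px M_nonneg L(1) in auto)
    have "\<bar>G e z\<bar> \<le> \<bar>\<bar>a z - k\<bar> * pt e z + sgn (a z - k) * (f (a z) - f k) * px e z\<bar>"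
      unfolding G_def by (simp add: indicator_def)
    also have "\<dots> \<le> C" unfolding C_def using 1 2 by linarith
    finally show ?thesis by (simp add: ind)
  qed
  have iC: "integrable lborel (\<lambda>z. C * indicat_real (cball z0 r) z)"
    by (intro integrable_mult_right integrable_real_indicator)
      (use emeasure_lborel_cball_finite[of z0 r] in auto)
  have G_lim: "AE z in lborel. (\<lambda>n. G (rs n) z) \<longlonglongrightarrow> G0 z"
    using AE_avg_tendsto[OF a_meas a_bound] AE_avg_tendsto[OF b_meas b_bound]
  proof eventually_elim
    case (elim z)
    have A: "(\<lambda>n. avg (rs n) a z) \<longlonglongrightarrow> a z" "(\<lambda>n. avg (rs n) b z) \<longlonglongrightarrow> b z"
      using filterlim_compose[OF elim(1) rs_right] filterlim_compose[OF elim(2) rs_right] .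
    show ?case unfolding G_def G0_def pt_def px_def X_def \<xi>_def
      by (intro tendsto_intros A lip_const_avg_tendsto[OF U_lip rs(1) rs0])
  qed
  have G0_meas: "G0 \<in> borel_measurable lborel" unfolding G0_def by measurable
  have G_meas: "G (rs n) \<in> borel_measurable lborel" for n unfolding G_def px_def pt_def by measurable
  have G_dom: "AE z in lborel. norm (G (rs n) z) \<le> C * indicat_real (cball z0 r) z" for n
    using G_bound[OF rs] by (intro AE_I2) simp
  note lim = integral_dominated_convergence[OF G0_meas G_meas iC G_lim G_dom]
  note iG0 = integrable_dominated_convergence[OF G0_meas G_meas iC G_lim G_dom]
  have G0_nonneg: "0 \<le> (LINT z|lborel. G0 z)"
    by (rule LIMSEQ_le_const[OF lim]) (use pos[OF rs] in auto)
  have G0_le: "G0 z \<le> - (4 * \<eta> * (\<xi> z * \<bar>a z - k\<bar>))" for z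
  proof (cases "\<xi> z > 0")
    case False
    then have "\<xi> z = 0" by (simp add: \<xi>_def)
    then show ?thesis by (simp add: G0_def)
  next
    case True
    from \<xi>_pos[OF True] have z: "norm (z - z0) < r" .
    have s: "\<bar>a z - k\<bar> = sgn (a z - k) * (a z - k)" by (simp add: abs_sgn)
    \<comment> \<open>With \<open>b = f a\<close> the terms in \<open>a * f a\<close> cancel, and
      the remainder regroups around \<open>k\<close> and \<open>f k\<close>.\<close>
    have "G0 z = 2 * \<xi> z * (\<bar>a z - k\<bar> * (\<phi>t z + f k) + sgn (a z - k) * (f (a z) - f k) * (\<phi>x z - k))"
      unfolding G0_def s using near(1)[OF z] flux[of z] by (simp add: algebra_simps)
    also have "\<dots> \<le> 2 * \<xi> z * (\<bar>a z - k\<bar> * (- 2 * \<eta>))"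
    proof (intro mult_left_mono)
      have "\<phi>t z + f k \<le> - 3 * \<eta>" using near(3)[OF z] \<eta>(2) by linarith
      then have "\<bar>a z - k\<bar> * (\<phi>t z + f k) \<le> \<bar>a z - k\<bar> * (- 3 * \<eta>)" by (intro mult_left_mono) auto
      moreover have "sgn (a z - k) * (f (a z) - f k) * (\<phi>x z - k) \<le> \<bar>a z - k\<bar> * \<eta>"
      proof -
        have "sgn (a z - k) * (f (a z) - f k) * (\<phi>x z - k) \<le> \<bar>f (a z) - f k\<bar> * \<bar>\<phi>x z - k\<bar>"
          by (rule order_trans[OF abs_ge_self]) (auto simp: abs_mult sgn_if)
        also have "\<dots> \<le> (L * \<bar>a z - k\<bar>) * \<bar>\<phi>x z - k\<bar>" by (intro mult_right_mono Lk) auto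
        also have "\<dots> = \<bar>a z - k\<bar> * (L * \<bar>\<phi>x z - k\<bar>)" by simp
        also have "\<dots> \<le> \<bar>a z - k\<bar> * \<eta>" by (intro mult_left_mono near(2)[OF z]) auto
        finally show ?thesis .
      qed
      ultimately show "\<bar>a z - k\<bar> * (\<phi>t z + f k) + sgn (a z - k) * (f (a z) - f k) * (\<phi>x z - k) \<le> \<bar>a z - k\<bar> * (- 2 * \<eta>)"
        by (simp add: algebra_simps)
    qed (use True in simp)
    finally show ?thesis by (simp add: algebra_simps)
  qed
  define H where "H z = \<xi> z * \<bar>a z - k\<bar>" for z
  have H0: "0 \<le> H z" for z by (simp add: H_def \<xi>_def)
  have [measurable]: "G0 \<in> borel_measurable borel" "H \<in> borel_measurable borel" unfolding G0_def H_def by measurable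
  have iH: "integrable lborel H"
  proof (rule Bochner_Integration.integrable_bound[where f="\<lambda>z. G0 z / (4 * \<eta>)"])
    show "AE z in lborel. norm (H z) \<le> norm (G0 z / (4 * \<eta>))"
    proof (rule AE_I2)
      fix z
      have "4 * \<eta> * H z \<le> \<bar>G0 z\<bar>" using G0_le[of z] unfolding H_def by linarith
      then show "norm (H z) \<le> norm (G0 z / (4 * \<eta>))" using H0[of z] \<eta>(1) by (simp add: field_simps)
    qed
  qed (use iG0 in auto)
  \<comment> \<open>Kruzkov's inequality makes the integral of \<open>G0\<close> nonnegative, while
    \<open>G0\<close> is at most \<open>- 4 * \<eta> * H\<close>; so the nonnegative
    \<open>H\<close> has integral zero.\<close>
  have "(LINT z|lborel. G0 z) \<le> (LINT z|lborel. - (4 * \<eta> * H z))"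
    using G0_le iG0 iH unfolding H_def[symmetric] by (intro integral_mono) auto
  then have "4 * \<eta> * (LINT z|lborel. H z) \<le> 0" using G0_nonneg by simp
  then have "(LINT z|lborel. H z) \<le> 0" using \<eta>(1) by (simp add: mult_le_0_iff)
  then have "(LINT z|lborel. H z) = 0" using H0 by (intro antisym) (auto intro: integral_nonneg)
  then have "AE z in lborel. H z = 0"
    using integral_nonneg_eq_0_iff_AE[OF iH] H0 by auto
  then have ae: "AE z in lborel. \<xi> z > 0 \<longrightarrow> a z = k"
    by eventually_elim (auto simp: H_def)
  have "\<xi> z0 > 0" using \<theta> by (simp add: \<xi>_def m_def)
  then obtain \<rho> where \<rho>: "\<rho> > 0" "\<And>z. dist z z0 < \<rho> \<Longrightarrow> \<xi> z > 0"
  proof -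
    have "open {z. \<xi> z > 0}" using c\<xi> by (intro open_Collect_less continuous_intros)
    moreover have "z0 \<in> {z. \<xi> z > 0}" using \<open>\<xi> z0 > 0\<close> by simp
    ultimately show thesis using that unfolding open_dist by blast
  qed
  \<comment> \<open>Where the slope is almost everywhere \<open>k\<close>, averages of the field are
    constant, which will make \<open>U\<close> affine. The conditions on \<open>e\<close> and
    \<open>z\<close> give half of \<open>\<rho>\<close> to the box and half to the distance from
    \<open>z0\<close>.\<close>
  have const: "avg e (pairing v) z = k * fst v - f k * snd v"
    if e: "e > 0" "4 * e < \<rho>" and z: "2 * dist z z0 < \<rho>" for e v z
  proof -
    have "avg e (pairing v) z = avg e (\<lambda>_. k * fst v - f k * snd v) z"
    proof (rule avg_cong_AE[OF e(1)])
      show "AE w in lborel. w - z \<in> box 0 (e, e) \<longrightarrow> pairing v w = k * fst v - f k * snd v"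
        using ae
      proof eventually_elim
        case (elim w)
        show ?case
        proof
          assume "w - z \<in> box 0 (e, e)"
          then have "norm (w - z) \<le> 2 * e" by (rule norm_le_box_zero_pair)
          then have "dist w z0 < \<rho>" using e z dist_triangle[of w z0 z] by (simp add: dist_norm)
          then have "\<xi> w > 0" by (rule \<rho>(2))
          then have "a w = k" "snd w > 0" using elim near(1)[OF \<xi>_pos] by auto
          then show "pairing v w = k * fst v - f k * snd v" using flux[of w] by (simp add: pairing_def)
        qed
      qed
    qed auto
    then show ?thesis using prob_space.prob_space[OF prob_space_unif[OF e(1)]] by (simp add: avg_def)
  qed
  have affine: "U (z0 + v) - U z0 = k * fst v - f k * snd v" if v: "2 * norm v < \<rho>" for v
  proof -
    interpret u: prob_space unit_meas by (rule prob_space_unit_meas)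
    have "avg e U (z0 + v) - avg e U z0 = k * fst v - f k * snd v" if e: "e > 0" "4 * e < \<rho>" for e
    proof -
      have "AE s in unit_meas. s \<in> {0..1}" unfolding unit_meas_def by (rule AE_uniform_measureI) auto
      then have "AE s in unit_meas. avg e (pairing v) (z0 + s *\<^sub>R v) = k * fst v - f k * snd v"
      proof eventually_elim
        case (elim s)
        then have "norm (s *\<^sub>R v) \<le> norm v" by (auto intro: mult_left_le_one_le)
        then show ?case using v by (intro const e) (simp add: dist_norm)
      qed
      moreover have [measurable]: "avg e (pairing v) \<in> borel_measurable borel"
        using e(1) by (rule avg_measurable) simp
      ultimately have "(LINT s|unit_meas. avg e (pairing v) (z0 + s *\<^sub>R v)) = (LINT s|unit_meas. k * fst v - f k * snd v)"
        by (intro integral_cong_AE) auto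
      then show ?thesis unfolding increment_avg[OF e(1) avg_U_deriv[OF e(1)]] using u.prob_space by simp
    qed
    moreover have "eventually (\<lambda>n. 4 * rs n < \<rho>) sequentially"
      using order_tendstoD(2)[OF tendsto_mult[OF tendsto_const[of 4] rs0], of \<rho>] \<rho>(1) by simp
    ultimately have "eventually (\<lambda>n. avg (rs n) U (z0 + v) - avg (rs n) U z0 = k * fst v - f k * snd v) sequentially"
      by (auto elim!: eventually_mono intro: rs(1))
    from tendsto_eventually[OF this] have "(\<lambda>n. avg (rs n) U (z0 + v) - avg (rs n) U z0) \<longlonglongrightarrow> k * fst v - f k * snd v" .
    moreover have "(\<lambda>n. avg (rs n) U (z0 + v) - avg (rs n) U z0) \<longlonglongrightarrow> U (z0 + v) - U z0"
      by (intro tendsto_intros lip_const_avg_tendsto[OF U_lip rs(1) rs0])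
    ultimately show ?thesis by (simp add: LIMSEQ_unique)
  qed
  have zz: "z0 + 0 *\<^sub>R (0, 1) = z0" by (simp add: prod_eq_iff)
  \<comment> \<open>In the time direction \<open>U\<close> is now \<open>U z0 - f k * s\<close>, so
    \<open>\<phi>\<close> plus \<open>f k * s\<close> has a local maximum at \<open>s = 0\<close>.
    Its derivative \<open>\<phi>t z0 + f k\<close> must vanish, whereas it equals
    \<open>- 4 * \<eta>\<close>.\<close>
  have "((\<lambda>s. \<phi> (z0 + s *\<^sub>R (0, 1)) + f k * s) has_real_derivative (\<phi>t z0 + f k)) (at 0)"
  proof -
    have line: "((\<lambda>s. z0 + s *\<^sub>R (0, 1)) has_derivative (\<lambda>h. h *\<^sub>R (0, 1))) (at (0::real))"
      by (auto intro!: derivative_eq_intros)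
    have "(\<phi> has_derivative (\<lambda>(h, k). \<phi>x z0 * h + \<phi>t z0 * k)) (at (z0 + 0 *\<^sub>R (0, 1)))"
      unfolding zz by (rule D)
    from has_derivative_compose[OF line this]
    have "((\<lambda>s. \<phi> (z0 + s *\<^sub>R (0, 1))) has_derivative (\<lambda>h. \<phi>t z0 * h)) (at 0)"
      by (rule has_derivative_eq_rhs) (simp add: fun_eq_iff)
    then have "((\<lambda>s. \<phi> (z0 + s *\<^sub>R (0, 1))) has_real_derivative \<phi>t z0) (at 0)"
      by (simp add: has_field_derivative_def)
    then show ?thesis by (auto intro!: derivative_eq_intros)
  qed
  moreover have "\<forall>s. \<bar>0 - s\<bar> < \<rho> / 2 \<longrightarrow> \<phi> (z0 + s *\<^sub>R (0, 1)) + f k * s \<le> \<phi> (z0 + 0 *\<^sub>R (0, 1)) + f k * 0"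
  proof (intro allI impI)
    fix s :: real assume "\<bar>0 - s\<bar> < \<rho> / 2"
    then have "U (z0 + s *\<^sub>R (0, 1)) - U z0 = - f k * s"
      using affine[of "s *\<^sub>R (0, 1)"] by (simp add: mult.commute)
    moreover have "0 \<le> (norm (z0 + s *\<^sub>R (0, 1) - z0))\<^sup>2" by simp
    ultimately show "\<phi> (z0 + s *\<^sub>R (0, 1)) + f k * s \<le> \<phi> (z0 + 0 *\<^sub>R (0, 1)) + f k * 0"
      unfolding zz using min[of "z0 + s *\<^sub>R (0, 1)"] by linarith
  qed
  ultimately have "\<phi>t z0 + f k = 0"
    using \<rho>(1) by (intro DERIV_local_max[of _ _ 0 "\<rho> / 2"]) auto
  then show False using \<eta> by simp
qed

end

section \<open>Comparison\<close>

lemma sqrt_one_plus_square_gt: "\<bar>y\<bar> < sqrt (1 + y\<^sup>2)"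
  by (rule real_less_rsqrt) simp

lemma norm_pair_square: "(norm (z :: real \<times> real))\<^sup>2 = (fst z)\<^sup>2 + (snd z)\<^sup>2"
  by (simp add: norm_prod_def)

lemma DERIV_sqrt_one_plus_square:
  "((\<lambda>y. sqrt (1 + y\<^sup>2)) has_real_derivative y / sqrt (1 + y\<^sup>2)) (at y)"
proof -
  have "1 + y\<^sup>2 > 0" using zero_le_power2[of y] by linarith
  then show ?thesis by (auto intro!: derivative_eq_intros simp: field_simps)
qed

context entropy_field
begin

text \<open>The penalty \<open>P\<close> grows linearly, so that the minimum of \<open>U - \<phi> + P\<close> is attained; it is below \<open>\<gamma>\<close> at
  \<open>z1\<close> by the choice of \<open>R\<close>; and \<open>P\<^sub>t > L \<bar>P\<^sub>x\<bar>\<close> makes \<open>\<phi> - P\<close> a strict subsolution.\<close>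

lemma comparison:
  assumes D: "\<And>z. (\<phi> has_derivative (\<lambda>(h, k). \<phi>x z * h + \<phi>t z * k)) (at z)"
    and cx: "continuous_on UNIV \<phi>x" and ct: "continuous_on UNIV \<phi>t"
    and lip: "lip_const N \<phi>" and bx: "\<And>z. \<bar>\<phi>x z\<bar> \<le> N"
    and sub: "\<And>z. z \<in> Q \<Longrightarrow> \<phi>t z + f (\<phi>x z) \<le> 0"
    and Q: "closed Q" "\<And>z. z \<in> Q \<Longrightarrow> 0 \<le> snd z"
    and bd: "\<And>z. z \<in> Q \<Longrightarrow> z \<notin> interior Q \<Longrightarrow> \<phi> z \<le> U z"
    and z1: "z1 \<in> Q"
  shows "\<phi> z1 \<le> U z1"
proof (rule ccontr)
  assume "\<not> \<phi> z1 \<le> U z1"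
  define \<gamma> where "\<gamma> = \<phi> z1 - U z1"
  have \<gamma>: "\<gamma> > 0" using \<open>\<not> \<phi> z1 \<le> U z1\<close> by (simp add: \<gamma>_def)
  have N0: "0 \<le> N" by (rule lip_const_nonneg[OF lip])
  \<comment> \<open>One more than the Lipschitz constant \<open>M + N\<close> of
    \<open>U - \<phi>\<close>, so that the penalty, growing at rate \<open>2 * A\<close>, forces the
    minimum into a bounded set.\<close>
  define A where "A = M + N + 1"
  have A: "A > 0" using M_nonneg N0 by (simp add: A_def)
  \<comment> \<open>\<open>f\<close> will be evaluated at \<open>\<phi>x\<close> and at
    \<open>\<phi>x - Px\<close>, where \<open>Px\<close> is bounded by \<open>2 * A\<close>.\<close>
  obtain L where L: "L > 0" "\<And>x y. \<bar>x\<bar> \<le> N + 2 * A \<Longrightarrow> \<bar>y\<bar> \<le> N + 2 * A \<Longrightarrow> \<bar>f x - f y\<bar> \<le> L * \<bar>x - y\<bar>"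
    using lipschitz_on_interval[OF f_deriv f'_cont, of "N + 2 * A"] by blast
  \<comment> \<open>The surplus \<open>1\<close> over \<open>L\<close> becomes the strictness in the
    final contradiction.\<close>
  define K where "K = L + 1"
  \<comment> \<open>Makes \<open>y z1 = - (A / \<gamma> + 1)\<close>, where the penalty is at most
    \<open>A / (A / \<gamma> + 1)\<close>, which is below \<open>\<gamma>\<close>.\<close>
  define R where "R = sqrt (1 + (fst z1)\<^sup>2) + K * snd z1 + A / \<gamma> + 1"
  define y where "y z = sqrt (1 + (fst z)\<^sup>2) + K * snd z - R" for z :: "real \<times> real"
  \<comment> \<open>A smooth version of \<open>2 * A\<close> times the positive part of
    \<open>y\<close>, with \<open>y\<close> a smooth version of
    \<open>\<bar>x\<bar> + K * t - R\<close>: the penalty is small deep inside a backward cone of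
    speed \<open>K\<close>.\<close>
  define P where "P z = A * (y z + sqrt (1 + (y z)\<^sup>2))" for z
  define g where "g z = A * (1 + y z / sqrt (1 + (y z)\<^sup>2))" for z
  define Px where "Px z = g z * (fst z / sqrt (1 + (fst z)\<^sup>2))" for z
  define Pt where "Pt z = g z * K" for z
  have sp: "0 < sqrt (1 + s\<^sup>2)" for s :: real using sqrt_one_plus_square_gt[of s] by linarith
  have frac: "\<bar>s / sqrt (1 + s\<^sup>2)\<bar> < 1" for s :: real
    using sqrt_one_plus_square_gt[of s] sp[of s] by (simp add: abs_divide)
  have g: "0 < g z" "g z \<le> 2 * A" for z
  proof -
    have "0 < 1 + y z / sqrt (1 + (y z)\<^sup>2)" "1 + y z / sqrt (1 + (y z)\<^sup>2) \<le> 2" using frac[of "y z"] by linarith+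
    then show "0 < g z" "g z \<le> 2 * A" using A mult_left_mono[of _ 2 A] unfolding g_def by (simp_all add: mult.commute)
  qed
  have DP: "(P has_derivative (\<lambda>(h, k). Px z * h + Pt z * k)) (at z)" for z
  proof -
    have "((\<lambda>z. sqrt (1 + (fst z)\<^sup>2)) has_derivative (\<lambda>v. fst z / sqrt (1 + (fst z)\<^sup>2) * fst v)) (at z)"
      by (rule has_derivative_compose[OF has_derivative_fst[OF has_derivative_ident]
          DERIV_sqrt_one_plus_square[unfolded has_field_derivative_def]])
    then have "(y has_derivative (\<lambda>v. fst z / sqrt (1 + (fst z)\<^sup>2) * fst v + K * snd v)) (at z)"
      unfolding y_def[abs_def]
      by (rule has_derivative_eq_rhs[OF has_derivative_diff[OF has_derivative_add[OF _
            has_derivative_mult_right[OF has_derivative_snd[OF has_derivative_ident]]] has_derivative_const]]) simp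
    moreover have "((\<lambda>y. A * (y + sqrt (1 + y\<^sup>2))) has_real_derivative g z) (at (y z))"
      unfolding g_def by (rule derivative_eq_intros DERIV_sqrt_one_plus_square refl)+ simp
    ultimately have "((\<lambda>z. A * (y z + sqrt (1 + (y z)\<^sup>2))) has_derivative
      (\<lambda>v. g z * (fst z / sqrt (1 + (fst z)\<^sup>2) * fst v + K * snd v))) (at z)"
      unfolding has_field_derivative_def by (rule has_derivative_compose)
    then show ?thesis unfolding P_def[abs_def]
      by (rule has_derivative_eq_rhs) (auto simp: fun_eq_iff Px_def Pt_def algebra_simps)
  qed
  have cy: "continuous_on UNIV y" unfolding y_def by (intro continuous_intros)
  have cg: "continuous_on UNIV g" unfolding g_def
    by (intro continuous_intros cy) (use sp in \<open>auto simp: less_le\<close>)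
  have cPx: "continuous_on UNIV Px" unfolding Px_def
    by (intro continuous_intros cg) (use sp in \<open>auto simp: less_le\<close>)
  have cPt: "continuous_on UNIV Pt" unfolding Pt_def by (intro continuous_intros cg)
  have cP: "continuous_on UNIV P" unfolding P_def by (intro continuous_intros cy)
  have P0: "0 \<le> P z" for z
    using sqrt_one_plus_square_gt[of "y z"] A unfolding P_def by (intro mult_nonneg_nonneg) auto
  have P_ge: "2 * A * (\<bar>fst z\<bar> + \<bar>snd z\<bar> - R) \<le> P z" if "0 \<le> snd z" for z
  proof -
    have "\<bar>fst z\<bar> + \<bar>snd z\<bar> - R \<le> y z"
      using sqrt_one_plus_square_gt[of "fst z"] that mult_right_mono[of 1 K "snd z"] L(1) by (simp add: y_def K_def)
    moreover have "y z < sqrt (1 + (y z)\<^sup>2)"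
      by (rule le_less_trans[OF abs_ge_self sqrt_one_plus_square_gt])
    moreover have "2 * c \<le> d + e" if "c \<le> d" "d < e" for c d e :: real using that by linarith
    ultimately have "2 * (\<bar>fst z\<bar> + \<bar>snd z\<bar> - R) \<le> y z + sqrt (1 + (y z)\<^sup>2)" by blast
    from mult_left_mono[OF this, of A] show ?thesis using A by (simp add: P_def mult.assoc mult.left_commute)
  qed
  have P_z1: "P z1 < \<gamma>"
  proof -
    define s where "s = A / \<gamma> + 1"
    have s: "s > 0" "A / \<gamma> < s" using A \<gamma> by (auto simp: s_def add_pos_pos)
    have y1: "y z1 = - s" by (simp add: y_def R_def s_def)
    have "(sqrt (1 + s\<^sup>2) - s) * s \<le> (sqrt (1 + s\<^sup>2) - s) * (sqrt (1 + s\<^sup>2) + s)"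
      using sqrt_one_plus_square_gt[of s] sp[of s] by (intro mult_left_mono) auto
    also have "\<dots> = 1" using sp[of s] by (simp add: algebra_simps power2_eq_square[symmetric])
    finally have "sqrt (1 + s\<^sup>2) - s \<le> 1 / s" using s(1) by (simp add: field_simps)
    then have "P z1 \<le> A * (1 / s)" unfolding P_def y1 using A by (intro mult_left_mono) auto
    also have "\<dots> < \<gamma>" using s \<gamma> A by (simp add: field_simps)
    finally show ?thesis .
  qed
  define h where "h z = U z - \<phi> z + P z" for z
  have ch: "continuous_on UNIV h"
    unfolding h_def by (intro continuous_intros lip_const_continuous[OF U_lip] lip_const_continuous[OF lip] cP)
  have diff: "U z - \<phi> z \<ge> U w - \<phi> w - (M + N) * (\<bar>fst z - fst w\<bar> + \<bar>snd z - snd w\<bar>)" for z w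
    using abs_le_D2[OF lip_const_diff_le[OF U_lip, of z w]] abs_le_D1[OF lip_const_diff_le[OF lip, of z w]]
    by (simp add: distrib_right)
  \<comment> \<open>Beyond this size the penalty outweighs the Lipschitz variation of
    \<open>U - \<phi>\<close>, so the minimum of \<open>h\<close> over \<open>Q\<close> can be
    sought in a compact set.\<close>
  define B where "B = (M + N) * (\<bar>fst z1\<bar> + \<bar>snd z1\<bar>) + 2 * A * R + P z1"
  have far: "h z1 < h z" if z: "z \<in> Q" "\<bar>fst z\<bar> + \<bar>snd z\<bar> > B" for z
  proof -
    define S where "S = \<bar>fst z\<bar> + \<bar>snd z\<bar>"
    define S1 where "S1 = \<bar>fst z1\<bar> + \<bar>snd z1\<bar>"
    define d where "d = \<bar>fst z - fst z1\<bar> + \<bar>snd z - snd z1\<bar>"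
    have "d \<le> S + S1" unfolding d_def S_def S1_def by linarith
    then have "(M + N) * d \<le> (M + N) * (S + S1)"
      using M_nonneg N0 by (intro mult_left_mono) auto
    moreover have "2 * A * S = (M + N) * S + (A + 1) * S" by (simp add: A_def algebra_simps)
    moreover have "0 \<le> A * S" using A by (simp add: S_def)
    then have "S \<le> (A + 1) * S" by (simp add: distrib_right)
    moreover have "U z1 - \<phi> z1 - (M + N) * d \<le> U z - \<phi> z" unfolding d_def by (rule diff)
    moreover have "2 * A * S - 2 * A * R \<le> P z"
      using P_ge[OF Q(2)[OF z(1)]] by (simp add: S_def right_diff_distrib)
    ultimately have "U z1 - \<phi> z1 - (M + N) * S1 - 2 * A * R + S \<le> U z - \<phi> z + P z"
      unfolding distrib_left by linarith
    moreover have "(M + N) * S1 + 2 * A * R + P z1 < S" using z(2) by (simp add: B_def S_def S1_def)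
    ultimately show ?thesis unfolding h_def by linarith
  qed
  have h1: "h z1 < 0" using P_z1 by (simp add: h_def \<gamma>_def)
  obtain z0 where z0: "z0 \<in> Q" "\<And>z. z \<in> Q \<Longrightarrow> h z0 \<le> h z"
  proof -
    let ?S = "Q \<inter> cball 0 (max (2 * \<bar>B\<bar>) (norm z1))"
    have "compact ?S" using Q(1) by (intro closed_Int_compact) auto
    moreover have "?S \<noteq> {}" using z1 by auto
    ultimately obtain z0 where z0: "z0 \<in> ?S" "\<And>z. z \<in> ?S \<Longrightarrow> h z0 \<le> h z"
      using continuous_attains_inf[of ?S h] continuous_on_subset[OF ch subset_UNIV] by blast
    have "h z0 \<le> h z" if "z \<in> Q" for z
    proof (cases "z \<in> ?S")
      case False
      then have "norm z > 2 * \<bar>B\<bar>" using that by auto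
      then have "\<bar>fst z\<bar> + \<bar>snd z\<bar> > B" using norm_Pair_le[of "fst z" "snd z"] by simp
      then have "h z1 < h z" by (rule far[OF that])
      moreover have "h z0 \<le> h z1" using z1 by (intro z0(2)) auto
      ultimately show ?thesis by linarith
    qed (rule z0(2))
    then show thesis using z0(1) that by blast
  qed
  \<comment> \<open>Off the interior \<open>h\<close> is nonnegative, whereas
    \<open>h z1 < 0\<close>. Being interior to \<open>Q\<close> also places \<open>z0\<close> at
    positive time.\<close>
  have "z0 \<in> interior Q"
  proof (rule ccontr)
    assume "z0 \<notin> interior Q"
    then have "0 \<le> h z0" using bd[OF z0(1)] P0[of z0] by (simp add: h_def)
    then show False using z0(2)[OF z1] h1 by linarith
  qed
  then obtain r where r: "r > 0" "ball z0 r \<subseteq> Q" by (meson mem_interior)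
  have t0: "snd z0 > 0"
  proof -
    have "z0 - (0, r / 2) \<in> ball z0 r" using r(1) by (simp add: dist_norm)
    then have "0 \<le> snd (z0 - (0, r / 2))" using r(2) Q(2) by blast
    then show ?thesis using r(1) by simp
  qed
  \<comment> \<open>\<open>z0\<close> minimises \<open>h\<close> only over \<open>Q\<close>, while
    \<open>potential_supersolution\<close> wants a strict global minimum. In the ball the summand
    \<open>1\<close> suffices; outside, \<open>P z0 / r\<^sup>2\<close> pays for discarding
    \<open>P z\<close>, and \<open>2 * (M + N) / r\<close> for the variation of
    \<open>U - \<phi>\<close>. The added square has zero gradient at \<open>z0\<close>.\<close>
  define \<sigma> where "\<sigma> = 1 + P z0 / r\<^sup>2 + 2 * (M + N) / r"
  define \<psi> where "\<psi> z = \<phi> z - P z - \<sigma> * ((fst z - fst z0)\<^sup>2 + (snd z - snd z0)\<^sup>2)" for z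
  have "0 \<le> (\<phi>t z0 - Pt z0 - \<sigma> * (2 * (snd z0 - snd z0))) + f (\<phi>x z0 - Px z0 - \<sigma> * (2 * (fst z0 - fst z0)))"
  proof (rule potential_supersolution[where \<phi>=\<psi> and \<phi>x="\<lambda>z. \<phi>x z - Px z - \<sigma> * (2 * (fst z - fst z0))"
        and \<phi>t="\<lambda>z. \<phi>t z - Pt z - \<sigma> * (2 * (snd z - snd z0))"])
    fix z
    show "(\<psi> has_derivative (\<lambda>(h, k). (\<phi>x z - Px z - \<sigma> * (2 * (fst z - fst z0))) * h
        + (\<phi>t z - Pt z - \<sigma> * (2 * (snd z - snd z0))) * k)) (at z)"
    proof -
      have "((\<lambda>z. \<sigma> * ((fst z - fst z0)\<^sup>2 + (snd z - snd z0)\<^sup>2)) has_derivative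
          (\<lambda>v. \<sigma> * (2 * (fst z - fst z0) * fst v + 2 * (snd z - snd z0) * snd v))) (at z)"
        by (auto intro!: derivative_eq_intros simp: fun_eq_iff algebra_simps)
      from has_derivative_diff[OF has_derivative_diff[OF D[of z] DP[of z]] this]
      show ?thesis unfolding \<psi>_def[abs_def]
        by (rule has_derivative_eq_rhs) (auto simp: fun_eq_iff algebra_simps)
    qed
    show "U z0 - \<psi> z0 + (norm (z - z0))\<^sup>2 \<le> U z - \<psi> z"
    proof -
      let ?n = "norm (z - z0)"
      have n2: "?n\<^sup>2 = (fst z - fst z0)\<^sup>2 + (snd z - snd z0)\<^sup>2" by (simp add: norm_pair_square)
      have eq: "U z - \<psi> z = h z + \<sigma> * ?n\<^sup>2" "U z0 - \<psi> z0 = h z0" by (simp_all add: \<psi>_def h_def n2)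
      have "h z0 + ?n\<^sup>2 \<le> h z + \<sigma> * ?n\<^sup>2"
      proof (cases "?n < r")
        case True
        then have "h z0 \<le> h z" using r(2) by (intro z0(2)) (auto simp: dist_norm norm_minus_commute)
        moreover have "1 \<le> \<sigma>" using P0[of z0] r(1) M_nonneg N0 by (simp add: \<sigma>_def)
        then have "?n\<^sup>2 \<le> \<sigma> * ?n\<^sup>2" by (simp add: mult_le_cancel_right1)
        ultimately show ?thesis by linarith
      next
        case False
        then have n: "r \<le> ?n" "0 < ?n" using r(1) by auto
        have a: "\<bar>fst z - fst z0\<bar> + \<bar>snd z - snd z0\<bar> \<le> 2 * ?n"
          using norm_fst_le[of "fst (z - z0)" "snd (z - z0)"] norm_snd_le[of "snd (z - z0)" "fst (z - z0)"]
          unfolding prod.collapse by simp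
        have "h z \<ge> U z - \<phi> z" using P0[of z] by (simp add: h_def)
        also have "U z - \<phi> z \<ge> U z0 - \<phi> z0 - (M + N) * (2 * ?n)"
          using diff[where z=z and w=z0] mult_left_mono[OF a, of "M + N"] M_nonneg N0 by linarith
        finally have 1: "h z \<ge> h z0 - P z0 - (M + N) * (2 * ?n)" by (simp add: h_def)
        have "r\<^sup>2 \<le> ?n\<^sup>2" using n r(1) by (intro power_mono) auto
        then have 2: "P z0 \<le> P z0 / r\<^sup>2 * ?n\<^sup>2"
          using mult_left_mono[of "r\<^sup>2" "?n\<^sup>2" "P z0 / r\<^sup>2"] P0[of z0] r(1) by simp
        have "?n * r \<le> ?n * ?n" using n by (intro mult_left_mono) auto
        then have "(2 * (M + N) / r) * (?n * r) \<le> (2 * (M + N) / r) * ?n\<^sup>2"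
          unfolding power2_eq_square by (rule mult_left_mono) (use M_nonneg N0 r(1) in auto)
        moreover have "(2 * (M + N) / r) * (?n * r) = (M + N) * (2 * ?n)" using r(1) by (simp add: field_simps)
        ultimately have 3: "(M + N) * (2 * ?n) \<le> 2 * (M + N) / r * ?n\<^sup>2" by (simp only:)
        show ?thesis using 1 2 3 unfolding \<sigma>_def by (simp add: algebra_simps)
      qed
      then show ?thesis unfolding eq .
    qed
  qed (use t0 in \<open>auto intro!: continuous_intros cx ct cPx cPt\<close>)
  then have s: "0 \<le> \<phi>t z0 - Pt z0 + f (\<phi>x z0 - Px z0)" by simp
  have Px: "\<bar>Px z0\<bar> \<le> g z0"
  proof -
    have "\<bar>Px z0\<bar> = g z0 * \<bar>fst z0 / sqrt (1 + (fst z0)\<^sup>2)\<bar>" unfolding Px_def abs_mult using g(1)[of z0] by simp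
    also have "\<dots> \<le> g z0 * 1" using frac[of "fst z0"] g(1)[of z0] by (intro mult_left_mono) auto
    finally show ?thesis by simp
  qed
  \<comment> \<open>Passing from \<open>\<phi>x\<close> to \<open>\<phi>x - Px\<close> raises
    \<open>f\<close> by at most \<open>L * g z0\<close>, while \<open>Pt\<close> subtracts
    \<open>(L + 1) * g z0\<close>; the surplus \<open>g z0 > 0\<close> gives the
    contradiction.\<close>
  have "\<bar>f (\<phi>x z0 - Px z0) - f (\<phi>x z0)\<bar> \<le> L * \<bar>\<phi>x z0 - Px z0 - \<phi>x z0\<bar>"
    using bx[of z0] Px g[of z0] A by (intro L(2)) auto
  also have "\<dots> \<le> L * g z0" using Px L(1) by simp
  finally have "f (\<phi>x z0 - Px z0) \<le> f (\<phi>x z0) + L * g z0" by linarith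
  moreover have "Pt z0 = L * g z0 + g z0" by (simp add: Pt_def K_def algebra_simps)
  ultimately show False using s sub[OF z0(1)] g(1)[of z0] by linarith
qed

end

section \<open>From entropy solutions to potentials\<close>

lemma test_fun_supp:
  assumes "test_fun ph phx pht"
  obtains R where "R > 0" "\<And>z. norm z > R \<Longrightarrow> ph z = 0 \<and> phx z = 0 \<and> pht z = 0"
proof -
  obtain R where R: "\<And>z. norm z > R \<Longrightarrow> ph z = 0" using assms by (auto simp: test_fun_def)
  have "phx z = 0 \<and> pht z = 0" if z: "norm z > R" for z
  proof -
    \<comment> \<open>The support condition concerns \<open>ph\<close> alone; the derivatives vanish
      as well because the exterior is open.\<close>
    have "open {z::real\<times>real. norm z > R}" by (intro open_Collect_less continuous_intros)
    from has_derivative_transform_within_open[OF _ this, of ph "\<lambda>(h, k). phx z * h + pht z * k" z UNIV "\<lambda>_. 0"]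
    have "((\<lambda>_. 0) has_derivative (\<lambda>(h, k). phx z * h + pht z * k)) (at z)"
      using assms R z unfolding test_fun_def by auto
    from has_derivative_unique[OF this has_derivative_const] have e: "(\<lambda>(h, k). phx z * h + pht z * k) = (\<lambda>_. 0)" .
    show ?thesis using fun_cong[OF e, of "(1, 0)"] fun_cong[OF e, of "(0, 1)"] by simp
  qed
  then show thesis using that[of "max 1 R"] R by auto
qed

lemma integrable_bounded_times_compact_supp:
  fixes g q :: "real \<times> real \<Rightarrow> real"
  assumes g: "g \<in> borel_measurable borel" "\<And>w. \<bar>g w\<bar> \<le> B" and c: "continuous_on UNIV q"
    and R: "\<And>z. norm z > R \<Longrightarrow> q z = 0"
  shows "integrable lborel (\<lambda>w. g w * q w)"
proof -
  have "bounded (q ` cball 0 R)" by (intro compact_imp_bounded compact_continuous_image continuous_on_subset[OF c]) auto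
  then obtain C where C: "C > 0" "\<And>w. w \<in> cball 0 R \<Longrightarrow> \<bar>q w\<bar> \<le> C"
    unfolding bounded_pos by auto
  have qC: "\<bar>q w\<bar> \<le> C" for w using C R[of w] by (cases "norm w \<le> R") auto
  have [measurable]: "q \<in> borel_measurable borel" using c by (rule borel_measurable_continuous_onI)
  have [measurable]: "g \<in> borel_measurable borel" by fact
  have "\<bar>g w * q w\<bar> \<le> B * C" for w
    unfolding abs_mult using g(2)[of w] qC[of w] by (intro mult_mono) auto
  then show ?thesis
    by (intro integrableI_bounded_set[of "cball 0 R" _ _ "B * C"])
      (use R emeasure_lborel_cball_finite[of "0::real\<times>real" R] in auto)
qed

lemma half_plane_sets [measurable]:
  "{z::real\<times>real. snd z > 0} \<in> sets borel" "{z::real\<times>real. snd z \<le> 0} \<in> sets borel"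
  by (intro borel_open open_Collect_less borel_closed closed_Collect_le continuous_intros)+

lemma integral_lborel_fst:
  fixes G :: "real \<times> real \<Rightarrow> real"
  assumes "integrable lborel G"
  shows "(LINT w|lborel. G w) = (LINT x|lborel. LINT t|lborel. G (x, t))"
  using lborel_pair.integral_fst'[of G] assms by (simp add: lborel_prod)

lemma integral_lborel_snd:
  fixes G :: "real \<times> real \<Rightarrow> real"
  assumes "integrable lborel G"
  shows "(LINT w|lborel. G w) = (LINT t|lborel. LINT x|lborel. G (x, t))"
  using lborel_pair.integral_snd[of "\<lambda>x t. G (x, t)"] assms by (simp add: lborel_prod)

lemma integral_compact_supp_derivative:
  fixes q q' :: "real \<Rightarrow> real"
  assumes D: "\<And>s. (q has_real_derivative q' s) (at s)" and c: "continuous_on UNIV q'"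
    and R: "R > 0" "\<And>s. \<bar>s\<bar> > R \<Longrightarrow> q s = 0 \<and> q' s = 0"
  shows "(LINT s|lborel. q' s) = 0" "(LINT s|lborel. indicator {..0} s * q' s) = q 0"
proof -
  have F: "(LINT s|lborel. indicator {-(R+1)..c} s *\<^sub>R q' s) = q c - q (-(R+1))" if "-(R+1) \<le> c" for c
    by (rule integral_FTC_atLeastAtMost[OF that])
      (use D c in \<open>auto simp: has_real_derivative_iff_has_vector_derivative intro: has_vector_derivative_at_within continuous_on_subset\<close>)
  have "(LINT s|lborel. q' s) = (LINT s|lborel. indicator {-(R+1)..R+1} s *\<^sub>R q' s)"
  proof (intro Bochner_Integration.integral_cong refl)
    show "q' s = indicator {-(R+1)..R+1} s *\<^sub>R q' s" for s
      using R(2)[of s] R(1) by (cases "\<bar>s\<bar> > R") (auto simp: indicator_def)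
  qed
  then show "(LINT s|lborel. q' s) = 0" using F[of "R+1"] R by simp
  have "(LINT s|lborel. indicator {..0} s * q' s) = (LINT s|lborel. indicator {-(R+1)..0} s *\<^sub>R q' s)"
  proof (intro Bochner_Integration.integral_cong refl)
    show "indicator {..0} s * q' s = indicator {-(R+1)..0} s *\<^sub>R q' s" for s
      using R(2)[of s] R(1) by (cases "\<bar>s\<bar> > R") (auto simp: indicator_def)
  qed
  then show "(LINT s|lborel. indicator {..0} s * q' s) = q 0" using F[of 0] R by simp
qed

lemma test_fun_partial:
  assumes "test_fun ph phx pht"
  shows "((\<lambda>s. ph (s, t)) has_real_derivative phx (x, t)) (at x)"
    "((\<lambda>s. ph (x, s)) has_real_derivative pht (x, t)) (at t)"
proof -
  have D: "(ph has_derivative (\<lambda>(h, k). phx z * h + pht z * k)) (at z)" for z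
    using assms unfolding test_fun_def by blast
  have "((\<lambda>s. (s, t)) has_derivative (\<lambda>h. (h, 0))) (at x)" by (auto intro!: derivative_eq_intros)
  from has_derivative_compose[OF this D]
  show "((\<lambda>s. ph (s, t)) has_real_derivative phx (x, t)) (at x)"
    unfolding has_field_derivative_def by (rule has_derivative_eq_rhs) (simp add: fun_eq_iff)
  have "((\<lambda>s. (x, s)) has_derivative (\<lambda>h. (0, h))) (at t)" by (auto intro!: derivative_eq_intros)
  from has_derivative_compose[OF this D]
  show "((\<lambda>s. ph (x, s)) has_real_derivative pht (x, t)) (at t)"
    unfolding has_field_derivative_def by (rule has_derivative_eq_rhs) (simp add: fun_eq_iff)
qed

context
  fixes ph phx pht :: "real \<times> real \<Rightarrow> real"
  assumes test: "test_fun ph phx pht"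
begin

lemma test_fun_continuous: "continuous_on UNIV ph" "continuous_on UNIV phx" "continuous_on UNIV pht"
  using test unfolding test_fun_def
  by (auto intro!: continuous_at_imp_continuous_on has_derivative_continuous)

lemma integrable_test_fun:
  assumes "g \<in> borel_measurable borel" "\<And>w. \<bar>g w\<bar> \<le> B"
  shows "integrable lborel (\<lambda>w. g w * phx w)" "integrable lborel (\<lambda>w. g w * pht w)"
proof -
  obtain R where R: "R > 0" "\<And>z. norm z > R \<Longrightarrow> ph z = 0 \<and> phx z = 0 \<and> pht z = 0"
    using test_fun_supp[OF test] by metis
  show "integrable lborel (\<lambda>w. g w * phx w)" "integrable lborel (\<lambda>w. g w * pht w)"
    using assms test_fun_continuous R by (auto intro!: integrable_bounded_times_compact_supp[of _ B _ R])
qed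

lemma test_fun_slice_supp:
  obtains R where "R > 0" "\<And>x t. \<bar>x\<bar> > R \<or> \<bar>t\<bar> > R \<Longrightarrow> ph (x, t) = 0 \<and> phx (x, t) = 0 \<and> pht (x, t) = 0"
proof -
  obtain R where R: "R > 0" "\<And>z. norm z > R \<Longrightarrow> ph z = 0 \<and> phx z = 0 \<and> pht z = 0"
    using test_fun_supp[OF test] by metis
  have "norm (x, t) > R" if "\<bar>x\<bar> > R \<or> \<bar>t\<bar> > R" for x t :: real
    using that norm_fst_le[of x t] norm_snd_le[of t x] by auto
  then show thesis using that R by blast
qed

lemma integrable_test_fun_initial:
  fixes g :: "real \<Rightarrow> real"
  assumes [measurable]: "g \<in> borel_measurable borel" and B: "\<And>w. \<bar>g w\<bar> \<le> B"
  shows "integrable lborel (\<lambda>x. g x * ph (x, 0))"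
proof -
  obtain R where R: "R > 0" "\<And>x t. \<bar>x\<bar> > R \<or> \<bar>t\<bar> > R \<Longrightarrow> ph (x, t) = 0 \<and> phx (x, t) = 0 \<and> pht (x, t) = 0"
    using test_fun_slice_supp by blast
  have c: "continuous_on UNIV (\<lambda>x. ph (x, 0))"
    by (intro continuous_on_compose2[OF test_fun_continuous(1)] continuous_intros) auto
  have "bounded ((\<lambda>x. ph (x, 0)) ` {-R..R})"
    by (intro compact_imp_bounded compact_continuous_image continuous_on_subset[OF c]) auto
  then obtain C where C: "C > 0" "\<And>x. x \<in> {-R..R} \<Longrightarrow> \<bar>ph (x, 0)\<bar> \<le> C"
    unfolding bounded_pos by auto
  have qC: "\<bar>ph (x, 0)\<bar> \<le> C" for x using C R(2)[of x 0] by (cases "\<bar>x\<bar> \<le> R") (auto simp: abs_le_iff)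
  have [measurable]: "(\<lambda>x. ph (x, 0)) \<in> borel_measurable borel" using c by (rule borel_measurable_continuous_onI)
  have "\<bar>g x * ph (x, 0)\<bar> \<le> B * C" for x
    unfolding abs_mult using B[of x] qC[of x] by (intro mult_mono) auto
  moreover have "g x * ph (x, 0) = 0" if "x \<notin> cbox (-R) R" for x
  proof -
    have "\<bar>x\<bar> > R" using that by auto
    then show ?thesis using R(2)[of x 0] by simp
  qed
  ultimately show ?thesis by (intro integrable_bounded_cbox[of _ "B * C" "-R" R]) auto
qed

lemma integral_pht: "(LINT w|lborel. pht w) = 0"
proof -
  obtain R where R: "R > 0" "\<And>x t. \<bar>x\<bar> > R \<or> \<bar>t\<bar> > R \<Longrightarrow> ph (x, t) = 0 \<and> phx (x, t) = 0 \<and> pht (x, t) = 0"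
    using test_fun_slice_supp by blast
  have "(LINT t|lborel. pht (x, t)) = 0" for x
    by (rule integral_compact_supp_derivative(1)[where q="\<lambda>t. ph (x, t)" and R=R])
      (use R test_fun_partial[OF test] in \<open>auto intro!: continuous_on_compose2[OF test_fun_continuous(3)] continuous_intros\<close>)
  then show ?thesis using integrable_test_fun(2)[of "\<lambda>_. 1" 1] by (subst integral_lborel_fst) auto
qed

text \<open>Integrating in time from the past turns the initial term into an integral over the past
  of data constant in time. Hence the extension of a solution by its data can be tested on the whole
  plane.\<close>

lemma integral_past_pht:
  fixes g :: "real \<Rightarrow> real"
  assumes [measurable]: "g \<in> borel_measurable borel" and B: "\<And>w. \<bar>g w\<bar> \<le> B"
  shows "(LINT w|lborel. indicator {z. snd z \<le> 0} w * g (fst w) * pht w) = (LINT x|lborel. g x * ph (x, 0))"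
proof -
  obtain R where R: "R > 0" "\<And>x t. \<bar>x\<bar> > R \<or> \<bar>t\<bar> > R \<Longrightarrow> ph (x, t) = 0 \<and> phx (x, t) = 0 \<and> pht (x, t) = 0"
    using test_fun_slice_supp by blast
  have m: "(\<lambda>w::real\<times>real. indicator {z. snd z \<le> 0} w * g (fst w)) \<in> borel_measurable borel"
  proof -
    have "(\<lambda>w. g (fst w)) \<in> borel_measurable (borel \<Otimes>\<^sub>M (borel :: real measure))" by measurable
    then have "(\<lambda>w. g (fst w)) \<in> borel_measurable (borel :: (real \<times> real) measure)" by (simp add: borel_prod)
    then show ?thesis by (intro borel_measurable_times borel_measurable_indicator half_plane_sets)
  qed
  have i: "integrable lborel (\<lambda>w. indicator {z. snd z \<le> 0} w * g (fst w) * pht w)"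
    by (rule integrable_test_fun(2)[OF m, of B]) (use B order_trans[OF abs_ge_zero B] in \<open>auto simp: indicator_def\<close>)
  have eq: "(LINT t|lborel. indicator {z. snd z \<le> 0} (x, t) * g (fst (x, t)) * pht (x, t)) = g x * ph (x, 0)" for x
  proof -
    have "(LINT t|lborel. indicator {z. snd z \<le> 0} (x, t) * g (fst (x, t)) * pht (x, t))
      = (LINT t|lborel. g x * (indicator {..0} t * pht (x, t)))"
      by (intro Bochner_Integration.integral_cong) (auto simp: indicator_def)
    also have "\<dots> = g x * (LINT t|lborel. indicator {..0} t * pht (x, t))" by simp
    also have "(LINT t|lborel. indicator {..0} t * pht (x, t)) = ph (x, 0)"
      by (rule integral_compact_supp_derivative(2)[where q="\<lambda>t. ph (x, t)" and R=R])
        (use R test_fun_partial[OF test] in \<open>auto intro!: continuous_on_compose2[OF test_fun_continuous(3)] continuous_intros\<close>)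
    finally show ?thesis .
  qed
  show ?thesis unfolding integral_lborel_fst[OF i] eq ..
qed

lemma integral_future_phx: "(LINT w|lborel. indicator {z. snd z > 0} w * phx w) = 0"
proof -
  obtain R where R: "R > 0" "\<And>x t. \<bar>x\<bar> > R \<or> \<bar>t\<bar> > R \<Longrightarrow> ph (x, t) = 0 \<and> phx (x, t) = 0 \<and> pht (x, t) = 0"
    using test_fun_slice_supp by blast
  have i: "integrable lborel (\<lambda>w. indicator {z. snd z > 0} w * phx w)"
    by (rule integrable_test_fun(1)[OF borel_measurable_indicator[OF half_plane_sets(1)], of 1]) (simp add: indicator_def)
  have "(LINT x|lborel. phx (x, t)) = 0" for t
    by (rule integral_compact_supp_derivative(1)[where q="\<lambda>x. ph (x, t)" and R=R])
      (use R test_fun_partial[OF test] in \<open>auto intro!: continuous_on_compose2[OF test_fun_continuous(2)] continuous_intros\<close>)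
  moreover have "(LINT x|lborel. indicator {z. snd z > 0} (x, t) * phx (x, t)) = indicator {0<..} t * (LINT x|lborel. phx (x, t))" for t :: real
    by (subst integral_mult_right_zero[symmetric], intro Bochner_Integration.integral_cong) (auto simp: indicator_def)
  ultimately show ?thesis unfolding integral_lborel_snd[OF i] by simp
qed

lemma integral_future_pht: "(LINT w|lborel. indicator {z. snd z > 0} w * pht w) = - (LINT x|lborel. ph (x, 0))"
proof -
  have "(LINT w|lborel. indicator {z. snd z > 0} w * pht w + indicator {z. snd z \<le> 0} w * pht w) = (LINT w|lborel. pht w)"
    by (intro Bochner_Integration.integral_cong) (auto simp: indicator_def)
  moreover have "integrable lborel (\<lambda>w. indicator {z. snd z > 0} w * pht w)" "integrable lborel (\<lambda>w. indicator {z. snd z \<le> 0} w * pht w)"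
    using integrable_test_fun(2)[OF borel_measurable_indicator[OF half_plane_sets(1)], of 1]
      integrable_test_fun(2)[OF borel_measurable_indicator[OF half_plane_sets(2)], of 1]
    by (simp_all add: indicator_def)
  ultimately show ?thesis using integral_past_pht[of "\<lambda>_. 1" 1] integral_pht by simp
qed

end

section \<open>Bounded representatives, weak form and initial values\<close>

definition clip :: "real \<Rightarrow> real \<Rightarrow> real" where
  "clip B c = max (- B) (min B c)"

lemma clip_bound: "0 \<le> B \<Longrightarrow> \<bar>clip B c\<bar> \<le> B"
  by (auto simp: clip_def)

lemma clip_eq: "\<bar>c\<bar> \<le> B \<Longrightarrow> clip B c = c"
  by (auto simp: clip_def)

lemma clip_measurable [measurable]: "clip B \<in> borel_measurable borel"
  unfolding clip_def by measurable

text \<open>For \<open>k\<close> beyond the range of \<open>a\<close> and \<open>v0\<close> the sign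
  in Kruzkov's inequality is constant and the inequality is linear; one \<open>k\<close> below and
  one above the range give the two halves of the equality.\<close>

lemma entropy_solution_weak:
  fixes f :: "real \<Rightarrow> real" and a :: "real \<times> real \<Rightarrow> real" and v0 :: "real \<Rightarrow> real"
  assumes [measurable]: "a \<in> borel_measurable borel" "f \<in> borel_measurable borel" "v0 \<in> borel_measurable borel"
    and B: "\<And>z. \<bar>a z\<bar> \<le> B" "\<And>x. \<bar>v0 x\<bar> \<le> B" "\<And>c. \<bar>c\<bar> \<le> B + 1 \<Longrightarrow> \<bar>f c\<bar> \<le> C"
    and past: "\<And>z. snd z \<le> 0 \<Longrightarrow> a z = v0 (fst z)"
    and kr: "\<And>k. 0 \<le> (LINT z : {z. snd z > 0} | lborel. \<bar>a z - k\<bar> * pht z + sgn (a z - k) * (f (a z) - f k) * phx z)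
        + (LINT x | lborel. \<bar>v0 x - k\<bar> * ph (x, 0))"
    and test: "test_fun ph phx pht"
  shows "(LINT z|lborel. a z * pht z + (if snd z > 0 then f (a z) else 0) * phx z) = 0"
proof -
  let ?F = "{z::real\<times>real. snd z > 0}"
  have B0: "0 \<le> B" using B(1)[of 0] by linarith
  have C0: "0 \<le> C" using B(3)[of 0] B0 by linarith
  have fa: "\<bar>f (a z)\<bar> \<le> C" for z using B(1)[of z] by (intro B(3)) auto
  have mi: "(\<lambda>w. indicator ?F w * g w) \<in> borel_measurable borel" if "g \<in> borel_measurable borel" for g :: "real \<times> real \<Rightarrow> real"
    using that by (intro borel_measurable_times borel_measurable_indicator half_plane_sets)
  have i_t: "integrable lborel (\<lambda>w. indicator ?F w * g w * pht w)" and i_x: "integrable lborel (\<lambda>w. indicator ?F w * g w * phx w)"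
    if g: "g \<in> borel_measurable borel" "\<And>w. \<bar>g w\<bar> \<le> D" for g D
  proof -
    have b: "\<bar>indicator ?F w * g w\<bar> \<le> D" for w using g(2)[of w] by (auto simp: indicator_def abs_mult)
    show "integrable lborel (\<lambda>w. indicator ?F w * g w * pht w)" "integrable lborel (\<lambda>w. indicator ?F w * g w * phx w)"
      by (rule integrable_test_fun[OF test mi[OF g(1)] b])+
  qed
  define Ia where "Ia = (LINT w|lborel. indicator ?F w * a w * pht w)"
  define If where "If = (LINT w|lborel. indicator ?F w * f (a w) * phx w)"
  define I0 where "I0 = (LINT x|lborel. v0 x * ph (x, 0))"
  define J where "J = (LINT x|lborel. ph (x, 0))"
  note ia = i_t[OF assms(1) B(1)]
  have ifa: "integrable lborel (\<lambda>w. indicator ?F w * f (a w) * phx w)" by (rule i_x[OF _ fa]) measurable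
  have it: "integrable lborel (\<lambda>w. indicator ?F w * pht w)" and ix: "integrable lborel (\<lambda>w. indicator ?F w * phx w)"
    using i_t[of "\<lambda>_. 1" 1] i_x[of "\<lambda>_. 1" 1] by simp_all
  have iv: "integrable lborel (\<lambda>x. v0 x * ph (x, 0))" and ip: "integrable lborel (\<lambda>x. ph (x, 0))"
    using integrable_test_fun_initial[OF test assms(3) B(2)] integrable_test_fun_initial[OF test, of "\<lambda>_. 1" 1] by simp_all
  have main: "0 \<le> s * (Ia + If + I0)" if s: "s = 1 \<or> s = -1" for s
  proof -
    \<comment> \<open>\<open>s\<close> is the constant sign of \<open>c - k\<close> over the range.
      The \<open>f k\<close> term vanishes, and the \<open>k\<close> term of the future cancels that
      of the initial integral.\<close>
    define k where "k = - s * (B + 1)"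
    have abs: "\<bar>c - k\<bar> = s * (c - k)" "sgn (c - k) = s" if "\<bar>c\<bar> \<le> B" for c
      using s that B0 by (auto simp: k_def sgn_if)
    have "(LINT z : ?F | lborel. \<bar>a z - k\<bar> * pht z + sgn (a z - k) * (f (a z) - f k) * phx z)
      = (LINT z|lborel. s * (indicator ?F z * a z * pht z) - s * k * (indicator ?F z * pht z)
          + s * (indicator ?F z * f (a z) * phx z) - s * f k * (indicator ?F z * phx z))"
      unfolding set_lebesgue_integral_def
      by (intro Bochner_Integration.integral_cong refl) (simp add: abs[OF B(1)] algebra_simps)
    also have "\<dots> = s * Ia + s * k * J + s * If"
      using ia ifa it ix unfolding Ia_def If_def J_def
      by (simp add: integral_future_phx[OF test] integral_future_pht[OF test])
    finally have 1: "(LINT z : ?F | lborel. \<bar>a z - k\<bar> * pht z + sgn (a z - k) * (f (a z) - f k) * phx z) = s * Ia + s * k * J + s * If" .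
    have "(LINT x | lborel. \<bar>v0 x - k\<bar> * ph (x, 0)) = (LINT x | lborel. s * (v0 x * ph (x, 0)) - s * k * ph (x, 0))"
      by (intro Bochner_Integration.integral_cong refl) (simp add: abs[OF B(2)] algebra_simps)
    also have "\<dots> = s * I0 - s * k * J" using iv ip unfolding I0_def J_def by simp
    finally have 2: "(LINT x | lborel. \<bar>v0 x - k\<bar> * ph (x, 0)) = s * I0 - s * k * J" .
    show ?thesis using kr[of k] unfolding 1 2 by (simp add: algebra_simps)
  qed
  have "Ia + If + I0 = 0" using main[of 1] main[of "-1"] by simp
  moreover have "I0 = (LINT w|lborel. indicator {z. snd z \<le> 0} w * v0 (fst w) * pht w)"
    unfolding I0_def by (rule integral_past_pht[OF test assms(3) B(2), symmetric])
  moreover have "\<dots> = (LINT w|lborel. indicator {z. snd z \<le> 0} w * a w * pht w)"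
    by (intro Bochner_Integration.integral_cong refl) (auto simp: indicator_def past)
  moreover have "integrable lborel (\<lambda>w. indicator {z. snd z \<le> 0} w * a w * pht w)"
  proof (rule integrable_test_fun(2)[OF test, of _ B])
    show "(\<lambda>w. indicator {z. snd z \<le> 0} w * a w) \<in> borel_measurable borel"
      by (intro borel_measurable_times borel_measurable_indicator half_plane_sets) fact
    show "\<bar>indicator {z. snd z \<le> 0} w * a w\<bar> \<le> B" for w
      using B(1)[of w] B0 by (auto simp: indicator_def)
  qed
  moreover have "(LINT z|lborel. a z * pht z + (if snd z > 0 then f (a z) else 0) * phx z)
    = (LINT w|lborel. indicator ?F w * a w * pht w + indicator ?F w * f (a w) * phx w + indicator {z. snd z \<le> 0} w * a w * pht w)"
    by (intro Bochner_Integration.integral_cong refl) (auto simp: indicator_def)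
  ultimately show ?thesis using ia ifa unfolding Ia_def If_def by simp
qed

text \<open>Zero flux makes \<open>U\<close> constant in time in the past. Averaged slopes converge
  only almost everywhere in the plane, so Fubini is used to find one time \<open>t0\<close> at which
  they converge for almost every \<open>y\<close>; there the fundamental theorem of calculus passes
  to the limit.\<close>

lemma potential_initial:
  fixes v0 :: "real \<Rightarrow> real"
  assumes bf: "bounded_field M a b" and pot: "potential M a b U" and U0: "U 0 = 0"
    and past: "\<And>z. snd z \<le> 0 \<Longrightarrow> a z = v0 (fst z)" "\<And>z. snd z \<le> 0 \<Longrightarrow> b z = 0"
    and t: "t \<le> 0"
  shows "U (x, t) = (LBINT y=0..x. v0 y)"
proof -
  interpret bounded_field M a b by fact
  note lip = potentialD(1)[OF pot]
  note D = potentialD(2)[OF pot]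
  define r where "r n = 1 / real (Suc n)" for n
  have r: "r n > 0" for n by (simp add: r_def)
  have r0: "r \<longlonglongrightarrow> 0" unfolding r_def by (rule LIMSEQ_Suc) (rule lim_1_over_n)
  have rr: "filterlim r (at_right 0) sequentially"
    by (rule tendsto_imp_filterlim_at_right[OF r0]) (simp add: r)
  note lim = lip_const_avg_tendsto[OF lip r r0]
  \<comment> \<open>Boxes look forward in time, so they remain in the past only if both times are
    strictly negative and \<open>e\<close> is small; time zero is reached afterwards by
    continuity.\<close>
  have const_neg: "U (x, s) = U (x, t)" if st: "s < 0" "t < 0" for x s t
  proof -
    have "avg e U (x, s) - avg e U (x, t) = 0" if e: "e > 0" "e < - max s t" for e
    proof -
      have z: "avg e (pairing (0, s - t)) ((x, t) + q *\<^sub>R (0, s - t)) = 0" if q: "q \<in> {0..1}" for q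
      proof -
        have "t + q * (s - t) = (1 - q) * t + q * s" by (simp add: algebra_simps)
        also have "\<dots> \<le> (1 - q) * max s t + q * max s t"
          using q by (intro add_mono mult_left_mono) auto
        finally have q': "t + q * (s - t) \<le> max s t" by (simp add: algebra_simps)
        have "\<bar>avg e b ((x, t) + q *\<^sub>R (0, s - t)) - 0\<bar> \<le> 0"
        proof (rule avg_near[OF e(1) b_meas])
          fix w assume "w \<in> box 0 (e, e)"
          then have "snd ((x, t) + q *\<^sub>R (0, s - t) + w) \<le> 0"
            using q' e(2) by (simp add: mem_box_zero_pair)
          then show "\<bar>b ((x, t) + q *\<^sub>R (0, s - t) + w) - 0\<bar> \<le> 0" using past(2) by simp
        qed
        then show ?thesis by (simp add: avg_pairing[OF e(1)])
      qed
      have "AE q in unit_meas. q \<in> {0..1}" unfolding unit_meas_def by (rule AE_uniform_measureI) auto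
      then have "AE q in unit_meas. avg e (pairing (0, s - t)) ((x, t) + q *\<^sub>R (0, s - t)) = 0"
        by eventually_elim (rule z)
      then have "(LINT q|unit_meas. avg e (pairing (0, s - t)) ((x, t) + q *\<^sub>R (0, s - t))) = 0"
        by (rule integral_eq_zero_AE)
      then show ?thesis using increment_avg[OF e(1) D[OF e(1)], of "(x, t)" "(0, s - t)"] by simp
    qed
    moreover have "eventually (\<lambda>n. r n < - max s t) sequentially"
      using order_tendstoD(2)[OF r0, of "- max s t"] st by simp
    ultimately have "eventually (\<lambda>n. avg (r n) U (x, s) - avg (r n) U (x, t) = 0) sequentially"
      by (auto elim!: eventually_mono intro: r)
    from tendsto_eventually[OF this] have "(\<lambda>n. avg (r n) U (x, s) - avg (r n) U (x, t)) \<longlonglongrightarrow> 0" .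
    moreover have "(\<lambda>n. avg (r n) U (x, s) - avg (r n) U (x, t)) \<longlonglongrightarrow> U (x, s) - U (x, t)"
      by (intro tendsto_intros lim)
    ultimately have "0 = U (x, s) - U (x, t)" by (rule LIMSEQ_unique)
    then show ?thesis by simp
  qed
  have const: "U (x, s) = U (x, -1)" if "s \<le> 0" for x s
  proof -
    have "(\<lambda>n. (x, s - r n)) \<longlonglongrightarrow> (x, s - 0)" by (intro tendsto_intros r0)
    then have "(\<lambda>n. U (x, s - r n)) \<longlonglongrightarrow> U (x, s)"
      using continuous_on_tendsto_compose[OF lip_const_continuous[OF lip]] by force
    moreover have "U (x, s - r n) = U (x, -1)" for n
      by (rule const_neg) (use that r[of n] in auto)
    ultimately show ?thesis by (simp add: LIMSEQ_const_iff)
  qed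
  have "AE z in lborel. ((\<lambda>e. avg e a z) \<longlongrightarrow> a z) (at_right 0)" by (rule AE_avg_tendsto[OF a_meas a_bound])
  then have "AE z in lborel. (\<lambda>n. avg (r n) a z) \<longlonglongrightarrow> a z"
    by eventually_elim (rule filterlim_compose[OF _ rr])
  then have "AE z in lborel \<Otimes>\<^sub>M lborel. (\<lambda>n. avg (r n) a z) \<longlonglongrightarrow> a z" by (subst lborel_prod)
  moreover have m: "{z \<in> space (lborel \<Otimes>\<^sub>M lborel). (\<lambda>n. avg (r n) a z) \<longlonglongrightarrow> a z} \<in> sets (lborel \<Otimes>\<^sub>M lborel)"
  proof -
    have [measurable]: "avg (r n) a \<in> borel_measurable borel" for n by (rule avg_measurable[OF r a_meas])
    have "Measurable.pred borel (\<lambda>z. (\<lambda>n. avg (r n) a z - a z) \<longlonglongrightarrow> 0)" by measurable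
    then have "Measurable.pred borel (\<lambda>z. (\<lambda>n. avg (r n) a z) \<longlonglongrightarrow> a z)" by (simp add: LIM_zero_iff)
    then show ?thesis unfolding lborel_prod by (simp add: pred_def)
  qed
  ultimately have "AE y in lborel. AE s in lborel. (\<lambda>n. avg (r n) a (y, s)) \<longlonglongrightarrow> a (y, s)"
    by (intro lborel_pair.AE_pair)
  with m have "AE s in lborel. AE y in lborel. (\<lambda>n. avg (r n) a (y, s)) \<longlonglongrightarrow> a (y, s)"
    by (subst (asm) lborel_pair.AE_commute) auto
  \<comment> \<open>An interval of positive length must contain one of the good times, and the
    chosen one makes \<open>t0\<close> negative.\<close>
  moreover have "\<not> (AE s in lborel. s \<notin> {-1<..<0::real})"
  proof
    assume "AE s in lborel. s \<notin> {-1<..<0::real}"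
    then have "{-1<..<0::real} \<in> null_sets lborel" by (subst AE_iff_null_sets) auto
    then show False by (auto simp: null_sets_def)
  qed
  ultimately obtain t0 where t0: "t0 < 0" "AE y in lborel. (\<lambda>n. avg (r n) a (y, t0)) \<longlonglongrightarrow> a (y, t0)"
    by (metis (mono_tags, lifting) eventually_mono greaterThanLessThan_iff)
  have a_t0: "a (y, t0) = v0 y" for y using past(1)[of "(y, t0)"] t0(1) by simp
  have [measurable]: "v0 \<in> borel_measurable borel"
  proof -
    have "(\<lambda>y. (y, t0)) \<in> borel \<rightarrow>\<^sub>M borel" by (intro borel_measurable_continuous_onI continuous_intros)
    from measurable_compose[OF this a_meas] show ?thesis by (simp add: a_t0)
  qed
  have incr: "U (x2, t0) - U (x1, t0) = (LINT y:{x1..x2}|lborel. v0 y)" if "x1 \<le> x2" for x1 x2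
  proof -
    have c: "continuous_on UNIV (\<lambda>y. avg (r n) a (y, t0))" for n
      by (intro continuous_on_compose2[OF continuous_avg[OF r a_meas a_bound]] continuous_intros) auto
    have ftc: "(LINT y:{x1..x2}|lborel. avg (r n) a (y, t0)) = avg (r n) U (x2, t0) - avg (r n) U (x1, t0)" for n
      unfolding set_lebesgue_integral_def
    proof (rule integral_FTC_atLeastAtMost[OF that])
      show "((\<lambda>y. avg (r n) U (y, t0)) has_vector_derivative avg (r n) a (y, t0)) (at y within {x1..x2})" for y
      proof -
        have "((\<lambda>y. (y, t0)) has_derivative (\<lambda>h. (h, 0))) (at y)" by (auto intro!: derivative_eq_intros)
        from has_derivative_compose[OF this D[OF r]]
        have "((\<lambda>y. avg (r n) U (y, t0)) has_real_derivative avg (r n) a (y, t0)) (at y)"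
          unfolding has_field_derivative_def by (rule has_derivative_eq_rhs) (simp add: fun_eq_iff)
        then show ?thesis
          by (auto simp: has_real_derivative_iff_has_vector_derivative intro: has_vector_derivative_at_within)
      qed
      show "continuous_on {x1..x2} (\<lambda>y. avg (r n) a (y, t0))" using c by (rule continuous_on_subset) simp
    qed
    have "(\<lambda>n. LINT y:{x1..x2}|lborel. avg (r n) a (y, t0)) \<longlonglongrightarrow> (LINT y:{x1..x2}|lborel. v0 y)"
      unfolding set_lebesgue_integral_def
    proof (rule integral_dominated_convergence[where w="\<lambda>y. M * indicator {x1..x2} y"])
      have [measurable]: "(\<lambda>y. avg (r n) a (y, t0)) \<in> borel_measurable borel" for n
        using c by (rule borel_measurable_continuous_onI)
      show "(\<lambda>y. indicat_real {x1..x2} y *\<^sub>R avg (r n) a (y, t0)) \<in> borel_measurable lborel" for n by measurable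
      show "(\<lambda>y. indicat_real {x1..x2} y *\<^sub>R v0 y) \<in> borel_measurable lborel" by measurable
      show "integrable lborel (\<lambda>y. M * indicat_real {x1..x2} y)"
        by (intro integrable_mult_right integrable_real_indicator) (use emeasure_lborel_cbox_finite[of x1 x2] in auto)
      show "AE y in lborel. (\<lambda>n. indicat_real {x1..x2} y *\<^sub>R avg (r n) a (y, t0)) \<longlonglongrightarrow> indicat_real {x1..x2} y *\<^sub>R v0 y"
        using t0(2) by eventually_elim (auto intro!: tendsto_intros simp: a_t0)
      show "AE y in lborel. norm (indicat_real {x1..x2} y *\<^sub>R avg (r n) a (y, t0)) \<le> M * indicat_real {x1..x2} y" for n
        using avg_bound[OF r a_meas a_bound] by (intro AE_I2) (auto simp: indicator_def)
    qed
    moreover have "(\<lambda>n. avg (r n) U (x2, t0) - avg (r n) U (x1, t0)) \<longlonglongrightarrow> U (x2, t0) - U (x1, t0)"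
      by (intro tendsto_intros lim)
    ultimately show ?thesis unfolding ftc by (rule LIMSEQ_unique[symmetric])
  qed
  have "U (0, t0) = 0" using const[of t0 0] const[of 0 0] t0(1) U0 by (simp add: zero_prod_def)
  moreover have "U (x, t) = U (x, t0)" using const[of t x] const[of t0 x] t t0(1) by simp
  moreover have "(LBINT y=0..x. v0 y) = U (x, t0) - U (0, t0)"
  proof (cases "0 \<le> x")
    case True
    then show ?thesis using incr[OF True] interval_integral_Icc[of 0 x v0] by (simp add: zero_ereal_def)
  next
    case False
    then have "(LBINT y=x..0. v0 y) = U (0, t0) - U (x, t0)"
      using incr[of x 0] interval_integral_Icc[of x 0 v0] by (simp add: zero_ereal_def)
    then show ?thesis by (subst interval_integral_endpoints_reverse) simp
  qed
  ultimately show ?thesis by simp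
qed

text \<open>A solution is bounded only almost everywhere, a \<open>bounded_field\<close> at every
  point, hence the clipped representatives. In the past the field is \<open>(v0, 0)\<close>, which
  solves the equation there and supplies the initial term across time zero.\<close>

lemma entropy_solution_field:
  fixes f f' u0 :: "real \<Rightarrow> real" and u :: "real \<Rightarrow> real \<Rightarrow> real"
  assumes f_deriv: "\<And>v. (f has_real_derivative f' v) (at v)"
    and f'_cont: "continuous_on UNIV f'"
    and tangent: "\<And>k v. f k + f' k * (v - k) \<le> f v"
    and Linf: "Linfty u0" and sol: "entropy_solution f u0 u"
  obtains M a b U where "entropy_field M a b f f' U"
    "AE z in lborel. snd z > 0 \<longrightarrow> u (fst z) (snd z) = a z"
    "\<And>x t. t \<le> 0 \<Longrightarrow> U (x, t) = (LBINT y=0..x. u0 y)"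
proof -
  have [measurable]: "u0 \<in> borel_measurable borel" using Linf by (simp add: Linfty_def)
  have um [measurable]: "(\<lambda>z. u (fst z) (snd z)) \<in> borel_measurable borel"
    using sol by (simp add: entropy_solution_def)
  have "continuous_on UNIV f" using f_deriv by (auto intro!: continuous_at_imp_continuous_on DERIV_isCont)
  note cf = this
  then have fm [measurable]: "f \<in> borel_measurable borel" by (rule borel_measurable_continuous_onI)
  obtain B1 where B1: "AE x in lborel. \<bar>u0 x\<bar> \<le> B1" using Linf by (auto simp: Linfty_def)
  obtain B2 where B2: "AE z in lborel. snd z > 0 \<longrightarrow> \<bar>u (fst z) (snd z)\<bar> \<le> B2"
    using sol by (auto simp: entropy_solution_def)
  define B where "B = max 0 (max B1 B2)"
  have B0: "0 \<le> B" by (simp add: B_def)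
  have "bounded (f ` {-(B+1)..B+1})"
    by (intro compact_imp_bounded compact_continuous_image continuous_on_subset[OF cf]) auto
  then obtain C where C: "C > 0" "\<And>c. c \<in> {-(B+1)..B+1} \<Longrightarrow> \<bar>f c\<bar> \<le> C"
    unfolding bounded_pos by auto
  have fC: "\<bar>f c\<bar> \<le> C" if "\<bar>c\<bar> \<le> B + 1" for c using C(2)[of c] that by (simp add: abs_le_iff)
  define v0 where "v0 x = clip B (u0 x)" for x
  define a where "a z = (if snd z > 0 then clip B (u (fst z) (snd z)) else v0 (fst z))" for z :: "real \<times> real"
  define b where "b z = (if snd z > 0 then f (a z) else 0)" for z
  define M where "M = max B C"
  have [measurable]: "v0 \<in> borel_measurable borel" unfolding v0_def by measurable
  have am [measurable]: "a \<in> borel_measurable borel"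
  proof -
    have "(\<lambda>z. v0 (fst z)) \<in> borel_measurable (borel \<Otimes>\<^sub>M (borel :: real measure))" by measurable
    then have [measurable]: "(\<lambda>z::real\<times>real. v0 (fst z)) \<in> borel_measurable borel" by (simp add: borel_prod)
    show ?thesis unfolding a_def by (rule measurable_If) (use half_plane_sets in \<open>auto\<close>)
  qed
  have bm [measurable]: "b \<in> borel_measurable borel"
    unfolding b_def by (rule measurable_If) (use half_plane_sets in \<open>auto\<close>)
  have aB: "\<bar>a z\<bar> \<le> B" for z using clip_bound[OF B0] by (simp add: a_def v0_def)
  have vB: "\<bar>v0 x\<bar> \<le> B" for x using clip_bound[OF B0] by (simp add: v0_def)
  have bf: "bounded_field M a b"
  proof
    show "\<bar>a z\<bar> \<le> M" for z using aB[of z] by (simp add: M_def)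
    show "\<bar>b z\<bar> \<le> M" for z using fC[of "a z"] aB[of z] C(1) by (auto simp: b_def M_def)
  qed (rule am, rule bm)
  have ae_u: "AE z in lborel. snd z > 0 \<longrightarrow> u (fst z) (snd z) = a z"
    using B2 by eventually_elim (auto simp: a_def B_def intro!: clip_eq[symmetric])
  have ae_0: "AE x in lborel. u0 x = v0 x"
    using B1 by eventually_elim (auto simp: v0_def B_def intro!: clip_eq[symmetric])
  have kr: "0 \<le> (LINT z : {z. snd z > 0} | lborel. \<bar>a z - k\<bar> * pht z + sgn (a z - k) * (f (a z) - f k) * phx z)
        + (LINT x | lborel. \<bar>v0 x - k\<bar> * ph (x, 0))" if test: "test_fun ph phx pht" for ph phx pht k
  proof -
    have [measurable]: "phx \<in> borel_measurable borel" "pht \<in> borel_measurable borel"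
      using test_fun_continuous[OF test] by (auto intro: borel_measurable_continuous_onI)
    have "continuous_on UNIV (\<lambda>x. ph (x, 0))"
      by (intro continuous_on_compose2[OF test_fun_continuous(1)[OF test]] continuous_intros) auto
    then have [measurable]: "(\<lambda>x. ph (x, 0)) \<in> borel_measurable borel" by (rule borel_measurable_continuous_onI)
    have "(LINT z : {z. snd z > 0} | lborel. \<bar>a z - k\<bar> * pht z + sgn (a z - k) * (f (a z) - f k) * phx z)
      = (LINT z : {z. snd z > 0} | lborel. \<bar>u (fst z) (snd z) - k\<bar> * pht z
          + sgn (u (fst z) (snd z) - k) * (f (u (fst z) (snd z)) - f k) * phx z)"
      unfolding set_lebesgue_integral_def
    proof (rule integral_cong_AE)
      have m: "(\<lambda>z. indicator {z. snd z > 0} z *\<^sub>R (\<bar>q z - k\<bar> * pht z + sgn (q z - k) * (f (q z) - f k) * phx z)) \<in> borel_measurable lborel"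
        if [measurable]: "q \<in> borel_measurable borel" for q :: "real \<times> real \<Rightarrow> real"
        by (intro borel_measurable_scaleR) (use half_plane_sets in measurable)
      show "(\<lambda>z. indicator {z. snd z > 0} z *\<^sub>R (\<bar>a z - k\<bar> * pht z + sgn (a z - k) * (f (a z) - f k) * phx z)) \<in> borel_measurable lborel"
        by (rule m[OF am])
      show "(\<lambda>z. indicator {z. snd z > 0} z *\<^sub>R (\<bar>u (fst z) (snd z) - k\<bar> * pht z
          + sgn (u (fst z) (snd z) - k) * (f (u (fst z) (snd z)) - f k) * phx z)) \<in> borel_measurable lborel"
        by (rule m[OF um])
      show "AE z in lborel. indicator {z. snd z > 0} z *\<^sub>R (\<bar>a z - k\<bar> * pht z + sgn (a z - k) * (f (a z) - f k) * phx z)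
        = indicator {z. snd z > 0} z *\<^sub>R (\<bar>u (fst z) (snd z) - k\<bar> * pht z
          + sgn (u (fst z) (snd z) - k) * (f (u (fst z) (snd z)) - f k) * phx z)"
        using ae_u by eventually_elim (auto simp: indicator_def)
    qed
    moreover have "(LINT x | lborel. \<bar>v0 x - k\<bar> * ph (x, 0)) = (LINT x | lborel. \<bar>u0 x - k\<bar> * ph (x, 0))"
      by (rule integral_cong_AE) (use ae_0 in \<open>auto elim: eventually_mono\<close>)
    ultimately show ?thesis using sol test by (simp add: entropy_solution_def)
  qed
  have past: "a z = v0 (fst z)" "b z = 0" if "snd z \<le> 0" for z using that by (auto simp: a_def b_def)
  have "div_free_field M a b"
  proof (intro div_free_field.intro[OF bf] div_free_field_axioms.intro)
    fix ph phx pht assume test: "test_fun ph phx pht"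
    show "(LINT w|lborel. a w * pht w + b w * phx w) = 0"
      unfolding b_def
      by (rule entropy_solution_weak[OF am fm _ aB vB fC past(1) kr[OF test] test]) auto
  qed
  from div_free_field.potential_exists[OF this] obtain U where U: "potential M a b U" "U 0 = 0" by blast
  have "entropy_field M a b f f' U"
  proof (intro entropy_field.intro[OF bf] entropy_field_axioms.intro f_deriv f'_cont tangent U(1))
    show "b z = f (a z)" if "0 < snd z" for z using that by (simp add: b_def)
    show "0 \<le> (LINT z : {z. snd z > 0} | lborel. \<bar>a z - k\<bar> * pht z + sgn (a z - k) * (f (a z) - f k) * phx z)"
      if "test_fun ph phx pht" "\<And>z. snd z \<le> 0 \<Longrightarrow> ph z = 0" for ph phx pht k
      using kr[OF that(1), of k] that(2)[of "(_, 0)"] by simp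
  qed
  moreover have "U (x, t) = (LBINT y=0..x. u0 y)" if t: "t \<le> 0" for x t
  proof -
    have "U (x, t) = (LBINT y=0..x. v0 y)"
      by (rule potential_initial[OF bf U past t])
    also have "\<dots> = (LBINT y=0..x. u0 y)"
      by (rule interval_integral_cong_AE) (use ae_0 in \<open>auto elim: eventually_mono\<close>)
    finally show ?thesis .
  qed
  ultimately show thesis using that ae_u by blast
qed

section \<open>Bounds, comparison and slopes of potentials\<close>

lemma interior_future: "z \<notin> interior {z::real\<times>real. 0 \<le> snd z} \<Longrightarrow> snd z \<le> 0"
proof -
  have "open {z::real\<times>real. 0 < snd z}" by (intro open_Collect_less continuous_intros)
  then have "{z::real\<times>real. 0 < snd z} \<subseteq> interior {z. 0 \<le> snd z}" by (intro interior_maximal) auto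
  then show "z \<notin> interior {z::real\<times>real. 0 \<le> snd z} \<Longrightarrow> snd z \<le> 0" by force
qed

context entropy_field
begin

text \<open>The affine function is an exact smooth solution, so \<open>comparison\<close> applies on
  the half-plane, whose boundary is the initial line.\<close>

lemma linear_lower_bound:
  assumes init: "\<And>x. k * x \<le> U (x, 0)" and t: "0 \<le> t"
  shows "k * x - f k * t \<le> U (x, t)"
proof -
  let ?N = "\<bar>k\<bar> + \<bar>f k\<bar>"
  have "(\<lambda>z. k * fst z - f k * snd z) (x, t) \<le> U (x, t)"
  proof (rule comparison[where \<phi>x="\<lambda>_. k" and \<phi>t="\<lambda>_. - f k" and N="?N" and Q="{z. 0 \<le> snd z}"])
    show "((\<lambda>z. k * fst z - f k * snd z) has_derivative (\<lambda>(h, l). k * h + - f k * l)) (at z)" for z :: "real \<times> real"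
      by (auto intro!: derivative_eq_intros)
    show "lip_const ?N (\<lambda>z. k * fst z - f k * snd z)"
      unfolding lip_const_def
    proof (intro allI)
      fix z v :: "real \<times> real"
      have "\<bar>k * fst (z + v) - f k * snd (z + v) - (k * fst z - f k * snd z)\<bar> = \<bar>k * fst v - f k * snd v\<bar>"
        by (simp add: algebra_simps)
      also have "\<dots> \<le> \<bar>k\<bar> * \<bar>fst v\<bar> + \<bar>f k\<bar> * \<bar>snd v\<bar>" by (metis abs_mult abs_triangle_ineq4)
      also have "\<dots> \<le> ?N * \<bar>fst v\<bar> + ?N * \<bar>snd v\<bar>" by (intro add_mono mult_right_mono) auto
      finally show "\<bar>k * fst (z + v) - f k * snd (z + v) - (k * fst z - f k * snd z)\<bar> \<le> ?N * (\<bar>fst v\<bar> + \<bar>snd v\<bar>)"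
        by (simp add: distrib_left)
    qed
    show "k * fst z - f k * snd z \<le> U z" if "z \<in> {z. 0 \<le> snd z}" "z \<notin> interior {z. 0 \<le> snd z}" for z
    proof -
      have "snd z = 0" using that interior_future[OF that(2)] by simp
      then show ?thesis using init[of "fst z"] by (cases z) simp
    qed
  qed (use t in \<open>auto intro!: closed_Collect_le continuous_intros\<close>)
  then show ?thesis by simp
qed

lemma avg_tendsto_right: "((\<lambda>e. avg e U z) \<longlongrightarrow> U z) (at_right 0)"
proof (rule LIM_zero_cancel, rule Lim_null_comparison)
  show "\<forall>\<^sub>F e in at_right 0. norm (avg e U z - U z) \<le> 2 * M * e"
    using lip_const_avg_near[OF U_lip] by (auto simp: eventually_at_filter)
  show "((\<lambda>e. 2 * M * e) \<longlongrightarrow> 0) (at_right 0)"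
    by (auto intro!: tendsto_eq_intros)
qed

text \<open>The tangent inequality gives
  \<open>f' k * a - b \<le> f' k * a - f a \<le> k * f' k - f k\<close> for averaged
  \<open>a\<close> and \<open>b\<close>: along a line of speed \<open>f' k\<close> the potential
  grows at most at the rate given by the Legendre transform of \<open>f\<close>.\<close>

lemma ray_upper_bound:
  assumes t: "0 \<le> t"
  shows "U (f' k * t, t) \<le> U 0 + (k * (f' k * t) - f k * t)"
proof -
  let ?v = "(f' k * t, t)" and ?d = "k * (f' k * t) - f k * t"
  interpret u: prob_space unit_meas by (rule prob_space_unit_meas)
  have "avg e U ?v - avg e U 0 \<le> ?d" if e: "e > 0" for e
  proof -
    have [measurable]: "avg e (pairing ?v) \<in> borel_measurable borel" by (rule avg_measurable[OF e]) simp
    have bd: "\<bar>avg e (pairing ?v) w\<bar> \<le> M * (\<bar>fst ?v\<bar> + \<bar>snd ?v\<bar>)" for w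
      by (rule avg_bound[OF e pairing_measurable pairing_bound])
    have i: "integrable unit_meas (\<lambda>s. avg e (pairing ?v) (0 + s *\<^sub>R ?v))"
      by (rule u.integrable_const_bound[of _ "M * (\<bar>fst ?v\<bar> + \<bar>snd ?v\<bar>)"]) (use bd in auto)
    have "AE s in unit_meas. s \<in> {0..1}" unfolding unit_meas_def by (rule AE_uniform_measureI) auto
    then have "AE s in unit_meas. avg e (pairing ?v) (0 + s *\<^sub>R ?v) \<le> ?d"
    proof eventually_elim
      case (elim s)
      let ?z = "0 + s *\<^sub>R ?v"
      have "f (avg e a ?z) \<le> avg e b ?z" using t elim by (intro avg_subsolution e) simp
      moreover have "f k + f' k * (avg e a ?z - k) \<le> f (avg e a ?z)" by (rule tangent)
      ultimately have "(f k + f' k * (avg e a ?z - k)) * t \<le> avg e b ?z * t" using t by (intro mult_right_mono) auto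
      then show ?case unfolding avg_pairing[OF e] by (simp add: algebra_simps)
    qed
    from u.integral_le_const[OF i this] show ?thesis
      using increment_avg[OF e avg_U_deriv[OF e], of 0 ?v] by simp
  qed
  then have "eventually (\<lambda>e. avg e U ?v - avg e U 0 \<le> ?d) (at_right 0)" by (auto simp: eventually_at_filter)
  from tendsto_upperbound[OF tendsto_diff[OF avg_tendsto_right avg_tendsto_right] this]
  show ?thesis by simp
qed

text \<open>The average of \<open>U\<close> exceeds \<open>U\<close> by at most
  \<open>2 * M * e\<close>. Subtracting this leaves a smooth subsolution that still obeys the
  boundary inequality; then \<open>e\<close> tends to zero.\<close>

lemma compare_potentials:
  assumes V: "entropy_field M' a' b' f f' V"
    and Q: "closed Q" "\<And>z. z \<in> Q \<Longrightarrow> 0 \<le> snd z"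
    and bd: "\<And>z. z \<in> Q \<Longrightarrow> z \<notin> interior Q \<Longrightarrow> U z \<le> V z" and z: "z \<in> Q"
  shows "U z \<le> V z"
proof -
  interpret V: entropy_field M' a' b' f f' V by (rule V)
  have "avg e U z - 2 * M * e \<le> V z" if e: "e > 0" for e
  proof (rule V.comparison[where \<phi>="\<lambda>z. avg e U z - 2 * M * e" and \<phi>x="avg e a" and \<phi>t="\<lambda>z. - avg e b z" and N=M and Q=Q])
    show "((\<lambda>z. avg e U z - 2 * M * e) has_derivative (\<lambda>(h, k). avg e a z * h + - avg e b z * k)) (at z)" for z
      using has_derivative_diff[OF avg_U_deriv[OF e, of z] has_derivative_const[of "2 * M * e"]]
      by (simp add: case_prod_beta')
    show "continuous_on UNIV (avg e a)" "continuous_on UNIV (\<lambda>z. - avg e b z)"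
      by (auto intro!: continuous_intros continuous_avg[OF e _ a_bound] continuous_avg[OF e _ b_bound])
    show "lip_const M (\<lambda>z. avg e U z - 2 * M * e)"
      using lip_const_avg_potential[OF e avg_U_deriv[OF e]] by (simp add: lip_const_def)
    show "\<bar>avg e a z\<bar> \<le> M" for z by (rule avg_bound[OF e a_meas a_bound])
    show "- avg e b z + f (avg e a z) \<le> 0" if "z \<in> Q" for z
      using avg_subsolution[OF e Q(2)[OF that]] by simp
    show "avg e U z - 2 * M * e \<le> V z" if "z \<in> Q" "z \<notin> interior Q" for z
      using bd[OF that] lip_const_avg_near[OF U_lip e, of z] by linarith
  qed (use Q z in auto)
  then have ev: "eventually (\<lambda>e. avg e U z - 2 * M * e \<le> V z) (at_right 0)" by (auto simp: eventually_at_filter)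
  have "((\<lambda>e. avg e U z - 2 * M * e) \<longlongrightarrow> U z - 2 * M * 0) (at_right 0)"
    by (intro tendsto_intros avg_tendsto_right)
  from tendsto_upperbound[OF this ev] show ?thesis by simp
qed

lemma AE_avg_slope_tendsto: "AE z in lborel. ((\<lambda>e. avg e a z) \<longlongrightarrow> a z) (at_right 0)"
  by (rule AE_avg_tendsto[OF a_meas a_bound])

text \<open>Chord bounds are preserved by averaging, and the derivative of the average is a limit of
  chords. \<open>4 * e < r\<close> and \<open>2 * h < r\<close> keep both ends of each translated
  chord in \<open>G\<close>.\<close>

lemma avg_slope_between:
  assumes G: "open G" "z \<in> G"
    and sl: "\<And>z h. z \<in> G \<Longrightarrow> z + (h, 0) \<in> G \<Longrightarrow> 0 < h \<Longrightarrow> c * h \<le> U (z + (h, 0)) - U z \<and> U (z + (h, 0)) - U z \<le> d * h"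
  shows "eventually (\<lambda>e. c \<le> avg e a z \<and> avg e a z \<le> d) (at_right 0)"
proof -
  obtain r where r: "r > 0" "\<And>w. norm (w - z) < r \<Longrightarrow> w \<in> G"
    using G unfolding open_dist by (metis dist_norm)
  have "c \<le> avg e a z \<and> avg e a z \<le> d" if e: "e > 0" "4 * e < r" for e
  proof -
    have "((\<lambda>h. z + (h, 0)) has_derivative (\<lambda>h. (h, 0))) (at (0::real))" by (auto intro!: derivative_eq_intros)
    moreover have "(avg e U has_derivative (\<lambda>(h, k). avg e a z * h - avg e b z * k)) (at (z + (0, 0)))"
      using avg_U_deriv[OF e(1), of z] by (simp add: zero_prod_def[symmetric])
    ultimately have "((\<lambda>h. avg e U (z + (h, 0))) has_derivative (\<lambda>h. avg e a z * h)) (at 0)"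
      by (rule has_derivative_eq_rhs[OF has_derivative_compose]) (simp add: fun_eq_iff)
    then have "((\<lambda>h. avg e U (z + (h, 0))) has_real_derivative avg e a z) (at 0)"
      by (simp add: has_field_derivative_def)
    then have "((\<lambda>h. (avg e U (z + (h, 0)) - avg e U z) / h) \<longlongrightarrow> avg e a z) (at 0)"
      by (simp add: DERIV_def zero_prod_def[symmetric])
    then have lim: "((\<lambda>h. (avg e U (z + (h, 0)) - avg e U z) / h) \<longlongrightarrow> avg e a z) (at_right 0)"
      by (rule tendsto_within_subset) simp
    have "c \<le> (avg e U (z + (h, 0)) - avg e U z) / h \<and> (avg e U (z + (h, 0)) - avg e U z) / h \<le> d"
      if h: "0 < h" "2 * h < r" for h
    proof -
      have "avg e U (z + (h, 0)) - avg e U z = avg e (\<lambda>z. U (z + (h, 0)) - U z) z"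
        using lip_const_avg_integrable[OF U_lip e(1), of "z + (h, 0)"] lip_const_avg_integrable[OF U_lip e(1), of z]
        by (subst avg_diff) (auto simp: avg_shift ac_simps)
      moreover have "c * h \<le> avg e (\<lambda>z. U (z + (h, 0)) - U z) z \<and> avg e (\<lambda>z. U (z + (h, 0)) - U z) z \<le> d * h"
      proof (rule avg_between[OF e(1)])
        have [measurable]: "U \<in> borel_measurable borel" by (rule lip_const_measurable[OF U_lip])
        show "(\<lambda>z. U (z + (h, 0)) - U z) \<in> borel_measurable borel" by measurable
        fix w assume "w \<in> box 0 (e, e)"
        then have w: "norm w \<le> 2 * e" by (rule norm_le_box_zero_pair)
        have "z + w \<in> G" using w e by (intro r(2)) simp
        moreover have "norm (z + w + (h, 0) - z) \<le> norm w + norm (h, 0::real)"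
          using norm_triangle_ineq[of w "(h, 0)"] by (simp add: algebra_simps)
        then have "z + w + (h, 0) \<in> G" using w e h by (intro r(2)) simp
        ultimately show "c * h \<le> U (z + w + (h, 0)) - U (z + w) \<and> U (z + w + (h, 0)) - U (z + w) \<le> d * h"
          using h(1) by (rule sl)
      qed
      ultimately show ?thesis using h(1) by (simp add: field_simps)
    qed
    then have "eventually (\<lambda>h. c \<le> (avg e U (z + (h, 0)) - avg e U z) / h \<and> (avg e U (z + (h, 0)) - avg e U z) / h \<le> d) (at_right 0)"
      unfolding eventually_at_right_field using r(1) by (intro exI[of _ "r / 2"]) auto
    then have "eventually (\<lambda>h. c \<le> (avg e U (z + (h, 0)) - avg e U z) / h) (at_right 0)"
      "eventually (\<lambda>h. (avg e U (z + (h, 0)) - avg e U z) / h \<le> d) (at_right 0)"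
      by (auto elim: eventually_mono)
    then show ?thesis
      using tendsto_lowerbound[OF lim] tendsto_upperbound[OF lim] by simp
  qed
  then show ?thesis unfolding eventually_at_right_field using r(1) by (intro exI[of _ "r / 4"]) auto
qed

text \<open>Equality on an open set carries over to averages over small boxes, hence to their
  derivatives, and by Lebesgue differentiation to the slopes.\<close>

lemma slope_unique:
  assumes V: "entropy_field M' a' b' f f' V" and G: "open G" and eq: "\<And>z. z \<in> G \<Longrightarrow> U z = V z"
  shows "AE z in lborel. z \<in> G \<longrightarrow> a z = a' z"
proof -
  interpret V: entropy_field M' a' b' f f' V by (rule V)
  have ev: "eventually (\<lambda>e. avg e a z = avg e a' z) (at_right 0)" if z: "z \<in> G" for z
  proof -
    obtain r where r: "r > 0" "\<And>w. norm (w - z) < r \<Longrightarrow> w \<in> G"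
      using G z unfolding open_dist by (metis dist_norm)
    have "avg e a z = avg e a' z" if e: "e > 0" "4 * e < r" for e
    proof -
      have loc: "avg e U w = avg e V w" if "w \<in> ball z (r / 2)" for w
      proof (rule avg_cong_AE[OF e(1) lip_const_measurable[OF U_lip] lip_const_measurable[OF V.U_lip]], intro AE_I2 impI)
        fix y assume "y - w \<in> box 0 (e, e)"
        then have "norm (y - w) \<le> 2 * e" by (rule norm_le_box_zero_pair)
        moreover have "norm (w - z) < r / 2" using that by (simp add: dist_norm norm_minus_commute)
        ultimately have "norm (y - z) < r" using e norm_triangle_ineq[of "y - w" "w - z"] by simp
        then show "U y = V y" by (intro eq r(2))
      qed
      have "(avg e V has_derivative (\<lambda>(h, k). avg e a z * h - avg e b z * k)) (at z)"
        by (rule has_derivative_transform_within_open[OF avg_U_deriv[OF e(1)] open_ball[of z "r / 2"]])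
          (use r(1) loc in auto)
      from has_derivative_unique[OF this V.avg_U_deriv[OF e(1)]]
      have "(\<lambda>(h, k). avg e a z * h - avg e b z * k) = (\<lambda>(h, k). avg e a' z * h - avg e b' z * k)" .
      from fun_cong[OF this, of "(1, 0)"] show ?thesis by simp
    qed
    then show ?thesis unfolding eventually_at_right_field using r(1) by (intro exI[of _ "r / 4"]) auto
  qed
  show ?thesis using AE_avg_slope_tendsto V.AE_avg_slope_tendsto
  proof eventually_elim
    case (elim z)
    show ?case
    proof
      assume "z \<in> G"
      from ev[OF this] have "((\<lambda>e. avg e a' z) \<longlongrightarrow> a z) (at_right 0)"
        using elim(1) by (rule tendsto_cong[THEN iffD1])
      then show "a z = a' z" using elim(2) by (rule tendsto_unique[rotated]) simp
    qed
  qed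
qed

end

section \<open>The rarefaction fan\<close>

text \<open>Discarding the two rays that bound the fan leaves only strict inequalities in the final
  case distinction.\<close>

lemma AE_not_on_ray: "AE z in lborel. fst z \<noteq> s * snd (z :: real \<times> real)"
proof -
  have "negligible {z::real\<times>real. (1, - s) \<bullet> z = 0}" by (rule negligible_hyperplane) (simp add: zero_prod_def)
  then have "{z::real\<times>real. (1, - s) \<bullet> z = 0} \<in> null_sets lebesgue" by (simp add: negligible_iff_null_sets)
  moreover have "closed {z::real\<times>real. (1, - s) \<bullet> z = 0}" by (rule closed_hyperplane)
  ultimately have "{z::real\<times>real. (1, - s) \<bullet> z = 0} \<in> null_sets lborel"
    by (metis null_sets_completion_iff borel_closed sets_lborel)
  then have "AE z in lborel. z \<notin> {z::real\<times>real. (1, - s) \<bullet> z = 0}" by (rule AE_not_in)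
  then show ?thesis by eventually_elim (auto simp: inner_prod_def)
qed

lemma interval_integrable_Linfty:
  fixes w :: "real \<Rightarrow> real"
  assumes "Linfty w"
  shows "interval_lebesgue_integrable lborel (ereal x) (ereal y) w"
proof -
  obtain B where B: "AE x in lborel. \<bar>w x\<bar> \<le> B" using assms by (auto simp: Linfty_def)
  have [measurable]: "w \<in> borel_measurable borel" using assms by (simp add: Linfty_def)
  have "set_integrable lborel (einterval (ereal p) (ereal q)) w" for p q
    unfolding set_integrable_def einterval_eq
    by (rule integrableI_bounded_set_indicator[of _ _ _ B])
      (use B emeasure_lborel_box_finite[of p q] in \<open>auto elim: eventually_mono\<close>)
  then show ?thesis by (simp add: interval_lebesgue_integrable_def)
qed

text \<open>Zero mean makes the primitive periodic, and a translation by a multiple of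
  \<open>p\<close> brings \<open>x\<close> into the first period.\<close>

lemma periodic_primitive_nonneg:
  fixes w :: "real \<Rightarrow> real" and p x :: real
  assumes Linf: "Linfty w" and p: "p > 0" and per: "\<And>x. w (x + p) = w x"
    and mean: "(LBINT y=0..p. w y) = 0" and prim: "\<And>x::real. 0 \<le> x \<Longrightarrow> x \<le> p \<Longrightarrow> (LBINT y=0..x. w y) \<ge> 0"
  shows "(LBINT y=0..x. w y) \<ge> 0"
proof -
  define W where "W x = (LBINT y=0..x. w y)" for x :: real
  have add: "(LBINT y=a..b. w y) + (LBINT y=b..c. w y) = (LBINT y=a..c. w y)" for a b c :: real
    by (rule interval_integral_sum) (metis interval_integrable_Linfty[OF Linf] ereal_min ereal_max)
  have shift: "(LINT y:{c+p..d+p}|lborel. w y) = (LINT y:{c..d}|lborel. w (y + p))" for c d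
    unfolding set_lebesgue_integral_def
    by (subst lborel_integral_real_affine[of 1 _ p])
      (auto intro!: Bochner_Integration.integral_cong simp: indicator_def add.commute)
  have "W (x + p) = W x" for x
  proof -
    have "(LBINT y=ereal p..ereal (x + p). w y) = (LBINT y=ereal 0..ereal x. w (y + p))"
    proof (cases "0 \<le> x")
      case True
      then show ?thesis using shift[of 0 x] by (simp add: interval_integral_Icc)
    next
      case False
      then have "(LBINT y=ereal (x + p)..ereal p. w y) = (LBINT y=ereal x..ereal 0. w (y + p))"
        using shift[of x 0] by (simp add: interval_integral_Icc)
      then show ?thesis
        by (subst (1 2) interval_integral_endpoints_reverse) simp
    qed
    then show ?thesis using add[of 0 p "x + p"] mean by (simp add: W_def per zero_ereal_def)
  qed
  note step = this
  have nat: "W (x + real n * p) = W x" for x n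
    by (induction n) (use step in \<open>auto simp: algebra_simps\<close>, metis add.assoc add.commute step)
  have int: "W (x + of_int n * p) = W x" for x n
  proof (cases "n \<ge> 0")
    case True
    then show ?thesis using nat[of x "nat n"] by simp
  next
    case False
    then show ?thesis using nat[of "x + of_int n * p" "nat (- n)"] by simp
  qed
  define n where "n = \<lfloor>x / p\<rfloor>"
  have n: "of_int n \<le> x / p" "x / p < of_int n + 1" by (auto simp: n_def)
  then have "0 \<le> x - of_int n * p" "x - of_int n * p \<le> p" using p by (auto simp: field_simps)
  then have "0 \<le> W (x - of_int n * p)" unfolding W_def by (rule prim)
  then show ?thesis using int[of "x - of_int n * p" n] by (simp add: W_def)
qed

theorem theorem4:
  fixes f f' f'' :: "real \<Rightarrow> real"
    and ul ur p :: real
    and w0 :: "real \<Rightarrow> real"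
    and u uL uR :: "real \<Rightarrow> real \<Rightarrow> real"
  assumes f_deriv: "\<And>v. (f has_real_derivative f' v) (at v)"
    and f'_deriv: "\<And>v. (f' has_real_derivative f'' v) (at v)"
    and f''_cont: "continuous_on UNIV f''"
    and f''_pos: "\<And>v. f'' v > 0"
    and ul_ur: "ul < ur"
    and p_pos: "p > 0"
    and w0_Linfty: "Linfty w0"
    and w0_periodic: "\<And>x. w0 (x + p) = w0 x"
    and w0_mean: "(LBINT y=0..p. w0 y) = 0"
    and w0_prim: "\<And>x. 0 \<le> x \<Longrightarrow> x \<le> p \<Longrightarrow> (LBINT y=0..x. w0 y) \<ge> 0"
    and u_sol: "entropy_solution f (\<lambda>x. if x < 0 then ul + w0 x else ur + w0 x) u"
    and uL_sol: "entropy_solution f (\<lambda>x. ul + w0 x) uL"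
    and uR_sol: "entropy_solution f (\<lambda>x. ur + w0 x) uR"
  shows "AE z in lborel. snd z > 0 \<longrightarrow>
           (let x = fst z; t = snd z in
             u x t = (if x / t < f' ul then uL x t
                      else if x / t \<le> f' ur then the_inv f' (x / t)
                      else uR x t))"
proof -
  have mono: "f' v < f' w" if "v < w" for v w
    by (rule DERIV_pos_imp_increasing[OF that]) (use f'_deriv f''_pos in blast)
  have f'_cont: "continuous_on UNIV f'" using f'_deriv by (auto intro!: continuous_at_imp_continuous_on DERIV_isCont)
  have tangent: "f k + f' k * (v - k) \<le> f v" for k v
    using f''_imp_f'[of UNIV f f' f'' k v] f_deriv f'_deriv f''_pos by (simp add: less_imp_le)
  have inj: "inj f'" by (rule injI) (metis mono linorder_neq_iff)
  define W where "W x = (LBINT y=0..x. w0 y)" for x :: real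
  have W0: "0 \<le> W x" for x
    unfolding W_def by (rule periodic_primitive_nonneg[OF w0_Linfty p_pos w0_periodic w0_mean w0_prim])
  obtain B where B: "AE x in lborel. \<bar>w0 x\<bar> \<le> B" using w0_Linfty by (auto simp: Linfty_def)
  have [measurable]: "w0 \<in> borel_measurable borel" using w0_Linfty by (simp add: Linfty_def)
  have Linf_c: "Linfty (\<lambda>x. c + w0 x)" for c
    unfolding Linfty_def
  proof (intro conjI exI[of _ "\<bar>c\<bar> + B"])
    show "AE x in lborel. \<bar>c + w0 x\<bar> \<le> \<bar>c\<bar> + B" using B by eventually_elim linarith
  qed measurable
  have Linf_u: "Linfty (\<lambda>x. if x < 0 then ul + w0 x else ur + w0 x)"
    unfolding Linfty_def
  proof (intro conjI exI[of _ "\<bar>ul\<bar> + \<bar>ur\<bar> + B"])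
    show "AE x in lborel. \<bar>if x < 0 then ul + w0 x else ur + w0 x\<bar> \<le> \<bar>ul\<bar> + \<bar>ur\<bar> + B"
      using B by eventually_elim (simp split: if_split, linarith)
  qed measurable
  obtain M a b U where E: "entropy_field M a b f f' U"
    and u: "AE z in lborel. snd z > 0 \<longrightarrow> u (fst z) (snd z) = a z"
    and init: "\<And>x t. t \<le> 0 \<Longrightarrow> U (x, t) = (LBINT y=0..x. (if y < 0 then ul + w0 y else ur + w0 y))"
    by (rule entropy_solution_field[OF f_deriv f'_cont tangent Linf_u u_sol]) (rule that)
  obtain Ml aL bL UL where EL: "entropy_field Ml aL bL f f' UL"
    and uL: "AE z in lborel. snd z > 0 \<longrightarrow> uL (fst z) (snd z) = aL z"
    and initL: "\<And>x t. t \<le> 0 \<Longrightarrow> UL (x, t) = (LBINT y=0..x. ul + w0 y)"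
    by (rule entropy_solution_field[OF f_deriv f'_cont tangent Linf_c uL_sol]) (rule that)
  obtain Mr aR bR UR where ER: "entropy_field Mr aR bR f f' UR"
    and uR: "AE z in lborel. snd z > 0 \<longrightarrow> uR (fst z) (snd z) = aR z"
    and initR: "\<And>x t. t \<le> 0 \<Longrightarrow> UR (x, t) = (LBINT y=0..x. ur + w0 y)"
    by (rule entropy_solution_field[OF f_deriv f'_cont tangent Linf_c uR_sol]) (rule that)
  interpret entropy_field M a b f f' U by (rule E)
  interpret L: entropy_field Ml aL bL f f' UL by (rule EL)
  interpret R: entropy_field Mr aR bR f f' UR by (rule ER)
  have int_c: "(LBINT y=0..x. c + w0 y) = c * x + W x" for c x :: real
  proof -
    have "(LBINT y=ereal 0..ereal x. c + w0 y) = (LBINT y=ereal 0..ereal x. c) + (LBINT y=ereal 0..ereal x. w0 y)"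
      by (rule interval_lebesgue_integral_add(2)) (auto intro: interval_integrable_Linfty[OF w0_Linfty])
    then show ?thesis by (simp add: W_def zero_ereal_def mult.commute)
  qed
  have U_left: "U (x, 0) = ul * x + W x" if "x \<le> 0" for x
  proof -
    have "(LBINT y=0..x. (if y < 0 then ul + w0 y else ur + w0 y)) = (LBINT y=0..x. ul + w0 y)"
      by (rule interval_integral_cong) (use that in \<open>auto simp: einterval_def zero_ereal_def min_def max_def split: if_splits\<close>)
    then show ?thesis using init[of 0 x] int_c by simp
  qed
  have U_right: "U (x, 0) = ur * x + W x" if "0 \<le> x" for x
  proof -
    have "(LBINT y=0..x. (if y < 0 then ul + w0 y else ur + w0 y)) = (LBINT y=0..x. ur + w0 y)"
      by (rule interval_integral_cong) (use that in \<open>auto simp: einterval_def zero_ereal_def min_def max_def split: if_splits\<close>)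
    then show ?thesis using init[of 0 x] int_c by simp
  qed
  have UL_init: "UL (x, 0) = ul * x + W x" and UR_init: "UR (x, 0) = ur * x + W x" for x
    using initL[of 0 x] initR[of 0 x] int_c by simp_all
  have zero: "U 0 = 0" "UL 0 = 0" "UR 0 = 0"
    using init[of 0 0] initL[of 0 0] initR[of 0 0] by (simp_all add: zero_prod_def zero_ereal_def)
  have U_ge: "k * x - f k * t \<le> U (x, t)" if "ul \<le> k" "k \<le> ur" "0 \<le> t" for k x t
  proof (rule linear_lower_bound[OF _ that(3)])
    fix x show "k * x \<le> U (x, 0)"
    proof (cases "0 \<le> x")
      case True
      then show ?thesis using U_right[OF True] W0[of x] mult_right_mono[OF that(2) True] by linarith
    next
      case False
      then have "k * x \<le> ul * x" using that(1) by (intro mult_right_mono_neg) auto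
      then show ?thesis using U_left[of x] False W0[of x] by linarith
    qed
  qed
  \<comment> \<open>For a single background state only its own slope keeps the line below the data
    on both sides. This gives one ray for each of \<open>UL\<close> and \<open>UR\<close>, the one
    bounding the region of comparison.\<close>
  have UL_ge: "ul * x - f ul * t \<le> UL (x, t)" and UR_ge: "ur * x - f ur * t \<le> UR (x, t)" if "0 \<le> t" for x t
    using L.linear_lower_bound[of ul, OF _ that] R.linear_lower_bound[of ur, OF _ that] W0 UL_init UR_init by simp_all
  have U_ray: "U (f' k * t, t) = k * (f' k * t) - f k * t" if "ul \<le> k" "k \<le> ur" "0 \<le> t" for k t
    using U_ge[OF that] ray_upper_bound[OF that(3), of k] zero by (intro antisym) auto
  have UL_ray: "UL (f' ul * t, t) = ul * (f' ul * t) - f ul * t" and UR_ray: "UR (f' ur * t, t) = ur * (f' ur * t) - f ur * t"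
    if "0 \<le> t" for t
    using UL_ge[OF that] UR_ge[OF that] L.ray_upper_bound[OF that, of ul] R.ray_upper_bound[OF that, of ur] zero
    by (auto intro!: antisym)

  \<comment> \<open>Comparison runs on the closed sectors, which contain their boundary values;
    slopes are identified on the open ones.\<close>
  define QL where "QL = {z::real\<times>real. 0 \<le> snd z \<and> fst z \<le> f' ul * snd z}"
  define GL where "GL = {z::real\<times>real. 0 < snd z \<and> fst z < f' ul * snd z}"
  define QR where "QR = {z::real\<times>real. 0 \<le> snd z \<and> f' ur * snd z \<le> fst z}"
  define GR where "GR = {z::real\<times>real. 0 < snd z \<and> f' ur * snd z < fst z}"
  have closed: "closed QL" "closed QR"
    unfolding QL_def QR_def by (intro closed_Collect_conj closed_Collect_le continuous_intros)+
  have opn: "open GL" "open GR"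
    unfolding GL_def GR_def by (intro open_Collect_conj open_Collect_less continuous_intros)+
  have sub: "GL \<subseteq> interior QL" "GR \<subseteq> interior QR"
    by (intro interior_maximal opn; auto simp: GL_def QL_def GR_def QR_def)+
  \<comment> \<open>A boundary point lies on the ray, where both potentials are explicit, or on the
    half-line at time zero left of the origin, where their data coincide.\<close>
  have bdL: "U z = UL z" if "z \<in> QL" "z \<notin> interior QL" for z
  proof (cases "fst z = f' ul * snd z")
    case True
    then show ?thesis using U_ray[of ul "snd z"] UL_ray[of "snd z"] that(1) ul_ur by (cases z) (auto simp: QL_def)
  next
    case False
    moreover have "z \<notin> GL" using that(2) sub(1) by blast
    ultimately have "snd z = 0" "fst z \<le> 0" using that(1) by (auto simp: QL_def GL_def intro: ccontr)
    then show ?thesis using U_left[of "fst z"] UL_init[of "fst z"] by (cases z) simp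
  qed
  have bdR: "U z = UR z" if "z \<in> QR" "z \<notin> interior QR" for z
  proof (cases "fst z = f' ur * snd z")
    case True
    then show ?thesis using U_ray[of ur "snd z"] UR_ray[of "snd z"] that(1) ul_ur by (cases z) (auto simp: QR_def)
  next
    case False
    moreover have "z \<notin> GR" using that(2) sub(2) by blast
    ultimately have "snd z = 0" "fst z \<ge> 0" using that(1) by (auto simp: QR_def GR_def intro: ccontr)
    then show ?thesis using U_right[of "fst z"] UR_init[of "fst z"] by (cases z) simp
  qed
  have tL: "0 \<le> snd z" if "z \<in> QL" for z using that by (simp add: QL_def)
  have tR: "0 \<le> snd z" if "z \<in> QR" for z using that by (simp add: QR_def)
  have eqL: "U z = UL z" if "z \<in> QL" for z
    using compare_potentials[OF EL closed(1) tL eq_refl[OF bdL] that]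
      L.compare_potentials[OF E closed(1) tL eq_refl[OF bdL[symmetric]] that] by simp
  have eqR: "U z = UR z" if "z \<in> QR" for z
    using compare_potentials[OF ER closed(2) tR eq_refl[OF bdR] that]
      R.compare_potentials[OF E closed(2) tR eq_refl[OF bdR[symmetric]] that] by simp
  have aeL: "AE z in lborel. z \<in> GL \<longrightarrow> a z = aL z"
    by (rule slope_unique[OF EL opn(1) eqL]) (use sub interior_subset in blast)
  have aeR: "AE z in lborel. z \<in> GR \<longrightarrow> a z = aR z"
    by (rule slope_unique[OF ER opn(2) eqR]) (use sub interior_subset in blast)

  \<comment> \<open>In the fan \<open>U\<close> is given ray by ray. Instead of differentiating a
    Legendre transform, chords between two rays are estimated and the averaged slope is squeezed
    towards \<open>k\<close>.\<close>
  have fan: "((\<lambda>e. avg e a z) \<longlongrightarrow> k) (at_right 0)"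
    if k: "ul < k" "k < ur" and z: "0 < snd z" "fst z = f' k * snd z" for k z
  proof (rule order_tendstoI)
    have main: "eventually (\<lambda>e. c \<le> avg e a z \<and> avg e a z \<le> d) (at_right 0)"
      if cd: "ul \<le> c" "c < k" "k < d" "d \<le> ur" for c d
    proof (rule avg_slope_between)
      let ?G = "{z::real\<times>real. 0 < snd z \<and> f' c * snd z < fst z \<and> fst z < f' d * snd z}"
      show "open ?G" by (intro open_Collect_conj open_Collect_less continuous_intros)
      show "z \<in> ?G" using z mono[OF cd(2)] mono[OF cd(3)] by simp
      have ex: "\<exists>q\<ge>c. q \<le> d \<and> fst y = f' q * snd y" if "y \<in> ?G" for y
      proof -
        have "f' c \<le> fst y / snd y" "fst y / snd y \<le> f' d" using that by (auto simp: field_simps)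
        moreover have "\<forall>x. c \<le> x \<and> x \<le> d \<longrightarrow> isCont f' x" using f'_deriv by (auto intro: DERIV_isCont)
        moreover have "c \<le> d" using cd by simp
        ultimately obtain q where "c \<le> q" "q \<le> d" "f' q = fst y / snd y" using IVT[of f' c "fst y / snd y" d] by blast
        then show ?thesis using that by (intro exI[of _ q]) (auto simp: field_simps)
      qed
      fix y and h :: real assume y: "y \<in> ?G" "y + (h, 0) \<in> ?G" "0 < h"
      obtain q1 where q1: "c \<le> q1" "q1 \<le> d" "fst y = f' q1 * snd y" using ex[OF y(1)] by blast
      obtain q2 where q2: "c \<le> q2" "q2 \<le> d" "fst (y + (h, 0)) = f' q2 * snd (y + (h, 0))" using ex[OF y(2)] by blast
      have t: "0 \<le> snd y" using y(1) by simp
      have 1: "U y = q1 * fst y - f q1 * snd y"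
        using U_ray[of q1 "snd y"] q1 cd t by (metis order_trans prod.collapse)
      have 2: "U (y + (h, 0)) = q2 * (fst y + h) - f q2 * snd y"
      proof -
        have "f' q2 * snd y = fst y + h" using q2(3) by simp
        moreover have "y + (h, 0) = (fst y + h, snd y)" by (cases y) simp
        ultimately show ?thesis using U_ray[of q2 "snd y"] q2 cd t by simp
      qed
      \<comment> \<open>Each affine lower bound touches \<open>U\<close> at one end of the chord and
        stays below it at the other, so the increment lies between \<open>q1 * h\<close> and
        \<open>q2 * h\<close>.\<close>
      have 3: "q2 * fst y - f q2 * snd y \<le> U y"
        using U_ge[of q2 "snd y" "fst y"] q2 cd t by simp
      have 4: "q1 * (fst y + h) - f q1 * snd y \<le> U (y + (h, 0))"
        using U_ge[of q1 "snd y" "fst y + h"] q1 cd t by (cases y) simp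
      have "c * h \<le> q1 * h" "q2 * h \<le> d * h" using q1 q2 y(3) by (auto intro: mult_right_mono)
      then show "c * h \<le> U (y + (h, 0)) - U y \<and> U (y + (h, 0)) - U y \<le> d * h"
        using 1 2 3 4 by (simp add: algebra_simps)
    qed
    show "eventually (\<lambda>e. c < avg e a z) (at_right 0)" if "c < k" for c
    proof -
      \<comment> \<open>The midpoint makes the inequality strict; truncation at \<open>ul\<close>
        keeps the slope in the range where the affine bounds hold.\<close>
      have "ul \<le> max ul ((c + k) / 2)" "max ul ((c + k) / 2) < k" using k that by auto
      from main[OF this k(2)] show ?thesis using that by (auto elim!: eventually_mono)
    qed
    show "eventually (\<lambda>e. avg e a z < d) (at_right 0)" if "k < d" for d
    proof -
      have "k < min ur ((d + k) / 2)" "min ur ((d + k) / 2) \<le> ur" using k that by auto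
      from main[OF _ k(1) this] show ?thesis using that by (auto elim!: eventually_mono)
    qed
  qed
  show ?thesis
    using u uL uR aeL aeR AE_not_on_ray[of "f' ul"] AE_not_on_ray[of "f' ur"] AE_avg_slope_tendsto
  proof eventually_elim
    case (elim z)
    show ?case
    proof
      assume t: "0 < snd z"
      consider "fst z / snd z < f' ul" | "f' ul < fst z / snd z" "fst z / snd z < f' ur" | "f' ur < fst z / snd z"
        using elim(6,7) t by (metis linorder_neqE_linordered_idom nonzero_eq_divide_eq less_irrefl)
      then show "let x = fst z; t = snd z in u x t = (if x / t < f' ul then uL x t
                      else if x / t \<le> f' ur then the_inv f' (x / t) else uR x t)"
      proof cases
        case 1
        then have "z \<in> GL" using t by (simp add: GL_def field_simps)
        then show ?thesis using 1 elim(1,2,4) t by (simp add: Let_def)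
      next
        case 2
        have "\<forall>x. ul \<le> x \<and> x \<le> ur \<longrightarrow> isCont f' x" using f'_deriv by (auto intro: DERIV_isCont)
        then obtain k where k: "ul \<le> k" "k \<le> ur" "f' k = fst z / snd z"
          using IVT[of f' ul "fst z / snd z" ur] 2 ul_ur by auto
        then have k': "ul < k" "k < ur" using 2 by (auto simp: less_le)
        have "fst z = f' k * snd z" using k(3) t by simp
        \<comment> \<open>\<open>k\<close> and \<open>a z\<close> are limits of the same averages,
          the first at every point of the open fan, the second at almost every point.\<close>
        from fan[OF k' t this] have "k = a z" using elim(8) by (rule tendsto_unique[rotated]) simp
        moreover have "the_inv f' (fst z / snd z) = k" using the_inv_f_f[OF inj, of k] k(3) by simp
        ultimately show ?thesis using 2 elim(1) t by (simp add: Let_def)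
      next
        case 3
        then have "z \<in> GR" using t by (simp add: GR_def field_simps)
        then show ?thesis using 3 elim(1,3,5) t mono[OF ul_ur] by (simp add: Let_def)
      qed
    qed
  qed
qed

end
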